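(* Let $K$ and $M$ be the matrices defined in the context, with $M_A$, $\widehat S$, $\widehat M_S$ symmetric positive definite, and let the quantities $\underline\mu,\bar\mu,\underline\nu,\bar\nu,\underline\varphi,\bar\varphi,\underline\omega,\bar\omega,\underline\phi,\bar\phi,\underline\gamma,\bar\gamma$, the functions $g_1,g_2,\varrho,\underline h_W,\bar h_W$ and the numbers $\widehat\xi,\xi_1$ be as defined in the context. Assume $0<\bar\mu\le2$, $0<\bar\nu\le2$ and $0<\bar\mu\bar\nu<2$. Then any eigenvalue $\lambda$ of $M^{-1}K$ satisfies $$\underline\eta\le \mathrm{Re}(\lambda)\le\bar\eta,\qquad |\mathrm{Im}(\lambda)|\le\rho,$$ where $\underline\eta$, $\bar\eta$ and $\rho\ge0$ are given as follows. Case $\bar\gamma\le1$: $$\underline\eta=\min\Big\{\underline\mu,\ \underline h_W(\bar\varphi)+\underline\phi(1-\bar\varphi),\ \frac{\underline\gamma\,\underline\nu}{g_1(\widehat\xi)}\Big\}g_1(\widehat\xi),$$ $$\bar\eta=\max\Big\{\bar\mu,\ \bar h_W(\bar\varphi)+\bar\phi(1-\underline\varphi),\ \frac{\bar\gamma\bar\nu}{g_2(\widehat\xi)}\Big\}g_2(\widehat\xi),$$ $$\rho^2=\bar\omega-\bar\phi+\bar\phi\,\varrho(\bar\gamma\bar\varphi,\underline\gamma\,\underline\varphi)+\bar\nu\,\lambda_{\max}\big((I-Y_AA)(I-Z_AA)M_A^{-1}A\big).$$ Case $\underline\gamma\ge1$: $$\underline\eta=\min\{\underline\mu g_1(\xi_1),\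 \underline\nu g_1(\xi_1),\ \underline h_W(\bar\mu\bar\varphi)+\underline\phi(1-\bar\mu\bar\varphi)\},$$ $$\bar\eta=\max\{\bar\mu g_2(\xi_1),\ \bar\nu g_2(\xi_1),\ \bar h_W(\bar\mu\bar\varphi)+\bar\phi(1-\underline\mu\,\underline\varphi)\},$$ $$\rho^2=\bar\omega-\bar\phi+\bar\phi\big((\bar\mu-1)\bar\mu\bar\varphi+\varrho(\bar\mu\bar\varphi,\underline\mu\,\underline\varphi)\big).$$ Case $\underline\gamma<1<\bar\gamma$: $$\underline\eta=\min\Big\{\underline\mu,\ \underline h_W(\bar\mu\bar\varphi)+\underline\phi(1-\bar\mu\bar\varphi),\ \frac{g_1(\xi_1)}{g_1(\widehat\xi)},\ \frac{\underline\mu\,\underline\nu\, g_1(\xi_1)}{g_1(\widehat\xi)}\Big\}g_1(\widehat\xi),$$ $$\bar\eta=\max\Big\{1,\ \bar h_W(\bar\mu\bar\varphi)+\bar\phi(1-\underline\varphi),\ \frac{\bar\mu g_2(\xi_1)}{g_2(\widehat\xi)},\ \frac{\bar\nu g_2(\xi_1)}{g_2(\widehat\xi)}\Big\}g_2(\widehat\xi),$$ $$\rho^2=\bar\omega-\bar\phi+\bar\phi\big((\bar\mu-1)\bar\mu\bar\varphi+\varrho(\bar\mu\bar\varphi,\underline\mu\,\underline\varphi)\big)+\bar\nu\,\lambda_{\max}\big(M_A^{-1}A(I-M_A^{-1}A)\big).$$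
   Context: Let $A\in\mathbb R^{n\times n}$ be symmetric positive definite (SPD), $B\in\mathbb R^{m\times n}$ have full row rank ($m\le n$), $D\in\mathbb R^{l\times l}$ be symmetric positive semi-definite, and $C\in\mathbb R^{l\times m}$, where $C$ has full row rank whenever $D$ is not SPD. Put $$K=\begin{pmatrix}A&B^T&0\\ B&0&C^T\\ 0&C&D\end{pmatrix},\qquad S=BA^{-1}B^T.$$ Let $M_A\in\mathbb R^{n\times n}$, $\widehat S\in\mathbb R^{m\times m}$, $\widehat M_S\in\mathbb R^{l\times l}$ be SPD matrices (thought of as approximations of $A$, $S$ and $M_S=D+CS^{-1}C^T$). Let $W_S\in\{0,\widehat S^{-1}\}$ and $Y_A,Z_A\in\{0,M_A^{-1}\}$ (chosen independently), and $$M=\begin{pmatrix}I&0&0\\ BY_A&I&0\\ 0&-CW_S&I\end{pmatrix}\begin{pmatrix}M_A&0&0\\ 0&-\widehat S&0\\ 0&0&\widehat M_S\end{pmatrix}\begin{pmatrix}I&Z_AB^T&0\\ 0&I&-W_SC^T\\ 0&0&I\end{pmatrix}.$$ $\lambda_{\min}(\cdot)$, $\lambda_{\max}(\cdot)$ denote the minimum and maximum eigenvalues; they are applied here to matrices all of whose eigenvalues are real. An underlined symbol denotes the minimum and a barred symbol the maximum eigenvalue of the following matrices: - $\underline\mu,\bar\mu$: of $M_A^{-1}A$; - $\underline\nu,\bar\nu$: of $\widehat S^{-1}S$; - $\underline\omega,\bar\omega$: of $\widehat M_S^{-1}C\widehat S^{-1}C^T$; - $\underline\tau,\bar\tau$: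 of $\widehat M_S^{-1}D$; - $\underline\varphi,\bar\varphi$: of $W_SS$; - $\underline\phi,\bar\phi$: of $\widehat M_S^{-1}CW_SC^T$; - $\underline\kappa,\bar\kappa$: of $\widehat M_S^{-1}(D+CW_SC^T)$; - $\underline\gamma,\bar\gamma$: of $Y_AA+Z_AA-Y_AAZ_AA$. Functions: $$g_1(s)=1+\tfrac12 s-\sqrt{\tfrac14s^2+s},\qquad g_2(s)=1+\tfrac12 s+\sqrt{\tfrac14s^2+s}\qquad(s\ge0),$$ $$\varrho(s,t)=\max\{(s-1)^2,(1-t)^2\}\qquad (s,t\ge0),$$ $$\underline h_W(t)=\begin{cases}\underline\kappa,&0\le t\le1,\\ \underline\tau+\underline\phi,&1<t\le2,\end{cases}\qquad \bar h_W(t)=\begin{cases}\bar\kappa,&0\le t\le1,\\ \bar\tau+\bar\phi,&1<t\le2.\end{cases}$$ Numbers: $$\widehat\xi=\frac{\bar\phi\bar\varphi(1-\underline\gamma)}{\underline\mu},\qquad \xi_1=\bar\nu-\frac{\bar\nu}{\bar\mu}.$$ *)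

theory Defs
  imports "HOL-Analysis.Analysis"
begin

definition spd :: "real^'n^'n \<Rightarrow> bool" where
  "spd A \<longleftrightarrow> transpose A = A \<and> (\<forall>x. x \<noteq> 0 \<longrightarrow> 0 < x \<bullet> (A *v x))"

definition spsd :: "real^'n^'n \<Rightarrow> bool" where
  "spsd A \<longleftrightarrow> transpose A = A \<and> (\<forall>x. 0 \<le> x \<bullet> (A *v x))"

definition eigenvalues :: "'a::field^'n^'n \<Rightarrow> 'a set" where
  "eigenvalues A = {k. \<exists>v. v \<noteq> 0 \<and> A *v v = k *s v}"

(* Min and Max are taken over the real eigenvalues only, so these are meant for
   matrices all of whose complex eigenvalues are real. *)

definition lambda_min :: "real^'n^'n \<Rightarrow> real" where
  "lambda_min A = Min (eigenvalues A)"

definition lambda_max :: "real^'n^'n \<Rightarrow> real" where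
  "lambda_max A = Max (eigenvalues A)"

(* The arguments are the blocks, row by row; the index type is the sum of the
   three block index types, and vec indexing is row first, then column. *)

definition block3 ::
  "'a^'n^'n \<Rightarrow> 'a^'m^'n \<Rightarrow> 'a^'l^'n \<Rightarrow>
   'a^'n^'m \<Rightarrow> 'a^'m^'m \<Rightarrow> 'a^'l^'m \<Rightarrow>
   'a^'n^'l \<Rightarrow> 'a^'m^'l \<Rightarrow> 'a^'l^'l \<Rightarrow> 'a^('n + 'm + 'l)^('n + 'm + 'l)" where
  "block3 A11 A12 A13 A21 A22 A23 A31 A32 A33 = (\<chi> i j.
     case i of
       Inl i1 \<Rightarrow>
         (case j of Inl j1 \<Rightarrow> A11 $ i1 $ j1
          | Inr (Inl j2) \<Rightarrow> A12 $ i1 $ j2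
          | Inr (Inr j3) \<Rightarrow> A13 $ i1 $ j3)
     | Inr (Inl i2) \<Rightarrow>
         (case j of Inl j1 \<Rightarrow> A21 $ i2 $ j1
          | Inr (Inl j2) \<Rightarrow> A22 $ i2 $ j2
          | Inr (Inr j3) \<Rightarrow> A23 $ i2 $ j3)
     | Inr (Inr i3) \<Rightarrow>
         (case j of Inl j1 \<Rightarrow> A31 $ i3 $ j1
          | Inr (Inl j2) \<Rightarrow> A32 $ i3 $ j2
          | Inr (Inr j3) \<Rightarrow> A33 $ i3 $ j3))"

definition g1 :: "real \<Rightarrow> real" where
  "g1 s = 1 + s / 2 - sqrt (s\<^sup>2 / 4 + s)"

definition g2 :: "real \<Rightarrow> real" where
  "g2 s = 1 + s / 2 + sqrt (s\<^sup>2 / 4 + s)"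

definition varrho :: "real \<Rightarrow> real \<Rightarrow> real" where
  "varrho s t = max ((s - 1)\<^sup>2) ((1 - t)\<^sup>2)"

end

theory Submission
  imports Defs
begin

text \<open>
  The idea is to bring \<open>M\<inverse>K\<close> to a real form whose symmetric and skew parts can be bounded
  separately, and then to apply Bendixson's theorem: the real part of an eigenvalue lies in the range
  of the quadratic form of the symmetric part, the imaginary part is at most the norm of the skew part.

  \<^bold>\<open>Coordinates.\<close> Write \<open>Y\<^sub>A = y M\<^sub>A\<inverse>\<close>, \<open>Z\<^sub>A = z M\<^sub>A\<inverse>\<close> and \<open>W\<^sub>S = w S\<inverse>\<close> (with the approximation
  of \<open>S\<close>), where \<open>y, z, w\<close> are 0 or 1. A simultaneous diagonalization of \<open>A\<close> and \<open>M\<^sub>A\<close>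
  (\<open>simultaneous_diagonalization\<close>) makes \<open>A\<close> a diagonal matrix with entries \<open>a i\<close> and the three
  diagonal blocks of \<open>M\<close> identities up to sign. Then \<open>Y\<^sub>A A + Z\<^sub>A A - Y\<^sub>A A Z\<^sub>A A\<close> is diagonal with entries
  \<open>G i = y a i + z a i - y z (a i)\<^sup>2\<close>, and cancelling the triangular factors of \<open>M\<close> gives a
  system (\<open>unscaled\<close>, \<open>coords_step\<close>) whose coupling of the first two blocks carries the factors
  \<open>1 - z a i\<close> above and \<open>- (1 - y a i)\<close> below the diagonal. The product of \<open>1 - z a i\<close> and
  \<open>1 - y a i\<close> is \<open>1 - G i\<close>, so rescaling the coordinate \<open>i\<close> turns both into \<open>r i = sqrt \<bar>1 - G i\<bar>\<close>
  up to sign (\<open>T_rescale\<close>): the coupling becomes skew where \<open>G i \<le> 1\<close> and symmetric where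
  \<open>G i \<ge> 1\<close>. This is why the sign of \<open>1 - G i\<close> separates the three cases of the theorem.

  \<^bold>\<open>Real part.\<close> Split the first block into the coordinates \<open>Neg\<close> of the first kind and the others.
  The symmetric part decouples into a pair (\<open>Neg\<close> coordinates, third block) and a pair (other
  coordinates, second block), see \<open>quadratic_form\<close>. Each pair is a congruence of a block diagonal
  matrix, made of the \<open>a i\<close> and a Schur complement, by a unit triangular shear. The extreme squared
  singular values of the shear are \<open>g1\<close> and \<open>g2\<close> (\<open>shear_lower\<close>, \<open>shear_upper\<close>). The Schur
  complements are bounded by comparing all sums over \<open>i\<close> with \<open>\<Sum>i. (b i \<bullet> q)\<^sup>2 / a i\<close>, which is
  \<open>B A\<inverse> B\<^sup>T\<close> in the new coordinates.

  \<^bold>\<open>Imaginary part.\<close> The skew part couples only (\<open>Neg\<close> coordinates, third block) with (other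
  coordinates, second block), so its norm is the norm of one off-diagonal block, which splits into two
  rows (\<open>skew_part_bound\<close>).

  \<^bold>\<open>Two degeneracies.\<close> The rescaling fails for \<open>(y, z) = (0, 1)\<close>, where the constant factor
  \<open>1 - y a i = 1\<close> would have to be a multiple of \<open>r i\<close>, which may vanish. But transposing \<open>M\<close> exchanges
  \<open>y\<close> and \<open>z\<close> and keeps the spectrum, because \<open>K\<close> is symmetric (\<open>preconditioned_eigenpairs\<close>). The rescaling may
  also annihilate the eigenvector, but then the eigenvalue is some \<open>a i\<close> with \<open>r i = 0\<close>, and it is an
  eigenvalue of the rescaled system as well (\<open>T_eigenpair\<close>).
\<close>

text \<open>As a rewrite rule the following fact would turn transposed matrices into row multiplication;
  here products with transposes stay products.\<close>

declare transpose_matrix_vector [simp del]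

section \<open>Simultaneous diagonalization\<close>

lemma inner_matrix_vector: "x \<bullet> (A *v y) = (transpose A *v x) \<bullet> (y :: real^'n)"
  for A :: "real^'n^'m"
  by (simp add: transpose_matrix_vector dot_lmul_matrix)

lemma matrix_vector_mult_sum_right: "A *v (\<Sum>i\<in>I. f i) = (\<Sum>i\<in>I. A *v f i)"
  for A :: "real^'n^'m"
  by (induction I rule: infinite_finite_induct) (simp_all add: matrix_vector_right_distrib)

lemma matrix_inv_unique:
  fixes A B :: "'a::field^'n^'n"
  assumes "A ** B = mat 1"
  shows "matrix_inv A = B"
proof -
  have BA: "B ** A = mat 1"
    using assms by (simp add: matrix_left_right_inverse)
  have "A ** matrix_inv A = mat 1 \<and> matrix_inv A ** A = mat 1"
    unfolding matrix_inv_def by (rule someI[of _ B]) (use assms BA in simp)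
  then have "matrix_inv A = (B ** A) ** matrix_inv A" "A ** matrix_inv A = mat 1"
    using BA by simp_all
  then show ?thesis
    by (simp add: matrix_mul_assoc[symmetric])
qed

lemma spd_sym: "spd P \<Longrightarrow> transpose P = P"
  by (simp add: spd_def)

lemma matrix_inv_right_ker:
  fixes A :: "real^'n^'n"
  assumes "\<And>x. A *v x = 0 \<Longrightarrow> x = 0"
  shows "A ** matrix_inv A = mat 1" "matrix_inv A ** A = mat 1"
proof -
  obtain B where "B ** A = mat 1"
    using assms matrix_left_invertible_ker[of A] by auto
  then have B: "A ** B = mat 1"
    by (simp add: matrix_left_right_inverse)
  with matrix_inv_unique[OF B] \<open>B ** A = mat 1\<close>
  show "A ** matrix_inv A = mat 1" "matrix_inv A ** A = mat 1" by simp_all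
qed

lemma spd_matrix_inv:
  assumes "spd P"
  shows "P ** matrix_inv P = mat 1" "matrix_inv P ** P = mat 1"
    "transpose (matrix_inv P) = matrix_inv P"
proof -
  have ker: "P *v x = 0 \<Longrightarrow> x = 0" for x
    using assms by (force simp: spd_def)
  show 1: "P ** matrix_inv P = mat 1" and 2: "matrix_inv P ** P = mat 1"
    using matrix_inv_right_ker[OF ker] by blast+
  have "P ** transpose (matrix_inv P) = transpose (matrix_inv P ** P)"
    by (simp add: matrix_transpose_mul spd_sym[OF assms])
  then have "P ** transpose (matrix_inv P) = mat 1"
    using 2 by simp
  then show "transpose (matrix_inv P) = matrix_inv P"
    using matrix_inv_unique by metis
qed

definition diag :: "('n \<Rightarrow> real) \<Rightarrow> real^'n^'n" where
  "diag d = (\<chi> i j. if i = j then d i else 0)"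

lemma diag_mult_nth [simp]: "(diag d *v x) $ i = d i * x $ i"
  by (simp add: diag_def matrix_vector_mult_def if_distrib[of "\<lambda>c. c * _"] cong: if_cong)

text \<open>The first-order condition at a minimum: along a line through a zero of a nonnegative quadratic
  form, the form is such a polynomial. A small step against the sign of \<open>b\<close> would make it negative.\<close>

lemma linear_coeff_zero:
  fixes b c :: real
  assumes "\<And>s. 0 \<le> 2 * s * b + s\<^sup>2 * c"
  shows "b = 0"
proof (rule ccontr)
  assume "b \<noteq> 0"
  define e where "e = 1 / (\<bar>c\<bar> + 1)"
  have e: "0 < e" "e * \<bar>c\<bar> < 1"
    by (auto simp: e_def divide_simps)
  have "0 \<le> 2 * (- e * b) * b + (- e * b)\<^sup>2 * c"
    by (rule assms)
  also have "\<dots> = e * b\<^sup>2 * (e * c - 2)"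
    by (simp add: power2_eq_square algebra_simps)
  finally have "0 \<le> e * c - 2"
    using e \<open>b \<noteq> 0\<close> by (auto simp: zero_le_mult_iff mult_le_0_iff)
  moreover have "e * c \<le> e * \<bar>c\<bar>"
    using e by (intro mult_left_mono) auto
  ultimately show False using e by linarith
qed

text \<open>The new eigenvector minimizes the Rayleigh quotient on the \<open>P\<close>-orthogonal complement \<open>U\<close> of
  \<open>E\<close>. With the minimum \<open>c\<close>, the form of \<open>H - c P\<close> is nonnegative on \<open>U\<close> and vanishes at the minimizer
  \<open>v\<close>, so \<open>H v - c P v\<close> is orthogonal to \<open>U\<close>; it is orthogonal to \<open>E\<close> because the elements of \<open>E\<close> are
  eigenvectors, and \<open>U\<close> and \<open>E\<close> together span the space.\<close>

lemma next_eigenvector: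
  fixes P H :: "real^'n^'n"
  assumes P: "spd P" and H: "transpose H = H"
    and E: "finite E" "card E < CARD('n)"
    and orth: "\<And>e f. e \<in> E \<Longrightarrow> f \<in> E \<Longrightarrow> e \<bullet> (P *v f) = (if e = f then 1 else 0)"
    and eig: "\<And>e. e \<in> E \<Longrightarrow> \<exists>d. H *v e = d *\<^sub>R (P *v e)"
  shows "\<exists>v. (\<forall>e\<in>E. e \<bullet> (P *v v) = 0) \<and> v \<bullet> (P *v v) = 1 \<and> (\<exists>d. H *v v = d *\<^sub>R (P *v v))"
proof -
  define U where "U = {x. \<forall>e\<in>E. e \<bullet> (P *v x) = 0}"
  \<comment> \<open>The \<open>P\<close>-orthogonal projection onto the span of \<open>E\<close>.\<close>
  define pr where "pr x = (\<Sum>e\<in>E. (e \<bullet> (P *v x)) *\<^sub>R e)" for x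
  have comm: "x \<bullet> (P *v y) = y \<bullet> (P *v x)" for x y
    by (metis inner_matrix_vector spd_sym[OF P] inner_commute)
  have commH: "x \<bullet> (H *v y) = y \<bullet> (H *v x)" for x y
    by (metis inner_matrix_vector H inner_commute)
  have prU: "x - pr x \<in> U" for x
  proof -
    have "f \<bullet> (P *v pr x) = f \<bullet> (P *v x)" if "f \<in> E" for f
    proof -
      have "f \<bullet> (P *v pr x) = (\<Sum>e\<in>E. (e \<bullet> (P *v x)) * (f \<bullet> (P *v e)))"
        by (simp add: pr_def matrix_vector_mult_sum_right inner_sum_right
            matrix_vector_mult_scaleR)
      also have "\<dots> = (\<Sum>e\<in>E. if e = f then f \<bullet> (P *v x) else 0)"
        by (rule sum.cong) (use orth that in auto)
      finally show ?thesis using E that by simp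
    qed
    then show ?thesis by (simp add: U_def matrix_vector_mult_diff_distrib inner_diff_right)
  qed
  have subU: "subspace U"
    by (auto simp: U_def subspace_def matrix_vector_right_distrib inner_add_right
        matrix_vector_mult_scaleR)
  have "dim (span E) < DIM(real^'n)"
    using dim_le_card'[OF E(1)] E(2) by simp
  then have "span E \<noteq> UNIV"
    using dim_UNIV by (metis less_irrefl)
  then obtain x where "x \<notin> span E" by auto
  moreover have "pr x \<in> span E"
    unfolding pr_def by (intro span_sum span_mul span_base)
  ultimately have "x - pr x \<noteq> 0" by auto
  then obtain u where u: "u \<in> U" "u \<noteq> 0" using prU by blast
  define X where "X = U \<inter> sphere 0 1"
  have "compact X"
    unfolding X_def by (intro closed_Int_compact closed_subspace subU compact_sphere)
  moreover have "u /\<^sub>R norm u \<in> X"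
    using u subU by (simp add: X_def subspace_scale)
  then have "X \<noteq> {}" by auto
  moreover have Ppos: "0 < x \<bullet> (P *v x)" if "x \<noteq> 0" for x
    using P that by (simp add: spd_def)
  have X0: "x \<bullet> (P *v x) \<noteq> 0" if "x \<in> X" for x
    using Ppos[of x] that by (cases "x = 0") (auto simp: X_def)
  moreover have "continuous_on X (\<lambda>x. (x \<bullet> (H *v x)) / (x \<bullet> (P *v x)))"
    using X0 by (intro continuous_intros linear_continuous_on matrix_vector_mul_bounded_linear) blast
  ultimately obtain v where v: "v \<in> X" and
    vmin: "\<And>y. y \<in> X \<Longrightarrow> (v \<bullet> (H *v v)) / (v \<bullet> (P *v v)) \<le> (y \<bullet> (H *v y)) / (y \<bullet> (P *v y))"
    using continuous_attains_inf[of X] by blast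
  have v0: "v \<noteq> 0" and vU: "v \<in> U" using v by (auto simp: X_def)
  define c where "c = (v \<bullet> (H *v v)) / (v \<bullet> (P *v v))"
  define G where "G x y = x \<bullet> (H *v y) - c * (x \<bullet> (P *v y))" for x y
  have Gpos: "0 \<le> G y y" if "y \<in> U" for y
  proof (cases "y = 0")
    case False
    have "y /\<^sub>R norm y \<in> X"
      using that False subU by (simp add: X_def subspace_scale)
    from vmin[OF this] have "c \<le> (y \<bullet> (H *v y)) / (y \<bullet> (P *v y))"
      using False by (simp add: c_def matrix_vector_mult_scaleR)
    with Ppos[OF False] show ?thesis by (simp add: G_def field_simps)
  qed (simp add: G_def)
  have Gvv: "G v v = 0" using Ppos[OF v0] by (simp add: G_def c_def)
  have GvU: "G y v = 0" if "y \<in> U" for y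
  proof (rule linear_coeff_zero)
    fix s :: real
    have "0 \<le> G (v + s *\<^sub>R y) (v + s *\<^sub>R y)"
      using vU that subU by (intro Gpos) (simp add: subspace_add subspace_scale)
    also have "\<dots> = G v v + 2 * s * G y v + s\<^sup>2 * G y y"
      using comm[of v y] commH[of v y]
      by (simp add: G_def matrix_vector_right_distrib matrix_vector_mult_scaleR inner_add_left
          inner_add_right power2_eq_square algebra_simps)
    finally show "0 \<le> 2 * s * G y v + s\<^sup>2 * G y y" using Gvv by simp
  qed
  have GvE: "G e v = 0" if eE: "e \<in> E" for e
  proof -
    obtain d where "H *v e = d *\<^sub>R (P *v e)" using eig[OF eE] by auto
    then have "e \<bullet> (H *v v) = d * (e \<bullet> (P *v v))"
      using comm[of e v] commH[of e v] by simp
    with vU eE show ?thesis by (simp add: G_def U_def)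
  qed
  have Gv: "G x v = 0" for x
  proof -
    have lin: "G (x + y) v = G x v + G y v" for x y
      by (simp add: G_def inner_add_left algebra_simps)
    have "G (pr x) v = (\<Sum>e\<in>E. (e \<bullet> (P *v x)) * G e v)"
      by (simp add: pr_def G_def inner_sum_left sum_distrib_left sum_subtractf algebra_simps)
    also have "\<dots> = 0" using GvE by simp
    finally have "G (pr x) v = 0" .
    with GvU[OF prU[of x]] lin[of "x - pr x" "pr x"] show ?thesis by simp
  qed
  have Hv: "H *v v = c *\<^sub>R (P *v v)"
  proof -
    define z where "z = H *v v - c *\<^sub>R (P *v v)"
    have "z \<bullet> z = G z v"
      unfolding G_def by (subst (2) z_def) (simp add: inner_diff_right)
    then show ?thesis using Gv by (simp add: z_def)
  qed
  define w where "w = v /\<^sub>R sqrt (v \<bullet> (P *v v))"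
  have "w \<bullet> (P *v w) = 1"
    using Ppos[OF v0] by (simp add: w_def matrix_vector_mult_scaleR field_simps)
  moreover have "\<forall>e\<in>E. e \<bullet> (P *v w) = 0"
    using vU by (simp add: w_def U_def matrix_vector_mult_scaleR)
  moreover have "H *v w = c *\<^sub>R (P *v w)"
    using Hv by (simp add: w_def matrix_vector_mult_scaleR)
  ultimately show ?thesis by blast
qed

lemma orthonormal_eigenvectors:
  fixes P H :: "real^'n^'n"
  assumes P: "spd P" and H: "transpose H = H" and "k \<le> CARD('n)"
  shows "\<exists>E. finite E \<and> card E = k \<and>
    (\<forall>e\<in>E. \<forall>f\<in>E. e \<bullet> (P *v f) = (if e = f then 1 else 0)) \<and>
    (\<forall>e\<in>E. \<exists>d. H *v e = d *\<^sub>R (P *v e))"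
  using \<open>k \<le> CARD('n)\<close>
proof (induction k)
  case 0
  show ?case by (rule exI[of _ "{}"]) simp
next
  case (Suc k)
  then obtain E where E: "finite E" "card E = k"
    "\<And>e f. e \<in> E \<Longrightarrow> f \<in> E \<Longrightarrow> e \<bullet> (P *v f) = (if e = f then 1 else 0)"
    "\<And>e. e \<in> E \<Longrightarrow> \<exists>d. H *v e = d *\<^sub>R (P *v e)"
    by auto
  then obtain v where v: "\<And>e. e \<in> E \<Longrightarrow> e \<bullet> (P *v v) = 0" "v \<bullet> (P *v v) = 1"
    "\<exists>d. H *v v = d *\<^sub>R (P *v v)"
    using next_eigenvector[OF P H E(1) _ E(3) E(4)] Suc.prems by (metis Suc_le_lessD)
  have v': "v \<bullet> (P *v e) = 0" if "e \<in> E" for e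
    using v(1)[OF that] by (metis inner_matrix_vector spd_sym[OF P] inner_commute)
  have vE: "v \<notin> E" using v by force
  then have "finite (insert v E) \<and> card (insert v E) = Suc k" using E by simp
  then show ?case
    using E(3,4) v v' vE by (intro exI[of _ "insert v E"]) auto
qed

text \<open>The columns of \<open>V\<close> are a maximal \<open>P\<close>-orthonormal family of generalized eigenvectors. Indexing them
  by the type \<open>'n\<close> itself keeps \<open>V\<close> a square matrix, so \<open>V\<^sup>T P\<close> is its two-sided inverse without a separate
  independence argument.\<close>

theorem simultaneous_diagonalization:
  fixes P H :: "real^'n^'n"
  assumes P: "spd P" and H: "transpose H = H"
  obtains V :: "real^'n^'n" and d where "transpose V ** P ** V = mat 1" "H ** V = P ** V ** diag d"
proof -
  obtain E where E: "finite E" "card E = CARD('n)"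
    "\<And>e f. e \<in> E \<Longrightarrow> f \<in> E \<Longrightarrow> e \<bullet> (P *v f) = (if e = f then 1 else 0)"
    "\<And>e. e \<in> E \<Longrightarrow> \<exists>d. H *v e = d *\<^sub>R (P *v e)"
    using orthonormal_eigenvectors[OF P H order_refl] by auto
  obtain v :: "'n \<Rightarrow> real^'n" where v: "bij_betw v UNIV E"
    using finite_same_card_bij[of "UNIV :: 'n set" E] E by auto
  have vE: "v i \<in> E" for i using v by (auto simp: bij_betw_def)
  obtain d where d: "\<And>i. H *v v i = d i *\<^sub>R (P *v v i)"
    using E(4)[OF vE] by metis
  define V :: "real^'n^'n" where "V = (\<chi> i j. v j $ i)"
  have col: "(X ** V) $ i $ j = (X *v v j) $ i" for X :: "real^'n^'n" and i j
    by (simp add: V_def matrix_matrix_mult_def matrix_vector_mult_def)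
  have "(transpose V ** P ** V) $ i $ j = mat 1 $ i $ j" for i j
  proof -
    have "(transpose V ** P ** V) $ i $ j = v i \<bullet> (P *v v j)"
      unfolding col matrix_vector_mul_assoc[symmetric]
      by (simp add: matrix_vector_mult_def[of "transpose V"])
        (simp add: V_def transpose_def inner_vec_def)
    then show ?thesis
      using E(3)[OF vE vE] v by (auto simp: mat_def bij_betw_def inj_eq)
  qed
  moreover have "(H ** V) $ i $ j = (P ** V ** diag d) $ i $ j" for i j
    by (simp add: matrix_matrix_mult_def[of "P ** V"] col d diag_def
        if_distrib[of "\<lambda>c. _ * c"] cong: if_cong)
  ultimately show ?thesis by (intro that[of V d]) (simp_all add: vec_eq_iff)
qed

section \<open>Eigenvalues and Rayleigh quotients\<close>

lemma eigenvalues_diagonalizable: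
  fixes N V W :: "real^'n^'n"
  assumes NV: "N ** V = V ** diag d" and WV: "W ** V = mat 1"
  shows "eigenvalues N = range d"
proof (intro set_eqI iffI)
  have WVx: "W *v (V *v x) = x" for x
    by (simp add: matrix_vector_mul_assoc WV)
  have NVx: "N *v (V *v x) = V *v (diag d *v x)" for x
    by (metis matrix_vector_mul_assoc NV)
  {
    fix k assume "k \<in> eigenvalues N"
    then obtain v where v: "v \<noteq> 0" "N *v v = k *\<^sub>R v"
      by (auto simp: eigenvalues_def scalar_mult_eq_scaleR)
    have VW: "V ** W = mat 1"
      using WV by (simp add: matrix_left_right_inverse)
    define u where "u = W *v v"
    have vu: "v = V *v u"
      by (simp add: u_def matrix_vector_mul_assoc VW)
    have "diag d *v u = W *v (V *v (diag d *v u))"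
      by (simp add: WVx)
    also have "V *v (diag d *v u) = N *v v"
      by (simp add: vu NVx)
    also have "W *v (N *v v) = k *\<^sub>R u"
      by (simp add: v u_def matrix_vector_mult_scaleR)
    finally have du: "diag d *v u = k *\<^sub>R u" .
    have "u \<noteq> 0" using v vu by auto
    then obtain i where "u $ i \<noteq> 0" by (auto simp: vec_eq_iff)
    moreover have "d i * u $ i = k * u $ i"
      using arg_cong[OF du, of "\<lambda>x. x $ i"] by simp
    ultimately show "k \<in> range d" by auto
  next
    fix k assume "k \<in> range d"
    then obtain i where k: "k = d i" by auto
    have "diag d *v axis i 1 = k *\<^sub>R axis i 1"
      by (simp add: vec_eq_iff k axis_def)
    then have "N *v (V *v axis i 1) = k *\<^sub>R (V *v axis i 1)"
      by (simp add: NVx matrix_vector_mult_scaleR)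
    moreover have "V *v axis i 1 \<noteq> 0"
    proof
      assume "V *v axis i 1 = 0"
      then have "W *v (V *v axis i 1) = 0" by simp
      then show False by (simp add: WVx axis_eq_0_iff)
    qed
    ultimately show "k \<in> eigenvalues N"
      by (auto simp: eigenvalues_def scalar_mult_eq_scaleR)
  }
qed

lemma lambda_diagonalizable:
  fixes N V W :: "real^'n^'n"
  assumes "N ** V = V ** diag d" "W ** V = mat 1"
  shows "lambda_min N = Min (range d)" "lambda_max N = Max (range d)"
  using eigenvalues_diagonalizable[OF assms] by (simp_all add: lambda_min_def lambda_max_def)

text \<open>A symmetric generalized eigenvalue problem has the extreme values of its Rayleigh quotient
  as extreme eigenvalues: in a diagonalizing basis the quotient is a weighted mean of the eigenvalues.
  All spectral data of the second and third block enter the estimates through this fact.\<close>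

lemma rayleigh:
  fixes P H :: "real^'n^'n"
  assumes P: "spd P" and H: "transpose H = H"
  shows "lambda_min (matrix_inv P ** H) * (x \<bullet> (P *v x)) \<le> x \<bullet> (H *v x)"
    and "x \<bullet> (H *v x) \<le> lambda_max (matrix_inv P ** H) * (x \<bullet> (P *v x))"
    and "\<exists>v. v \<bullet> (P *v v) = 1 \<and> v \<bullet> (H *v v) = lambda_min (matrix_inv P ** H)"
proof -
  obtain V :: "real^'n^'n" and d where V: "transpose V ** P ** V = mat 1" and HV: "H ** V = P ** V ** diag d"
    using simultaneous_diagonalization[OF P H] .
  have 1: "(matrix_inv P ** H) ** V = V ** diag d"
    by (metis HV matrix_mul_assoc matrix_mul_lid spd_matrix_inv(2)[OF P])
  have l: "lambda_min (matrix_inv P ** H) = Min (range d)"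
    "lambda_max (matrix_inv P ** H) = Max (range d)"
    using lambda_diagonalizable[OF 1 V] by auto
  have VV: "V ** (transpose V ** P) = mat 1"
    using V by (simp add: matrix_left_right_inverse)
  define u where "u x = transpose V ** P *v x" for x
  have xV: "V *v u x = x" for x
    by (simp add: u_def matrix_vector_mul_assoc VV)
  have Pform: "(V *v y) \<bullet> (P *v (V *v y)) = y \<bullet> y" for y
    by (metis V inner_commute inner_matrix_vector matrix_mul_assoc matrix_vector_mul_assoc
        matrix_vector_mul_lid)
  have Hform: "(V *v y) \<bullet> (H *v (V *v y)) = (\<Sum>i\<in>UNIV. d i * (y $ i)\<^sup>2)" for y
  proof -
    have "(V *v y) \<bullet> (H *v (V *v y)) = y \<bullet> (transpose V ** P ** V *v (diag d *v y))"
      by (metis HV inner_commute inner_matrix_vector matrix_mul_assoc matrix_vector_mul_assoc)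
    then show ?thesis using V
      by (simp add: inner_vec_def power2_eq_square mult_ac)
  qed
  have yy: "y \<bullet> y = (\<Sum>i\<in>UNIV. (y $ i)\<^sup>2)" for y :: "real^'n"
    by (simp add: inner_vec_def power2_eq_square)
  have "Min (range d) * (u x \<bullet> u x) \<le> (V *v u x) \<bullet> (H *v (V *v u x))"
    unfolding Hform yy sum_distrib_left by (intro sum_mono mult_right_mono) auto
  then show "lambda_min (matrix_inv P ** H) * (x \<bullet> (P *v x)) \<le> x \<bullet> (H *v x)"
    using Pform[of "u x"] by (simp add: l xV)
  have "(V *v u x) \<bullet> (H *v (V *v u x)) \<le> Max (range d) * (u x \<bullet> u x)"
    unfolding Hform yy sum_distrib_left by (intro sum_mono mult_right_mono) auto
  then show "x \<bullet> (H *v x) \<le> lambda_max (matrix_inv P ** H) * (x \<bullet> (P *v x))"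
    using Pform[of "u x"] by (simp add: l xV)
  have ax: "\<exists>v. v \<bullet> (P *v v) = 1 \<and> v \<bullet> (H *v v) = d i" for i
  proof (intro exI conjI)
    show "(V *v axis i 1) \<bullet> (P *v (V *v axis i 1)) = 1"
      unfolding Pform by (simp add: inner_axis_axis)
    show "(V *v axis i 1) \<bullet> (H *v (V *v axis i 1)) = d i"
      unfolding Hform by (simp add: axis_def if_distrib[of "\<lambda>c. _ * c\<^sup>2"] cong: if_cong)
  qed
  obtain i where "d i = Min (range d)"
    using Min_in[of "range d"] by fastforce
  with ax[of i] show "\<exists>v. v \<bullet> (P *v v) = 1 \<and> v \<bullet> (H *v v) = lambda_min (matrix_inv P ** H)"
    by (simp add: l)
qed

section \<open>Scalar and inner product estimates\<close>

lemma g1_root: "0 \<le> s \<Longrightarrow> (1 - g1 s)\<^sup>2 = s * g1 s" and g2_root: "0 \<le> s \<Longrightarrow> (g2 s - 1)\<^sup>2 = s * g2 s"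
  and g1_pos: "0 \<le> s \<Longrightarrow> 0 < g1 s" and g1_le_1: "0 \<le> s \<Longrightarrow> g1 s \<le> 1"
  and g2_ge_1: "0 \<le> s \<Longrightarrow> 1 \<le> g2 s"
proof -
  assume s: "0 \<le> s"
  define q where "q = sqrt (s\<^sup>2 / 4 + s)"
  have q: "q\<^sup>2 = s\<^sup>2 / 4 + s" "0 \<le> q" using s by (auto simp: q_def)
  have g: "g1 s = 1 + s / 2 - q" "g2 s = 1 + s / 2 + q" by (auto simp: g1_def g2_def q_def)
  show "(1 - g1 s)\<^sup>2 = s * g1 s" "(g2 s - 1)\<^sup>2 = s * g2 s"
    using q unfolding g by (simp_all add: power2_eq_square algebra_simps)
  have "q\<^sup>2 < (1 + s / 2)\<^sup>2" using q by (simp add: power2_eq_square algebra_simps)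
  then have "q < 1 + s / 2" by (rule power_less_imp_less_base) (use s in simp)
  then show "0 < g1 s" by (simp add: g)
  have "(s / 2)\<^sup>2 \<le> q\<^sup>2" using q s by (simp add: power2_eq_square algebra_simps)
  then have "s / 2 \<le> q" by (rule power2_le_imp_le) (use q in simp)
  then show "g1 s \<le> 1" by (simp add: g)
  show "1 \<le> g2 s" using q s by (simp add: g)
qed

lemma g_zero [simp]: "g1 0 = 1" "g2 0 = 1"
  by (simp_all add: g1_def g2_def)

text \<open>The numbers \<open>g1 s\<close> and \<open>g2 s\<close> are the extreme values of the squared singular values of
  the shear that adds a multiple \<open>t\<close> with \<open>t\<^sup>2 \<le> s\<close> of one component to the other; they are the
  roots of \<open>(1 - g)\<^sup>2 = s g\<close>, which is the condition under which completing the square closes.\<close>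

lemma shear_lower:
  fixes u v :: "'a::real_inner" and p :: "'b::real_inner"
  assumes s: "0 \<le> s" and v: "(norm v)\<^sup>2 \<le> s * (norm p)\<^sup>2"
  shows "g1 s * ((norm u)\<^sup>2 + (norm p)\<^sup>2) \<le> (norm (u + v))\<^sup>2 + (norm p)\<^sup>2"
proof (cases "s = 0")
  case True
  then have "v = 0" using v by simp
  then show ?thesis using True by simp
next
  case False
  define e where "e = 1 - g1 s"
  have root: "e\<^sup>2 = s * (1 - e)" using g1_root[OF s] by (simp add: e_def)
  have e: "0 \<le> e" "e < 1" using g1_pos[OF s] g1_le_1[OF s] by (auto simp: e_def)
  then have "e \<noteq> 0" using root False by auto
  with e have e0: "0 < e" by simp
  have "0 \<le> (norm (e *\<^sub>R u + v))\<^sup>2" by simp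
  also have "\<dots> = e\<^sup>2 * (norm u)\<^sup>2 + 2 * e * (u \<bullet> v) + (norm v)\<^sup>2"
    unfolding power2_norm_eq_inner
    by (simp add: inner_add_left inner_add_right inner_commute power2_eq_square algebra_simps)
  finally have 1: "0 \<le> e\<^sup>2 * (norm u)\<^sup>2 + 2 * e * (u \<bullet> v) + (norm v)\<^sup>2" .
  have "(1 - e) * (norm v)\<^sup>2 \<le> (1 - e) * (s * (norm p)\<^sup>2)"
    using e v by (intro mult_left_mono) auto
  also have "\<dots> = e\<^sup>2 * (norm p)\<^sup>2" using root by simp
  finally have 2: "(1 - e) * (norm v)\<^sup>2 \<le> e\<^sup>2 * (norm p)\<^sup>2" .
  have "0 \<le> e * (e * (norm u)\<^sup>2 + 2 * (u \<bullet> v) + (norm v)\<^sup>2 + e * (norm p)\<^sup>2)"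
    using 1 2 by (simp add: power2_eq_square algebra_simps)
  then have "0 \<le> e * (norm u)\<^sup>2 + 2 * (u \<bullet> v) + (norm v)\<^sup>2 + e * (norm p)\<^sup>2"
    using e0 by (simp add: zero_le_mult_iff)
  moreover have "(norm (u + v))\<^sup>2 = (norm u)\<^sup>2 + 2 * (u \<bullet> v) + (norm v)\<^sup>2"
    by (simp add: power2_norm_eq_inner inner_add_left inner_add_right inner_commute)
  ultimately show ?thesis by (simp add: e_def algebra_simps)
qed

lemma shear_upper:
  fixes u v :: "'a::real_inner" and p :: "'b::real_inner"
  assumes s: "0 \<le> s" and v: "(norm v)\<^sup>2 \<le> s * (norm p)\<^sup>2"
  shows "(norm (u + v))\<^sup>2 + (norm p)\<^sup>2 \<le> g2 s * ((norm u)\<^sup>2 + (norm p)\<^sup>2)"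
proof (cases "s = 0")
  case True
  then have "v = 0" using v by simp
  then show ?thesis using True by simp
next
  case False
  define e where "e = g2 s - 1"
  have root: "e\<^sup>2 = s * (1 + e)" using g2_root[OF s] by (simp add: e_def)
  have e: "0 \<le> e" using g2_ge_1[OF s] by (auto simp: e_def)
  then have "e \<noteq> 0" using root False by auto
  with e have e0: "0 < e" by simp
  have "0 \<le> (norm (e *\<^sub>R u - v))\<^sup>2" by simp
  also have "\<dots> = e\<^sup>2 * (norm u)\<^sup>2 - 2 * e * (u \<bullet> v) + (norm v)\<^sup>2"
    unfolding power2_norm_eq_inner
    by (simp add: inner_diff_left inner_diff_right inner_commute power2_eq_square algebra_simps)
  finally have 1: "0 \<le> e\<^sup>2 * (norm u)\<^sup>2 - 2 * e * (u \<bullet> v) + (norm v)\<^sup>2" .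
  have "(1 + e) * (norm v)\<^sup>2 \<le> (1 + e) * (s * (norm p)\<^sup>2)"
    using e v by (intro mult_left_mono) auto
  also have "\<dots> = e\<^sup>2 * (norm p)\<^sup>2" using root by simp
  finally have 2: "(1 + e) * (norm v)\<^sup>2 \<le> e\<^sup>2 * (norm p)\<^sup>2" .
  have "0 \<le> e * (e * (norm u)\<^sup>2 - 2 * (u \<bullet> v) - (norm v)\<^sup>2 + e * (norm p)\<^sup>2)"
    using 1 2 by (simp add: power2_eq_square algebra_simps)
  then have "0 \<le> e * (norm u)\<^sup>2 - 2 * (u \<bullet> v) - (norm v)\<^sup>2 + e * (norm p)\<^sup>2"
    using e0 by (simp add: zero_le_mult_iff)
  moreover have "(norm (u + v))\<^sup>2 = (norm u)\<^sup>2 + 2 * (u \<bullet> v) + (norm v)\<^sup>2"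
    by (simp add: power2_norm_eq_inner inner_add_left inner_add_right inner_commute)
  ultimately show ?thesis by (simp add: e_def algebra_simps)
qed

text \<open>For a symmetric operator the numerical radius is the norm: polarization bounds \<open>x \<bullet> f y\<close>, and
  taking \<open>y\<close> in the direction of \<open>f x\<close> with the length of \<open>x\<close> recovers \<open>norm (f x)\<close>.\<close>

lemma symmetric_norm_bound:
  fixes f :: "'a::real_inner \<Rightarrow> 'a"
  assumes lin: "linear f" and sym: "\<And>x y. x \<bullet> f y = f x \<bullet> y"
    and bd: "\<And>x. \<bar>x \<bullet> f x\<bar> \<le> k * (norm x)\<^sup>2"
  shows "norm (f x) \<le> k * norm x"
proof (cases "f x = 0 \<or> x = 0")
  case True
  show ?thesis
  proof (cases "x = 0")
    case False
    have "0 \<le> k * (norm x)\<^sup>2" using bd[of x] by linarith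
    with False have "0 \<le> k" by (simp add: zero_le_mult_iff)
    with True False show ?thesis by simp
  qed (use lin in \<open>simp add: linear_0\<close>)
next
  case False
  define y where "y = (norm x / norm (f x)) *\<^sub>R f x"
  have ny: "norm y = norm x" using False by (simp add: y_def)
  have "4 * (x \<bullet> f y) = (x + y) \<bullet> f (x + y) - (x - y) \<bullet> f (x - y)"
    using sym[of y x]
    by (simp add: linear_add[OF lin] linear_diff[OF lin] inner_add_left inner_add_right
        inner_diff_left inner_diff_right inner_commute)
  also have "\<dots> \<le> k * (norm (x + y))\<^sup>2 + k * (norm (x - y))\<^sup>2"
    using bd[of "x + y"] bd[of "x - y"] by linarith
  also have "\<dots> = 4 * (k * (norm x)\<^sup>2)"
  proof -
    have "(norm (x + y))\<^sup>2 + (norm (x - y))\<^sup>2 = 2 * (norm x)\<^sup>2 + 2 * (norm y)\<^sup>2"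
      by (simp add: power2_norm_eq_inner inner_add_left inner_add_right inner_diff_left inner_diff_right)
    then show ?thesis by (simp add: ny flip: distrib_left)
  qed
  finally have "x \<bullet> f y \<le> k * (norm x)\<^sup>2" by simp
  moreover have "x \<bullet> f y = norm x * norm (f x)"
  proof -
    have "x \<bullet> f y = f x \<bullet> y" by (rule sym)
    also have "\<dots> = norm x * norm (f x)"
      using False by (simp add: y_def dot_square_norm power2_eq_square)
    finally show ?thesis .
  qed
  ultimately have "norm x * norm (f x) \<le> norm x * (k * norm x)"
    by (simp add: power2_eq_square mult_ac)
  then show ?thesis using False by simp
qed

text \<open>Used to combine bounds for two components into a bound for the Euclidean norm of the pair.\<close>

lemma cauchy_schwarz_2: "a * c + b * d \<le> sqrt (a\<^sup>2 + b\<^sup>2) * sqrt (c\<^sup>2 + d\<^sup>2)" for a b c d :: real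
  using norm_cauchy_schwarz[of "(a, b)" "(c, d)"] by (simp add: norm_Pair)

text \<open>Bendixson's theorem for the eigenvalue \<open>\<alpha> + i \<beta>\<close> with eigenvector \<open>x + i y\<close>. Keeping the
  eigenvector as a pair of real vectors makes all later estimates statements about real quadratic and
  bilinear forms. Summing the two real equations gives \<open>\<alpha>\<close> from \<open>x \<bullet> T x + y \<bullet> T y\<close> and \<open>\<beta>\<close> from
  \<open>x \<bullet> T y - y \<bullet> T x\<close>.\<close>

lemma bendixson:
  fixes T :: "'a::real_inner \<Rightarrow> 'a"
  assumes Tx: "T x = \<alpha> *\<^sub>R x - \<beta> *\<^sub>R y" and Ty: "T y = \<beta> *\<^sub>R x + \<alpha> *\<^sub>R y"
    and nz: "x \<noteq> 0 \<or> y \<noteq> 0"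
  shows "(\<And>x. l * (norm x)\<^sup>2 \<le> x \<bullet> T x) \<Longrightarrow> l \<le> \<alpha>"
    and "(\<And>x. x \<bullet> T x \<le> h * (norm x)\<^sup>2) \<Longrightarrow> \<alpha> \<le> h"
    and "(\<And>x y. \<bar>x \<bullet> T y - y \<bullet> T x\<bar> \<le> 2 * \<rho> * norm x * norm y) \<Longrightarrow> 0 \<le> \<rho> \<Longrightarrow> \<bar>\<beta>\<bar> \<le> \<rho>"
proof -
  define N where "N = (norm x)\<^sup>2 + (norm y)\<^sup>2"
  have N: "0 < N" using nz by (auto simp: N_def add_pos_nonneg add_nonneg_pos)
  have re: "x \<bullet> T x + y \<bullet> T y = \<alpha> * N"
    by (simp add: Tx Ty N_def inner_diff_right inner_add_right inner_commute power2_norm_eq_inner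
        algebra_simps)
  have im: "x \<bullet> T y - y \<bullet> T x = \<beta> * N"
    by (simp add: Tx Ty N_def inner_diff_right inner_add_right inner_commute power2_norm_eq_inner
        algebra_simps)
  show "l \<le> \<alpha>" if l: "\<And>x. l * (norm x)\<^sup>2 \<le> x \<bullet> T x"
  proof -
    have "l * N \<le> \<alpha> * N" unfolding re[symmetric]
      using l[of x] l[of y] by (simp add: N_def distrib_left)
    then show ?thesis using N by simp
  qed
  show "\<alpha> \<le> h" if h: "\<And>x. x \<bullet> T x \<le> h * (norm x)\<^sup>2"
  proof -
    have "\<alpha> * N \<le> h * N" unfolding re[symmetric]
      using h[of x] h[of y] by (simp add: N_def distrib_left)
    then show ?thesis using N by simp
  qed
  show "\<bar>\<beta>\<bar> \<le> \<rho>" if \<rho>: "\<And>x y. \<bar>x \<bullet> T y - y \<bullet> T x\<bar> \<le> 2 * \<rho> * norm x * norm y" "0 \<le> \<rho>"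
  proof -
    have "\<bar>\<beta>\<bar> * N = \<bar>x \<bullet> T y - y \<bullet> T x\<bar>"
      using N by (simp add: im abs_mult)
    also have "\<dots> \<le> \<rho> * (2 * norm x * norm y)" using \<rho>(1)[of x y] by (simp add: mult_ac)
    also have "\<dots> \<le> \<rho> * N" 
      unfolding N_def using \<rho>(2) sum_squares_bound[of "norm x" "norm y"] by (intro mult_left_mono) auto
    finally show ?thesis using N by simp
  qed
qed

section \<open>The reduced system\<close>

text \<open>The operator that remains of \<open>M\<inverse>K\<close> after all changes of coordinates. The index set \<open>Neg\<close> is a
  parameter instead of \<open>{i. G i \<le> 1}\<close>: an index with \<open>G i = 1\<close> has \<open>r i = 0\<close> and may be put on either
  side, so that one side can be empty in the two extreme cases of the theorem. The vector \<open>b i\<close> is the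
  \<open>i\<close>-th column of the transformed \<open>B\<close>.\<close>

locale reduced_system =
  fixes Neg :: "'n::finite set" and a r G :: "'n \<Rightarrow> real" and b :: "'n \<Rightarrow> real^'m"
    and C :: "real^'m^'l" and D :: "real^'l^'l" and w :: real
  assumes a_pos: "\<And>i. 0 < a i"
    and r_neg: "\<And>i. i \<in> Neg \<Longrightarrow> (r i)\<^sup>2 = 1 - G i"
    and r_pos: "\<And>i. i \<notin> Neg \<Longrightarrow> (r i)\<^sup>2 = G i - 1"
    and D_sym: "transpose D = D"
    and w: "w = 0 \<or> w = 1"
begin

definition sg :: "'n \<Rightarrow> real" where "sg i = (if i \<in> Neg then 1 else -1)"

definition ct :: "real^'l \<Rightarrow> real^'m" where "ct p = transpose C *v p"

definition wct :: "real^'l \<Rightarrow> real^'m" where "wct p = w *\<^sub>R ct p"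

definition Pop :: "real^'m \<Rightarrow> real^'m" where
  "Pop q = (\<Sum>i\<in>UNIV. (G i / a i * (b i \<bullet> q)) *\<^sub>R b i)"

text \<open>The second row of the operator; its negative reappears in the third row, multiplied by \<open>w C\<close>, from
  the elimination with the lower triangular factor of \<open>M\<close>.\<close>

definition T2 :: "(real^'n) \<times> (real^'m) \<times> (real^'l) \<Rightarrow> real^'m" where
  "T2 = (\<lambda>(u, q, p). Pop (q + wct p) - ct p - (\<Sum>i\<in>UNIV. (sg i * r i * u $ i) *\<^sub>R b i))"

definition T :: "(real^'n) \<times> (real^'m) \<times> (real^'l) \<Rightarrow> (real^'n) \<times> (real^'m) \<times> (real^'l)" where
  "T = (\<lambda>(u, q, p).
     (\<chi> i. a i * u $ i + r i * (b i \<bullet> (q + wct p)),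
      T2 (u, q, p),
      C *v (q + wct p) + D *v p - w *\<^sub>R (C *v T2 (u, q, p))))"

definition mask :: "'n set \<Rightarrow> real^'n \<Rightarrow> real^'n" where
  "mask I u = (\<chi> i. if i \<in> I then u $ i else 0)"

text \<open>What completing the square in the first block leaves in the two other blocks: \<open>SQ\<close> is the Schur
  complement in the second block, and \<open>ST\<close> is the part subtracted from the third.\<close>

definition ST :: "real^'m \<Rightarrow> real" where
  "ST t = (\<Sum>i\<in>UNIV. (if i \<in> Neg then 1 else G i) / a i * (b i \<bullet> t)\<^sup>2)"

definition SQ :: "real^'m \<Rightarrow> real" where
  "SQ q = (\<Sum>i\<in>UNIV. (if i \<in> Neg then G i else 1) / a i * (b i \<bullet> q)\<^sup>2)"

definition shear :: "'n set \<Rightarrow> real^'m \<Rightarrow> real^'n" where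
  "shear I x = mask I (\<chi> i. r i / a i * (b i \<bullet> x))"

lemma wct_simps: "wct p \<bullet> wct p' = wct p \<bullet> ct p'"
    "ct p \<bullet> wct p' = wct p \<bullet> wct p'"
  using w by (auto simp: wct_def)

text \<open>Both parts of \<open>T\<close> are read off from this formula. Moving the factor \<open>w C\<close> of the third row to the
  left argument combines the second and the third row into one inner product with \<open>q - wct p\<close>.\<close>

lemma bilinear_form:
  "(u, q, p) \<bullet> T (u', q', p') =
     (\<Sum>i\<in>UNIV. a i * u $ i * u' $ i + r i * u $ i * (b i \<bullet> (q' + wct p'))
        - sg i * r i * u' $ i * (b i \<bullet> (q - wct p))
        + G i / a i * (b i \<bullet> (q' + wct p')) * (b i \<bullet> (q - wct p)))
     + ct p \<bullet> (q' + wct p') - (q - wct p) \<bullet> ct p' + p \<bullet> (D *v p')"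
proof -
  have 1: "u \<bullet> (\<chi> i. a i * u' $ i + r i * (b i \<bullet> (q' + wct p'))) =
    (\<Sum>i\<in>UNIV. a i * u $ i * u' $ i + r i * u $ i * (b i \<bullet> (q' + wct p')))"
    by (simp add: inner_vec_def algebra_simps)
  have C: "p \<bullet> (C *v x) = ct p \<bullet> x" for x
    by (simp add: ct_def inner_matrix_vector)
  have 2: "(q - wct p) \<bullet> T2 (u', q', p') = (\<Sum>i\<in>UNIV. - sg i * r i * u' $ i * (b i \<bullet> (q - wct p))
        + G i / a i * (b i \<bullet> (q' + wct p')) * (b i \<bullet> (q - wct p))) - (q - wct p) \<bullet> ct p'"
  proof -
    define z where "z = q - wct p"
    show ?thesis
      unfolding z_def[symmetric]
      by (simp add: T2_def Pop_def inner_commute[of z] inner_diff_left inner_sum_left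
          sum_subtractf)
  qed
  have "p \<bullet> (C *v (q' + wct p') + D *v p' - w *\<^sub>R (C *v T2 (u', q', p'))) =
    ct p \<bullet> (q' + wct p') + p \<bullet> (D *v p') - wct p \<bullet> T2 (u', q', p')"
    unfolding inner_diff_right inner_add_right inner_scaleR_right C
    by (simp add: wct_def)
  then have "(u, q, p) \<bullet> T (u', q', p') =
    u \<bullet> (\<chi> i. a i * u' $ i + r i * (b i \<bullet> (q' + wct p'))) + (q - wct p) \<bullet> T2 (u', q', p')
    + ct p \<bullet> (q' + wct p') + p \<bullet> (D *v p')"
    by (simp add: T_def inner_diff_left)
  also have "\<dots> = (\<Sum>i\<in>UNIV. a i * u $ i * u' $ i + r i * u $ i * (b i \<bullet> (q' + wct p')))
    + (\<Sum>i\<in>UNIV. - sg i * r i * u' $ i * (b i \<bullet> (q - wct p))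
        + G i / a i * (b i \<bullet> (q' + wct p')) * (b i \<bullet> (q - wct p)))
    + ct p \<bullet> (q' + wct p') - (q - wct p) \<bullet> ct p' + p \<bullet> (D *v p')"
    unfolding 1 2 by simp
  finally show ?thesis by (simp flip: sum.distrib add: algebra_simps)
qed

text \<open>Completing the square in every coordinate of the first block. In a \<open>Neg\<close> coordinate the coupling with
  \<open>q\<close> is skew and drops out, which leaves a square with \<open>wct p\<close>; in the other coordinates the coupling
  with \<open>wct p\<close> drops out and leaves a square with \<open>q\<close>. Hence the form is a sum of a form in the pair
  (\<open>Neg\<close> coordinates, \<open>p\<close>) and a form in the pair (other coordinates, \<open>q\<close>).\<close>

lemma quadratic_form:
  "(u, q, p) \<bullet> T (u, q, p) =
     (\<Sum>i\<in>UNIV. a i * (mask Neg u $ i + shear Neg (wct p) $ i)\<^sup>2)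
     + (\<Sum>i\<in>UNIV. a i * (mask (-Neg) u $ i + shear (-Neg) q $ i)\<^sup>2)
     + SQ q + (p \<bullet> (D *v p) + 2 * (norm (wct p))\<^sup>2 - ST (wct p))"
proof -
  let ?t = "wct p"
  have tt: "ct p \<bullet> (q + ?t) - (q - ?t) \<bullet> ct p = 2 * (norm ?t)\<^sup>2"
    by (simp add: inner_add_right inner_diff_left wct_simps(2) power2_norm_eq_inner inner_commute[of q]
        flip: wct_simps(1))
  have "a i * u $ i * u $ i + r i * u $ i * (b i \<bullet> (q + ?t))
        - sg i * r i * u $ i * (b i \<bullet> (q - ?t))
        + G i / a i * (b i \<bullet> (q + ?t)) * (b i \<bullet> (q - ?t)) =
      a i * (mask Neg u $ i + shear Neg ?t $ i)\<^sup>2 + a i * (mask (-Neg) u $ i + shear (-Neg) q $ i)\<^sup>2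
      + (if i \<in> Neg then G i else 1) / a i * (b i \<bullet> q)\<^sup>2
      - (if i \<in> Neg then 1 else G i) / a i * (b i \<bullet> ?t)\<^sup>2" for i
  proof -
    have ai: "a i \<noteq> 0" using a_pos[of i] by simp
    define x y where xy: "x = b i \<bullet> q" "y = b i \<bullet> ?t"
    have sq: "a i * (v + r i / a i * z)\<^sup>2 = a i * v\<^sup>2 + 2 * r i * v * z + (r i)\<^sup>2 * z\<^sup>2 / a i" for v z
      using ai by (simp add: power2_eq_square field_simps)
    show ?thesis
    proof (cases "i \<in> Neg")
      case True
      show ?thesis
        using True ai sq[of "u $ i" y] r_neg[OF True]
        by (simp add: sg_def mask_def shear_def inner_add_right inner_diff_right flip: xy)
          (simp add: power2_eq_square field_simps)
    next
      case False
      show ?thesis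
        using False ai sq[of "u $ i" x] r_pos[OF False]
        by (simp add: sg_def mask_def shear_def inner_add_right inner_diff_right flip: xy)
          (simp add: power2_eq_square field_simps)
    qed
  qed
  then show ?thesis
    unfolding bilinear_form using tt by (simp add: sum.distrib sum_subtractf ST_def SQ_def)
qed

lemma norm_vec_square: "(norm (x :: real^'k))\<^sup>2 = (\<Sum>i\<in>UNIV. (x $ i)\<^sup>2)"
  unfolding power2_norm_eq_inner inner_vec_def by (simp add: power2_eq_square)

lemma norm_mask: "(norm (mask Neg u))\<^sup>2 + (norm (mask (-Neg) u))\<^sup>2 = (norm u)\<^sup>2"
  by (simp add: norm_vec_square mask_def flip: sum.distrib) (intro sum.cong, auto)

lemma norm_triple: "(norm (u, q, p))\<^sup>2 = (norm u)\<^sup>2 + (norm q)\<^sup>2 + (norm p)\<^sup>2"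
  by (simp add: norm_Pair)

text \<open>In each of the two pairs the form is at least \<open>m\<close> (or \<open>k\<close>) times the squared norm of the sheared
  vector, and undoing the shear costs the factor \<open>g1\<close>.\<close>

lemma real_part_lower:
  assumes m: "\<And>i. i \<in> Neg \<Longrightarrow> m \<le> a i" "\<And>p. m * (norm p)\<^sup>2 \<le> p \<bullet> (D *v p) + 2 * (norm (wct p))\<^sup>2 - ST (wct p)" "0 \<le> m"
    and k: "\<And>i. i \<notin> Neg \<Longrightarrow> k \<le> a i" "\<And>q. k * (norm q)\<^sup>2 \<le> SQ q" "0 \<le> k"
    and s: "\<And>p. (norm (shear Neg (wct p)))\<^sup>2 \<le> s * (norm p)\<^sup>2" "0 \<le> s"
    and z: "\<And>q. (norm (shear (-Neg) q))\<^sup>2 \<le> z * (norm q)\<^sup>2" "0 \<le> z"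
    and l: "l \<le> m * g1 s" "l \<le> k * g1 z"
  shows "l * (norm x)\<^sup>2 \<le> x \<bullet> T x"
proof -
  obtain u q p where x: "x = (u, q, p)" by (cases x)
  have "m * (norm (mask Neg u + shear Neg (wct p)))\<^sup>2
      \<le> (\<Sum>i\<in>UNIV. a i * (mask Neg u $ i + shear Neg (wct p) $ i)\<^sup>2)"
    unfolding norm_vec_square sum_distrib_left
    using m(1) by (intro sum_mono) (auto simp: mask_def shear_def intro: mult_right_mono)
  with m(2)[of p] have "m * ((norm (mask Neg u + shear Neg (wct p)))\<^sup>2 + (norm p)\<^sup>2)
      \<le> (\<Sum>i\<in>UNIV. a i * (mask Neg u $ i + shear Neg (wct p) $ i)\<^sup>2)
       + (p \<bullet> (D *v p) + 2 * (norm (wct p))\<^sup>2 - ST (wct p))" (is "_ \<le> ?M")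
    by (simp add: distrib_left)
  moreover have "m * (g1 s * ((norm (mask Neg u))\<^sup>2 + (norm p)\<^sup>2))
      \<le> m * ((norm (mask Neg u + shear Neg (wct p)))\<^sup>2 + (norm p)\<^sup>2)"
    by (intro mult_left_mono shear_lower s m)
  moreover have "l * ((norm (mask Neg u))\<^sup>2 + (norm p)\<^sup>2) \<le> m * g1 s * ((norm (mask Neg u))\<^sup>2 + (norm p)\<^sup>2)"
    using l by (intro mult_right_mono) auto
  ultimately have M: "l * ((norm (mask Neg u))\<^sup>2 + (norm p)\<^sup>2) \<le> ?M" by (simp add: mult.assoc)
  have "k * (norm (mask (-Neg) u + shear (-Neg) q))\<^sup>2
      \<le> (\<Sum>i\<in>UNIV. a i * (mask (-Neg) u $ i + shear (-Neg) q $ i)\<^sup>2)"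
    unfolding norm_vec_square sum_distrib_left
    using k(1) by (intro sum_mono) (auto simp: mask_def shear_def intro: mult_right_mono)
  with k(2)[of q] have "k * ((norm (mask (-Neg) u + shear (-Neg) q))\<^sup>2 + (norm q)\<^sup>2)
      \<le> (\<Sum>i\<in>UNIV. a i * (mask (-Neg) u $ i + shear (-Neg) q $ i)\<^sup>2) + SQ q" (is "_ \<le> ?K")
    by (simp add: distrib_left)
  moreover have "k * (g1 z * ((norm (mask (-Neg) u))\<^sup>2 + (norm q)\<^sup>2))
      \<le> k * ((norm (mask (-Neg) u + shear (-Neg) q))\<^sup>2 + (norm q)\<^sup>2)"
    by (intro mult_left_mono shear_lower z k)
  moreover have "l * ((norm (mask (-Neg) u))\<^sup>2 + (norm q)\<^sup>2) \<le> k * g1 z * ((norm (mask (-Neg) u))\<^sup>2 + (norm q)\<^sup>2)"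
    using l by (intro mult_right_mono) auto
  ultimately have K: "l * ((norm (mask (-Neg) u))\<^sup>2 + (norm q)\<^sup>2) \<le> ?K" by (simp add: mult.assoc)
  have "l * (norm x)\<^sup>2 = l * ((norm (mask Neg u))\<^sup>2 + (norm p)\<^sup>2) + l * ((norm (mask (-Neg) u))\<^sup>2 + (norm q)\<^sup>2)"
    unfolding x norm_triple norm_mask[of u, symmetric] by (simp add: algebra_simps)
  also have "\<dots> \<le> ?M + ?K" using M K by simp
  finally show ?thesis by (simp add: x quadratic_form)
qed

lemma real_part_upper:
  assumes m: "\<And>i. i \<in> Neg \<Longrightarrow> a i \<le> m" "\<And>p. p \<bullet> (D *v p) + 2 * (norm (wct p))\<^sup>2 - ST (wct p) \<le> m * (norm p)\<^sup>2" "0 \<le> m"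
    and k: "\<And>i. i \<notin> Neg \<Longrightarrow> a i \<le> k" "\<And>q. SQ q \<le> k * (norm q)\<^sup>2" "0 \<le> k"
    and s: "\<And>p. (norm (shear Neg (wct p)))\<^sup>2 \<le> s * (norm p)\<^sup>2" "0 \<le> s"
    and z: "\<And>q. (norm (shear (-Neg) q))\<^sup>2 \<le> z * (norm q)\<^sup>2" "0 \<le> z"
    and l: "m * g2 s \<le> l" "k * g2 z \<le> l"
  shows "x \<bullet> T x \<le> l * (norm x)\<^sup>2"
proof -
  obtain u q p where x: "x = (u, q, p)" by (cases x)
  have "(\<Sum>i\<in>UNIV. a i * (mask Neg u $ i + shear Neg (wct p) $ i)\<^sup>2)
      \<le> m * (norm (mask Neg u + shear Neg (wct p)))\<^sup>2"
    unfolding norm_vec_square sum_distrib_left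
    using m(1) by (intro sum_mono) (auto simp: mask_def shear_def intro: mult_right_mono)
  with m(2)[of p] have "(\<Sum>i\<in>UNIV. a i * (mask Neg u $ i + shear Neg (wct p) $ i)\<^sup>2)
       + (p \<bullet> (D *v p) + 2 * (norm (wct p))\<^sup>2 - ST (wct p))
      \<le> m * ((norm (mask Neg u + shear Neg (wct p)))\<^sup>2 + (norm p)\<^sup>2)" (is "?M \<le> _")
    by (simp add: distrib_left)
  moreover have "m * ((norm (mask Neg u + shear Neg (wct p)))\<^sup>2 + (norm p)\<^sup>2)
      \<le> m * (g2 s * ((norm (mask Neg u))\<^sup>2 + (norm p)\<^sup>2))"
    by (intro mult_left_mono shear_upper s m)
  moreover have "m * g2 s * ((norm (mask Neg u))\<^sup>2 + (norm p)\<^sup>2) \<le> l * ((norm (mask Neg u))\<^sup>2 + (norm p)\<^sup>2)"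
    using l by (intro mult_right_mono) auto
  ultimately have M: "?M \<le> l * ((norm (mask Neg u))\<^sup>2 + (norm p)\<^sup>2)" by (simp add: mult.assoc)
  have "(\<Sum>i\<in>UNIV. a i * (mask (-Neg) u $ i + shear (-Neg) q $ i)\<^sup>2)
      \<le> k * (norm (mask (-Neg) u + shear (-Neg) q))\<^sup>2"
    unfolding norm_vec_square sum_distrib_left
    using k(1) by (intro sum_mono) (auto simp: mask_def shear_def intro: mult_right_mono)
  with k(2)[of q] have "(\<Sum>i\<in>UNIV. a i * (mask (-Neg) u $ i + shear (-Neg) q $ i)\<^sup>2) + SQ q
      \<le> k * ((norm (mask (-Neg) u + shear (-Neg) q))\<^sup>2 + (norm q)\<^sup>2)" (is "?K \<le> _")
    by (simp add: distrib_left)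
  moreover have "k * ((norm (mask (-Neg) u + shear (-Neg) q))\<^sup>2 + (norm q)\<^sup>2)
      \<le> k * (g2 z * ((norm (mask (-Neg) u))\<^sup>2 + (norm q)\<^sup>2))"
    by (intro mult_left_mono shear_upper z k)
  moreover have "k * g2 z * ((norm (mask (-Neg) u))\<^sup>2 + (norm q)\<^sup>2) \<le> l * ((norm (mask (-Neg) u))\<^sup>2 + (norm q)\<^sup>2)"
    using l by (intro mult_right_mono) auto
  ultimately have K: "?K \<le> l * ((norm (mask (-Neg) u))\<^sup>2 + (norm q)\<^sup>2)" by (simp add: mult.assoc)
  have "x \<bullet> T x = ?M + ?K" by (simp add: x quadratic_form)
  also have "\<dots> \<le> l * ((norm (mask Neg u))\<^sup>2 + (norm p)\<^sup>2) + l * ((norm (mask (-Neg) u))\<^sup>2 + (norm q)\<^sup>2)"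
    using M K by simp
  also have "\<dots> = l * (norm x)\<^sup>2"
    unfolding x norm_triple norm_mask[of u, symmetric] by (simp add: algebra_simps)
  finally show ?thesis .
qed

lemma Pop_linear: "linear Pop"
  unfolding Pop_def
  by (intro linearI) (simp_all add: inner_add_right algebra_simps sum.distrib scaleR_sum_right)

lemma Pop_form: "q \<bullet> Pop q' = (\<Sum>i\<in>UNIV. G i / a i * (b i \<bullet> q) * (b i \<bullet> q'))"
  by (simp add: Pop_def inner_sum_right inner_commute[of q] mult_ac)

lemma Pop_sym: "q \<bullet> Pop q' = Pop q \<bullet> q'"
  using Pop_form[of q q'] Pop_form[of q' q] by (simp add: inner_commute[of "Pop q"] mult_ac)

text \<open>This is where \<open>varrho\<close> comes from: its value is the square of the larger distance from 1 to an endpoint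
  of the interval that contains the spectrum of \<open>Pop\<close>.\<close>

lemma Pop_contraction:
  assumes lo: "\<And>q. lo * (norm q)\<^sup>2 \<le> q \<bullet> Pop q" and hi: "\<And>q. q \<bullet> Pop q \<le> hi * (norm q)\<^sup>2"
  shows "(norm (q - Pop q))\<^sup>2 \<le> varrho hi lo * (norm q)\<^sup>2"
proof -
  define k where "k = max \<bar>hi - 1\<bar> \<bar>1 - lo\<bar>"
  have k: "k\<^sup>2 = varrho hi lo" "0 \<le> k"
  proof -
    have "k\<^sup>2 = max (\<bar>hi - 1\<bar>\<^sup>2) (\<bar>1 - lo\<bar>\<^sup>2)"
      unfolding k_def by (cases "\<bar>hi - 1\<bar> \<le> \<bar>1 - lo\<bar>")
        (simp_all add: max_def abs_le_square_iff del: power2_abs)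
    then show "k\<^sup>2 = varrho hi lo" by (simp add: varrho_def)
  qed (simp add: k_def)
  have "norm (q - Pop q) \<le> k * norm q"
  proof (rule symmetric_norm_bound[of "\<lambda>q. q - Pop q"])
    show "linear (\<lambda>q. q - Pop q)"
      by (intro linear_compose_sub Pop_linear linear_ident)
    show "x \<bullet> (y - Pop y) = (x - Pop x) \<bullet> y" for x y
      by (simp add: inner_diff_left inner_diff_right Pop_sym)
    show "\<bar>x \<bullet> (x - Pop x)\<bar> \<le> k * (norm x)\<^sup>2" for x
    proof -
      have "x \<bullet> (x - Pop x) = (norm x)\<^sup>2 - x \<bullet> Pop x"
        by (simp add: inner_diff_right power2_norm_eq_inner)
      moreover have "(hi - 1) * (norm x)\<^sup>2 \<le> k * (norm x)\<^sup>2" "(1 - lo) * (norm x)\<^sup>2 \<le> k * (norm x)\<^sup>2"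
        unfolding k_def by (intro mult_right_mono; simp)+
      ultimately show ?thesis using lo[of x] hi[of x] by (simp add: algebra_simps abs_le_iff)
    qed
  qed
  then have "(norm (q - Pop q))\<^sup>2 \<le> (k * norm q)\<^sup>2" by (intro power_mono) auto
  then show ?thesis by (simp add: power_mult_distrib k)
qed

text \<open>The skew part pairs (\<open>Neg\<close> coordinates, \<open>p\<close>) of one argument only with (other coordinates, \<open>q\<close>) of the
  other; \<open>F\<close> is this off-diagonal block.\<close>

lemma skew_form:
  assumes "F = (\<lambda>u p u' q'. (\<Sum>i\<in>UNIV. if i \<in> Neg then r i * u $ i * (b i \<bullet> q')
         else - (r i * u' $ i * (b i \<bullet> wct p))) + (ct p - Pop (wct p)) \<bullet> q')"
  shows "(u, q, p) \<bullet> T (u', q', p') - (u', q', p') \<bullet> T (u, q, p) =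
    2 * (F u p u' q' - F u' p' u q)"
proof -
  let ?t = "wct p" and ?t' = "wct p'"
  have D: "p' \<bullet> (D *v p) = p \<bullet> (D *v p')"
    by (metis inner_matrix_vector inner_commute D_sym)
  define L where "L i = (a i * u $ i * u' $ i + r i * u $ i * (b i \<bullet> (q' + ?t'))
        - sg i * r i * u' $ i * (b i \<bullet> (q - ?t))
        + G i / a i * (b i \<bullet> (q' + ?t')) * (b i \<bullet> (q - ?t))) -
     (a i * u' $ i * u $ i + r i * u' $ i * (b i \<bullet> (q + ?t))
        - sg i * r i * u $ i * (b i \<bullet> (q' - ?t'))
        + G i / a i * (b i \<bullet> (q + ?t)) * (b i \<bullet> (q' - ?t')))" for i
  have L: "L i = 2 * (if i \<in> Neg then r i * u $ i * (b i \<bullet> q') else - (r i * u' $ i * (b i \<bullet> ?t)))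
      - 2 * (if i \<in> Neg then r i * u' $ i * (b i \<bullet> q) else - (r i * u $ i * (b i \<bullet> ?t')))
      + 2 * (G i / a i * (b i \<bullet> ?t') * (b i \<bullet> q)) - 2 * (G i / a i * (b i \<bullet> ?t) * (b i \<bullet> q'))" for i
  proof -
    define g where "g = G i / a i"
    show ?thesis
      unfolding L_def sg_def inner_add_right inner_diff_right g_def[symmetric]
      by (simp add: algebra_simps)
  qed
  have tt: "ct p \<bullet> (q' + ?t') - (q - ?t) \<bullet> ct p' - (ct p' \<bullet> (q + ?t) - (q' - ?t') \<bullet> ct p)
      = 2 * (ct p \<bullet> q') - 2 * (ct p' \<bullet> q)"
  proof -
    have "ct p' \<bullet> ?t = ct p \<bullet> ?t'" "?t \<bullet> ct p' = ct p \<bullet> ?t'" "?t' \<bullet> ct p = ct p \<bullet> ?t'"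
      "q \<bullet> ct p' = ct p' \<bullet> q" "q' \<bullet> ct p = ct p \<bullet> q'"
      by (simp_all add: wct_def inner_commute)
    then show ?thesis by (simp add: inner_add_right inner_diff_left)
  qed
  have "(u, q, p) \<bullet> T (u', q', p') - (u', q', p') \<bullet> T (u, q, p) =
    (\<Sum>i\<in>UNIV. L i) + (2 * (ct p \<bullet> q') - 2 * (ct p' \<bullet> q))"
    unfolding bilinear_form tt[symmetric] L_def by (subst sum_subtractf) (simp add: D)
  also have "\<dots> = 2 * (F u p u' q' - F u' p' u q)"
  proof -
    have P: "Pop x \<bullet> y = (\<Sum>i\<in>UNIV. G i / a i * (b i \<bullet> x) * (b i \<bullet> y))" for x y
      by (simp add: Pop_form flip: Pop_sym)
    show ?thesis
      unfolding L assms inner_diff_left P sum.distrib sum_subtractf sum_distrib_left[symmetric]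
      by simp
  qed
  finally show ?thesis .
qed

text \<open>The off-diagonal block of the skew part has two rows, one ending in the \<open>Neg\<close> coordinates and one in
  \<open>p\<close>. The squared norm of the block is at most the sum \<open>\<delta> + \<epsilon>\<close> of the squared norms of the rows, and the
  norm of a skew matrix with only one off-diagonal block is the norm of this block.\<close>

lemma skew_part_bound:
  assumes \<delta>: "\<And>q. (\<Sum>i\<in>Neg. (r i * (b i \<bullet> q))\<^sup>2) \<le> \<delta> * (norm q)\<^sup>2" "0 \<le> \<delta>"
    and \<epsilon>: "\<And>p. (norm (ct p - Pop (wct p)))\<^sup>2 + (\<Sum>i\<in>-Neg. (r i * (b i \<bullet> wct p))\<^sup>2) \<le> \<epsilon> * (norm p)\<^sup>2" "0 \<le> \<epsilon>"
  shows "\<bar>x \<bullet> T y - y \<bullet> T x\<bar> \<le> 2 * sqrt (\<delta> + \<epsilon>) * norm x * norm y"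
proof -
  obtain u q p where x: "x = (u, q, p)" by (cases x)
  obtain u' q' p' where y: "y = (u', q', p')" by (cases y)
  define F where "F = (\<lambda>u p u' q'. (\<Sum>i\<in>UNIV. if i \<in> Neg then r i * u $ i * (b i \<bullet> q')
         else - (r i * u' $ i * (b i \<bullet> wct p))) + (ct p - Pop (wct p)) \<bullet> q')"
  define X where "X = (\<lambda>u (p::real^'l). sqrt ((norm (mask Neg u))\<^sup>2 + (norm p)\<^sup>2))"
  define Y where "Y = (\<lambda>u (q::real^'m). sqrt ((norm (mask (-Neg) u))\<^sup>2 + (norm q)\<^sup>2))"
  have F: "\<bar>F u p u' q'\<bar> \<le> sqrt (\<delta> + \<epsilon>) * (X u p * Y u' q')" for u p u' q'
  proof -
    define \<alpha> :: "real^'n" where "\<alpha> = (\<chi> i. if i \<in> Neg then r i * (b i \<bullet> q') else 0)"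
    define \<gamma> :: "real^'n" where "\<gamma> = (\<chi> i. if i \<in> Neg then 0 else - (r i * (b i \<bullet> wct p)))"
    have "F u p u' q' = mask Neg u \<bullet> \<alpha> + (\<gamma>, ct p - Pop (wct p)) \<bullet> (mask (-Neg) u', q')"
      by (simp add: F_def inner_vec_def mask_def \<alpha>_def \<gamma>_def flip: sum.distrib)
        (intro sum.cong, auto)
    then have "\<bar>F u p u' q'\<bar> \<le> norm (mask Neg u) * norm \<alpha>
        + norm (\<gamma>, ct p - Pop (wct p)) * norm (mask (-Neg) u', q')"
      using Cauchy_Schwarz_ineq2[of "mask Neg u" \<alpha>]
        Cauchy_Schwarz_ineq2[of "(\<gamma>, ct p - Pop (wct p))" "(mask (-Neg) u', q')"] by linarith
    also have "norm (mask (-Neg) u', q') = Y u' q'" by (simp add: Y_def norm_Pair)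
    also have "norm (\<gamma>, ct p - Pop (wct p)) \<le> sqrt \<epsilon> * norm p"
    proof -
      have "(norm \<gamma>)\<^sup>2 = (\<Sum>i\<in>-Neg. (r i * (b i \<bullet> wct p))\<^sup>2)"
        unfolding norm_vec_square \<gamma>_def
        by (intro sum.mono_neutral_cong_right) auto
      then have "(norm \<gamma>)\<^sup>2 + (norm (ct p - Pop (wct p)))\<^sup>2 \<le> \<epsilon> * (norm p)\<^sup>2"
        using \<epsilon>(1)[of p] by linarith
      then have "norm (\<gamma>, ct p - Pop (wct p)) \<le> sqrt (\<epsilon> * (norm p)\<^sup>2)"
        unfolding norm_Pair by (rule real_sqrt_le_mono)
      then show ?thesis by (simp add: real_sqrt_mult)
    qed
    also have "norm \<alpha> \<le> sqrt \<delta> * Y u' q'"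
    proof -
      have "(norm \<alpha>)\<^sup>2 = (\<Sum>i\<in>Neg. (r i * (b i \<bullet> q'))\<^sup>2)"
        unfolding norm_vec_square \<alpha>_def
        by (intro sum.mono_neutral_cong_right) auto
      then have "(norm \<alpha>)\<^sup>2 \<le> \<delta> * (norm q')\<^sup>2" using \<delta>(1)[of q'] by linarith
      then have "norm \<alpha> \<le> sqrt (\<delta> * (norm q')\<^sup>2)" by (rule real_le_rsqrt)
      also have "\<dots> = sqrt \<delta> * norm q'" by (simp add: real_sqrt_mult)
      also have "norm q' \<le> Y u' q'" unfolding Y_def by (rule real_le_rsqrt) simp
      finally show ?thesis using \<delta>(2) by (simp add: mult_left_mono)
    qed
    finally have "\<bar>F u p u' q'\<bar> \<le> (sqrt \<delta> * norm (mask Neg u) + sqrt \<epsilon> * norm p) * Y u' q'"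
      by (simp add: mult_left_mono mult_right_mono Y_def algebra_simps)
    also have "\<dots> \<le> (sqrt ((sqrt \<delta>)\<^sup>2 + (sqrt \<epsilon>)\<^sup>2) * X u p) * Y u' q'"
      unfolding X_def by (intro mult_right_mono cauchy_schwarz_2) (simp add: Y_def)
    finally show ?thesis using \<delta>(2) \<epsilon>(2) by (simp add: mult.assoc)
  qed
  have XY: "norm (u, q, p) = sqrt ((X u p)\<^sup>2 + (Y u q)\<^sup>2)" for u q p
  proof -
    have "(norm (u, q, p))\<^sup>2 = (X u p)\<^sup>2 + (Y u q)\<^sup>2"
      unfolding norm_triple X_def Y_def using norm_mask[of u] by simp
    then show ?thesis by (metis norm_ge_zero real_sqrt_unique)
  qed
  have "x \<bullet> T y - y \<bullet> T x = 2 * (F u p u' q' - F u' p' u q)"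
    unfolding x y by (rule skew_form[OF F_def])
  then have "\<bar>x \<bullet> T y - y \<bullet> T x\<bar> \<le> 2 * (\<bar>F u p u' q'\<bar> + \<bar>F u' p' u q\<bar>)" by simp
  also have "\<dots> \<le> 2 * (sqrt (\<delta> + \<epsilon>) * (X u p * Y u' q' + Y u q * X u' p'))"
    using F[of u p u' q'] F[of u' p' u q] by (simp add: distrib_left mult_ac)
  also have "X u p * Y u' q' + Y u q * X u' p' \<le> norm x * norm y"
    using cauchy_schwarz_2[of "X u p" "Y u' q'" "Y u q" "X u' p'"]
    unfolding x y XY by (simp add: add.commute)
  finally show ?thesis using \<delta>(2) \<epsilon>(2) by (simp add: mult_left_mono mult.assoc)
qed

end

section \<open>Spectral bounds for the reduced system\<close>

text \<open>The spectral quantities of the theorem enter as bounds of quadratic forms in the new coordinates. In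
  terms of \<open>w\<close>, the eigenvalues of \<open>W\<^sub>S S\<close> are \<open>w\<close> times those for \<open>nu\<close>, and likewise \<open>phi_max\<close> is \<open>w\<close> times
  \<open>omega_max\<close>, which treats \<open>W\<^sub>S = 0\<close> and \<open>W\<^sub>S \<noteq> 0\<close> together.\<close>

locale bounded_system = reduced_system Neg a r G b C D w
  for Neg :: "'n::finite set" and a r G :: "'n \<Rightarrow> real" and b :: "'n \<Rightarrow> real^'m"
    and C :: "real^'m^'l" and D :: "real^'l^'l" and w :: real +
  fixes mu_min mu_max nu_min nu_max omega_max tau_min tau_max varphi_min varphi_max
    phi_min phi_max kappa_min kappa_max gamma_min gamma_max :: real
    and h_min h_max :: "real \<Rightarrow> real"
  assumes mu: "0 < mu_min" "\<And>i. mu_min \<le> a i" "\<And>i. a i \<le> mu_max" "mu_max \<le> 2"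
    and nu: "\<And>q. nu_min * (norm q)\<^sup>2 \<le> (\<Sum>i\<in>UNIV. (b i \<bullet> q)\<^sup>2 / a i)"
      "\<And>q. (\<Sum>i\<in>UNIV. (b i \<bullet> q)\<^sup>2 / a i) \<le> nu_max * (norm q)\<^sup>2"
      "0 \<le> nu_min" "nu_max \<le> 2" "mu_max * nu_max < 2"
    and omega: "\<And>p. (norm (ct p))\<^sup>2 \<le> omega_max * (norm p)\<^sup>2"
    and tau: "\<And>p. tau_min * (norm p)\<^sup>2 \<le> p \<bullet> (D *v p)"
      "\<And>p. p \<bullet> (D *v p) \<le> tau_max * (norm p)\<^sup>2" "0 \<le> tau_min"
    and varphi: "varphi_min = w * nu_min" "varphi_max = w * nu_max"
    and phi: "\<And>p. phi_min * (norm p)\<^sup>2 \<le> (norm (wct p))\<^sup>2"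
      "\<And>p. (norm (wct p))\<^sup>2 \<le> phi_max * (norm p)\<^sup>2" "0 \<le> phi_min" "phi_max = w * omega_max"
    and kappa: "\<And>p. kappa_min * (norm p)\<^sup>2 \<le> p \<bullet> (D *v p) + (norm (wct p))\<^sup>2"
      "\<And>p. p \<bullet> (D *v p) + (norm (wct p))\<^sup>2 \<le> kappa_max * (norm p)\<^sup>2" "0 \<le> kappa_min"
    and gamma: "\<And>i. gamma_min \<le> G i" "\<And>i. G i \<le> gamma_max" "0 \<le> gamma_min"
    and h_min: "\<And>t. 0 \<le> t \<Longrightarrow> t \<le> 1 \<Longrightarrow> h_min t = kappa_min"
      "\<And>t. 1 < t \<Longrightarrow> t \<le> 2 \<Longrightarrow> h_min t = tau_min + phi_min"
    and h_max: "\<And>t. 0 \<le> t \<Longrightarrow> t \<le> 1 \<Longrightarrow> h_max t = kappa_max"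
      "\<And>t. 1 < t \<Longrightarrow> t \<le> 2 \<Longrightarrow> h_max t = tau_max + phi_max"
begin

definition SI :: "real^'m \<Rightarrow> real" where
  "SI q = (\<Sum>i\<in>UNIV. (b i \<bullet> q)\<^sup>2 / a i)"

lemma form_bounds_le:
  assumes "\<And>p :: real^'k. lo * (norm p)\<^sup>2 \<le> f p" "\<And>p :: real^'k. f p \<le> hi * (norm p)\<^sup>2"
  shows "lo \<le> hi"
  using order_trans[OF assms(1) assms(2), of "axis undefined 1"] by (simp add: norm_axis_1)

lemma const_order: "mu_min \<le> mu_max" "nu_min \<le> nu_max" "tau_min \<le> tau_max" "phi_min \<le> phi_max"
  "kappa_min \<le> kappa_max" "gamma_min \<le> gamma_max" "phi_max \<le> omega_max" "0 \<le> omega_max"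
proof -
  show "mu_min \<le> mu_max" "gamma_min \<le> gamma_max"
    using order_trans[OF mu(2) mu(3)] order_trans[OF gamma(1) gamma(2)] by blast+
  show "nu_min \<le> nu_max" "tau_min \<le> tau_max" "phi_min \<le> phi_max" "kappa_min \<le> kappa_max"
    by (rule form_bounds_le[OF nu(1,2)] form_bounds_le[OF tau(1,2)] form_bounds_le[OF phi(1,2)]
        form_bounds_le[OF kappa(1,2)])+
  show "0 \<le> omega_max"
    using form_bounds_le[of 0 "\<lambda>p. (norm (ct p))\<^sup>2", OF _ omega] by simp
  then show "phi_max \<le> omega_max"
    using w phi(4) by auto
qed

lemma nonneg: "0 \<le> nu_max" "0 \<le> tau_max" "0 \<le> phi_max" "0 \<le> kappa_max" "0 < mu_max"
  "0 \<le> varphi_min" "0 \<le> varphi_max" "varphi_min \<le> varphi_max" "varphi_max \<le> 2" "mu_max * varphi_max \<le> 2"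
  using const_order mu(1) nu(3,4,5) tau(3) phi(3) kappa(3) w varphi by auto

text \<open>All weighted sums are compared with \<open>SI\<close>, the only sum over the coordinates whose spectral bounds are
  given. The sums in \<open>ST\<close> and \<open>SQ\<close> are thus bounded by the extreme weights.\<close>

lemma weighted_le:
  assumes "\<And>i. f i \<le> k * (1 / a i)"
  shows "(\<Sum>i\<in>UNIV. f i * (b i \<bullet> q)\<^sup>2) \<le> k * SI q"
proof -
  have "(\<Sum>i\<in>UNIV. f i * (b i \<bullet> q)\<^sup>2) \<le> (\<Sum>i\<in>UNIV. k * (1 / a i) * (b i \<bullet> q)\<^sup>2)"
    using assms by (intro sum_mono mult_right_mono) auto
  then show ?thesis by (simp add: SI_def sum_distrib_left)
qed

lemma weighted_ge:
  assumes "\<And>i. k * (1 / a i) \<le> f i"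
  shows "k * SI q \<le> (\<Sum>i\<in>UNIV. f i * (b i \<bullet> q)\<^sup>2)"
proof -
  have "(\<Sum>i\<in>UNIV. k * (1 / a i) * (b i \<bullet> q)\<^sup>2) \<le> (\<Sum>i\<in>UNIV. f i * (b i \<bullet> q)\<^sup>2)"
    using assms by (intro sum_mono mult_right_mono) auto
  then show ?thesis by (simp add: SI_def sum_distrib_left)
qed

lemma SI_bounds: "nu_min * (norm q)\<^sup>2 \<le> SI q" "SI q \<le> nu_max * (norm q)\<^sup>2"
  using nu by (simp_all add: SI_def)

lemma SI_wct: "varphi_min * (norm (wct p))\<^sup>2 \<le> SI (wct p)" "SI (wct p) \<le> varphi_max * (norm (wct p))\<^sup>2"
  using SI_bounds[of "wct p"] w by (auto simp: varphi wct_def SI_def)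

lemma ST_bounds:
  assumes "\<And>i. i \<in> Neg \<Longrightarrow> lo \<le> 1" "\<And>i. i \<in> Neg \<Longrightarrow> 1 \<le> hi"
    and "\<And>i. i \<notin> Neg \<Longrightarrow> lo \<le> G i" "\<And>i. i \<notin> Neg \<Longrightarrow> G i \<le> hi" and "0 \<le> lo" "0 \<le> hi"
  shows "lo * varphi_min * (norm (wct p))\<^sup>2 \<le> ST (wct p)"
    "ST (wct p) \<le> hi * varphi_max * (norm (wct p))\<^sup>2"
proof -
  have "lo * SI (wct p) \<le> ST (wct p)"
    unfolding ST_def using assms a_pos
    by (intro weighted_ge) (auto intro!: divide_right_mono simp: less_imp_le)
  with mult_left_mono[OF SI_wct(1)[of p] \<open>0 \<le> lo\<close>]
  show "lo * varphi_min * (norm (wct p))\<^sup>2 \<le> ST (wct p)" by (simp add: mult.assoc)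
  have "ST (wct p) \<le> hi * SI (wct p)"
    unfolding ST_def using assms a_pos
    by (intro weighted_le) (auto intro!: divide_right_mono simp: less_imp_le)
  with mult_left_mono[OF SI_wct(2)[of p] \<open>0 \<le> hi\<close>]
  show "ST (wct p) \<le> hi * varphi_max * (norm (wct p))\<^sup>2" by (simp add: mult.assoc)
qed

lemma SQ_bounds:
  assumes "\<And>i. i \<in> Neg \<Longrightarrow> lo \<le> G i" "\<And>i. i \<in> Neg \<Longrightarrow> G i \<le> hi"
    and "\<And>i. i \<notin> Neg \<Longrightarrow> lo \<le> 1" "\<And>i. i \<notin> Neg \<Longrightarrow> 1 \<le> hi" and "0 \<le> lo" "0 \<le> hi"
  shows "lo * nu_min * (norm q)\<^sup>2 \<le> SQ q" "SQ q \<le> hi * nu_max * (norm q)\<^sup>2"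
proof -
  have "lo * SI q \<le> SQ q"
    unfolding SQ_def using assms a_pos
    by (intro weighted_ge) (auto intro!: divide_right_mono simp: less_imp_le)
  with mult_left_mono[OF SI_bounds(1)[of q] \<open>0 \<le> lo\<close>]
  show "lo * nu_min * (norm q)\<^sup>2 \<le> SQ q" by (simp add: mult.assoc)
  have "SQ q \<le> hi * SI q"
    unfolding SQ_def using assms a_pos
    by (intro weighted_le) (auto intro!: divide_right_mono simp: less_imp_le)
  with mult_left_mono[OF SI_bounds(2)[of q] \<open>0 \<le> hi\<close>]
  show "SQ q \<le> hi * nu_max * (norm q)\<^sup>2" by (simp add: mult.assoc)
qed

text \<open>The two branches of \<open>h_min\<close>: the form to be bounded is \<open>D + 2 |t|\<^sup>2\<close> minus at most \<open>H |t|\<^sup>2\<close> with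
  \<open>t = wct p\<close>. For \<open>H \<le> 1\<close> one copy of \<open>|t|\<^sup>2\<close> is kept together with \<open>D\<close>, where the sharper joint bound
  \<open>kappa_min\<close> applies, and \<open>(1 - H) |t|\<^sup>2\<close> is still nonnegative. For \<open>H > 1\<close> this coefficient is
  negative, so \<open>D\<close> and \<open>(2 - H) |t|\<^sup>2\<close> are bounded separately.\<close>

lemma third_block_lower:
  assumes H: "0 \<le> H" "H \<le> 2" and ST: "\<And>p. ST (wct p) \<le> H * (norm (wct p))\<^sup>2"
  shows "(h_min H + phi_min * (1 - H)) * (norm p)\<^sup>2 \<le> p \<bullet> (D *v p) + 2 * (norm (wct p))\<^sup>2 - ST (wct p)"
    and "0 \<le> h_min H + phi_min * (1 - H)"
proof -
  consider "H \<le> 1" | "1 < H" by linarith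
  then have "(h_min H + phi_min * (1 - H)) * (norm p)\<^sup>2 \<le> p \<bullet> (D *v p) + 2 * (norm (wct p))\<^sup>2 - ST (wct p) \<and>
     0 \<le> h_min H + phi_min * (1 - H)"
  proof cases
    case 1
    have "(1 - H) * (phi_min * (norm p)\<^sup>2) \<le> (1 - H) * (norm (wct p))\<^sup>2"
      using phi(1) 1 by (intro mult_left_mono) auto
    moreover have "0 \<le> (1 - H) * phi_min" using 1 phi(3) by simp
    ultimately show ?thesis
      using ST[of p] kappa(1)[of p] kappa(3) h_min(1)[OF H(1) 1]
      by (simp add: algebra_simps)
  next
    case 2
    have "(2 - H) * (phi_min * (norm p)\<^sup>2) \<le> (2 - H) * (norm (wct p))\<^sup>2"
      using phi(1) H by (intro mult_left_mono) auto
    moreover have "0 \<le> (2 - H) * phi_min" using H phi(3) by simp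
    ultimately show ?thesis
      using ST[of p] tau(1)[of p] tau(3) h_min(2)[OF 2 H(2)]
      by (simp add: algebra_simps)
  qed
  then show "(h_min H + phi_min * (1 - H)) * (norm p)\<^sup>2 \<le> p \<bullet> (D *v p) + 2 * (norm (wct p))\<^sup>2 - ST (wct p)"
    and "0 \<le> h_min H + phi_min * (1 - H)" by auto
qed

lemma third_block_upper:
  assumes H: "0 \<le> H" "H \<le> 2" "l \<le> H" and ST: "\<And>p. l * (norm (wct p))\<^sup>2 \<le> ST (wct p)"
  shows "p \<bullet> (D *v p) + 2 * (norm (wct p))\<^sup>2 - ST (wct p) \<le> (h_max H + phi_max * (1 - l)) * (norm p)\<^sup>2"
    and "0 \<le> h_max H + phi_max * (1 - l)"
proof -
  consider "H \<le> 1" | "1 < H" by linarith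
  then have "p \<bullet> (D *v p) + 2 * (norm (wct p))\<^sup>2 - ST (wct p) \<le> (h_max H + phi_max * (1 - l)) * (norm p)\<^sup>2 \<and>
     0 \<le> h_max H + phi_max * (1 - l)"
  proof cases
    case 1
    have "(1 - l) * (norm (wct p))\<^sup>2 \<le> (1 - l) * (phi_max * (norm p)\<^sup>2)"
      using phi(2) 1 H by (intro mult_left_mono) auto
    moreover have "0 \<le> phi_max * (1 - l)" using 1 H nonneg by simp
    ultimately show ?thesis
      using ST[of p] kappa(2)[of p] nonneg(4) h_max(1)[OF H(1) 1]
      by (simp add: algebra_simps)
  next
    case 2
    have "(2 - l) * (norm (wct p))\<^sup>2 \<le> (2 - l) * (phi_max * (norm p)\<^sup>2)"
      using phi(2) H by (intro mult_left_mono) auto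
    moreover have "0 \<le> (2 - l) * phi_max" using H nonneg by simp
    ultimately show ?thesis
      using ST[of p] tau(2)[of p] nonneg(2) h_max(2)[OF 2 H(2)]
      by (simp add: algebra_simps)
  qed
  then show "p \<bullet> (D *v p) + 2 * (norm (wct p))\<^sup>2 - ST (wct p) \<le> (h_max H + phi_max * (1 - l)) * (norm p)\<^sup>2"
    and "0 \<le> h_max H + phi_max * (1 - l)" by auto
qed

lemma norm_shear: "(norm (shear I q))\<^sup>2 = (\<Sum>i\<in>UNIV. (if i \<in> I then (r i / a i)\<^sup>2 else 0) * (b i \<bullet> q)\<^sup>2)"
  by (simp add: norm_vec_square shear_def mask_def power_mult_distrib if_distrib cong: if_cong)
    (intro sum.cong, auto simp: power_mult_distrib power_divide)

text \<open>With \<open>(r i)\<^sup>2 = 1 - G i\<close> the squared shear has the weights \<open>(1 - G i) / (a i)\<^sup>2\<close>. One factor \<open>1 / a i\<close> is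
  spent on \<open>SI\<close>, the remaining quotient is at most \<open>(1 - gamma_min) / mu_min\<close>.\<close>

lemma shear_Neg:
  assumes "gamma_min \<le> 1"
  shows "(norm (shear Neg (wct p)))\<^sup>2 \<le> phi_max * varphi_max * (1 - gamma_min) / mu_min * (norm p)\<^sup>2"
    and "0 \<le> phi_max * varphi_max * (1 - gamma_min) / mu_min"
proof -
  define k where "k = (1 - gamma_min) / mu_min"
  have k: "0 \<le> k" using assms mu(1) by (simp add: k_def)
  have "(if i \<in> Neg then (r i / a i)\<^sup>2 else 0) \<le> k * (1 / a i)" for i
  proof (cases "i \<in> Neg")
    case True
    have "(1 - G i) / a i \<le> k"
      unfolding k_def using mu(1,2) gamma(1)[of i] assms by (intro frac_le) auto
    then have "(1 - G i) / a i * (1 / a i) \<le> k * (1 / a i)"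
      using a_pos[of i] by (intro mult_right_mono) auto
    then show ?thesis using True r_neg[OF True] by (simp add: power_divide) (simp add: power2_eq_square)
  qed (use k a_pos[of i] in simp)
  then have "(norm (shear Neg (wct p)))\<^sup>2 \<le> k * SI (wct p)"
    unfolding norm_shear by (rule weighted_le)
  also have "\<dots> \<le> k * (varphi_max * (phi_max * (norm p)\<^sup>2))"
    using SI_wct(2)[of p] mult_left_mono[OF phi(2)[of p] nonneg(7)] k by (intro mult_left_mono) auto
  finally show "(norm (shear Neg (wct p)))\<^sup>2 \<le> phi_max * varphi_max * (1 - gamma_min) / mu_min * (norm p)\<^sup>2"
    by (simp add: k_def mult_ac)
  show "0 \<le> phi_max * varphi_max * (1 - gamma_min) / mu_min"
    using nonneg mu(1) assms by simp
qed

text \<open>Here \<open>(r i)\<^sup>2 = a i - 1\<close>, and the weight left after spending one factor \<open>1 / a i\<close> on \<open>SI\<close> is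
  \<open>1 - 1 / a i\<close>, which increases with \<open>a i\<close>.\<close>

lemma shear_Pos:
  assumes "1 \<le> mu_max" and Ga: "\<And>i. i \<notin> Neg \<Longrightarrow> G i = a i"
  shows "(norm (shear (-Neg) q))\<^sup>2 \<le> (nu_max - nu_max / mu_max) * (norm q)\<^sup>2"
    and "0 \<le> nu_max - nu_max / mu_max"
proof -
  define k where "k = 1 - 1 / mu_max"
  have k: "0 \<le> k" "nu_max - nu_max / mu_max = k * nu_max"
    using assms by (simp_all add: k_def field_simps)
  have "(if i \<in> -Neg then (r i / a i)\<^sup>2 else 0) \<le> k * (1 / a i)" for i
  proof (cases "i \<in> Neg")
    case False
    have "1 / mu_max \<le> 1 / a i"
      using mu(3) a_pos[of i] by (intro frac_le) auto
    then have "(a i - 1) / a i \<le> k"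
      unfolding k_def using a_pos[of i] by (simp add: diff_divide_distrib)
    then have "(a i - 1) / a i * (1 / a i) \<le> k * (1 / a i)"
      using a_pos[of i] by (intro mult_right_mono) auto
    then show ?thesis using False r_pos[OF False] Ga[OF False]
      by (simp add: power_divide) (simp add: power2_eq_square)
  qed (use k a_pos[of i] in simp)
  then have "(norm (shear (-Neg) q))\<^sup>2 \<le> k * SI q"
    unfolding norm_shear by (rule weighted_le)
  also have "\<dots> \<le> k * (nu_max * (norm q)\<^sup>2)"
    using SI_bounds(2)[of q] k by (intro mult_left_mono) auto
  finally show "(norm (shear (-Neg) q))\<^sup>2 \<le> (nu_max - nu_max / mu_max) * (norm q)\<^sup>2"
    by (simp add: k)
  show "0 \<le> nu_max - nu_max / mu_max" using k nonneg by simp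
qed

lemma shear_empty: "shear {} q = 0"
  by (simp add: shear_def mask_def vec_eq_iff)

lemma skew_Neg:
  assumes "\<And>i. i \<in> Neg \<Longrightarrow> (r i)\<^sup>2 * a i \<le> d" "0 \<le> d"
  shows "(\<Sum>i\<in>Neg. (r i * (b i \<bullet> q))\<^sup>2) \<le> nu_max * d * (norm q)\<^sup>2"
proof -
  have "(if i \<in> Neg then (r i)\<^sup>2 else 0) \<le> d * (1 / a i)" for i
    using assms(1)[of i] assms(2) a_pos[of i] by (auto simp: field_simps)
  then have "(\<Sum>i\<in>UNIV. (if i \<in> Neg then (r i)\<^sup>2 else 0) * (b i \<bullet> q)\<^sup>2) \<le> d * SI q"
    by (rule weighted_le)
  also have "\<dots> \<le> d * (nu_max * (norm q)\<^sup>2)"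
    using SI_bounds(2)[of q] assms(2) by (intro mult_left_mono) auto
  also have "(\<Sum>i\<in>UNIV. (if i \<in> Neg then (r i)\<^sup>2 else 0) * (b i \<bullet> q)\<^sup>2) = (\<Sum>i\<in>Neg. (r i * (b i \<bullet> q))\<^sup>2)"
    by (intro sum.mono_neutral_cong_right) (auto simp: power_mult_distrib)
  finally show ?thesis by (simp add: mult_ac)
qed

text \<open>The two terms are the contributions of the second block and of the coordinates outside \<open>Neg\<close> to the
  row of \<open>p\<close>. If \<open>w = 0\<close>, only \<open>ct p\<close> remains, which is bounded by \<open>omega_max\<close>; if \<open>w = 1\<close>, the first term is
  \<open>(1 - Pop) (ct p)\<close> and \<open>omega_max - phi_max\<close> vanishes.\<close>

lemma skew_Pos:
  assumes e: "\<And>i. i \<notin> Neg \<Longrightarrow> (r i)\<^sup>2 * a i \<le> e" "0 \<le> e"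
    and lo: "\<And>i. lo \<le> G i" "0 \<le> lo" and hi: "\<And>i. G i \<le> hi"
  shows "(norm (ct p - Pop (wct p)))\<^sup>2 + (\<Sum>i\<in>-Neg. (r i * (b i \<bullet> wct p))\<^sup>2)
      \<le> (omega_max - phi_max + phi_max * (e * varphi_max + varrho (hi * varphi_max) (lo * varphi_min)))
        * (norm p)\<^sup>2"
    and "0 \<le> omega_max - phi_max + phi_max * (e * varphi_max + varrho (hi * varphi_max) (lo * varphi_min))"
proof -
  have vr: "0 \<le> varrho s t" for s t by (simp add: varrho_def max_def)
  show "0 \<le> omega_max - phi_max + phi_max * (e * varphi_max + varrho (hi * varphi_max) (lo * varphi_min))"
    using vr const_order nonneg e(2) by simp
  have hi0: "0 \<le> hi" using order_trans[OF lo(1) hi] lo(2) by linarith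
  show "(norm (ct p - Pop (wct p)))\<^sup>2 + (\<Sum>i\<in>-Neg. (r i * (b i \<bullet> wct p))\<^sup>2)
      \<le> (omega_max - phi_max + phi_max * (e * varphi_max + varrho (hi * varphi_max) (lo * varphi_min)))
        * (norm p)\<^sup>2"
  proof (cases "w = 0")
    case True
    have "(norm (ct p))\<^sup>2 \<le> omega_max * (norm p)\<^sup>2" by (rule omega)
    moreover have "wct p = 0" unfolding wct_def by (simp add: True)
    moreover have "phi_max = 0" unfolding phi(4) by (simp add: True)
    ultimately show ?thesis by (simp add: Pop_def)
  next
    case False
    then have w1: "w = 1" using w by simp
    let ?t = "wct p"
    have ctp: "ct p = ?t" unfolding wct_def by (simp add: w1)
    have eqs: "varphi_min = nu_min" "varphi_max = nu_max" "phi_max = omega_max"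
      unfolding varphi phi(4) by (simp_all add: w1)
    have Pf: "q \<bullet> Pop q = (\<Sum>i\<in>UNIV. G i / a i * (b i \<bullet> q)\<^sup>2)" for q
      by (simp add: Pop_form power2_eq_square mult_ac)
    have "lo * nu_min * (norm q)\<^sup>2 \<le> q \<bullet> Pop q" for q
    proof -
      have "lo * SI q \<le> q \<bullet> Pop q"
        unfolding Pf using lo a_pos by (intro weighted_ge) (auto intro!: divide_right_mono simp: less_imp_le)
      with mult_left_mono[OF SI_bounds(1)[of q] lo(2)] show ?thesis by (simp add: mult.assoc)
    qed
    moreover have "q \<bullet> Pop q \<le> hi * nu_max * (norm q)\<^sup>2" for q
    proof -
      have "q \<bullet> Pop q \<le> hi * SI q"
        unfolding Pf using hi a_pos by (intro weighted_le) (auto intro!: divide_right_mono simp: less_imp_le)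
      with mult_left_mono[OF SI_bounds(2)[of q] hi0] show ?thesis by (simp add: mult.assoc)
    qed
    ultimately have 1: "(norm (?t - Pop ?t))\<^sup>2 \<le> varrho (hi * nu_max) (lo * nu_min) * (norm ?t)\<^sup>2"
      by (rule Pop_contraction)
    have "(if i \<in> -Neg then (r i)\<^sup>2 else 0) \<le> e * (1 / a i)" for i
      using e(1)[of i] e(2) a_pos[of i] by (auto simp: field_simps)
    then have "(\<Sum>i\<in>UNIV. (if i \<in> -Neg then (r i)\<^sup>2 else 0) * (b i \<bullet> ?t)\<^sup>2) \<le> e * SI ?t"
      by (rule weighted_le)
    also have "\<dots> \<le> e * (varphi_max * (norm ?t)\<^sup>2)"
      using SI_wct(2)[of p] e(2) by (intro mult_left_mono) auto
    also have "(\<Sum>i\<in>UNIV. (if i \<in> -Neg then (r i)\<^sup>2 else 0) * (b i \<bullet> ?t)\<^sup>2) = (\<Sum>i\<in>-Neg. (r i * (b i \<bullet> ?t))\<^sup>2)"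
      by (intro sum.mono_neutral_cong_right) (auto simp: power_mult_distrib)
    finally have 2: "(\<Sum>i\<in>-Neg. (r i * (b i \<bullet> ?t))\<^sup>2) \<le> e * (varphi_max * (norm ?t)\<^sup>2)" .
    have "(norm (?t - Pop ?t))\<^sup>2 + (\<Sum>i\<in>-Neg. (r i * (b i \<bullet> ?t))\<^sup>2)
      \<le> (e * varphi_max + varrho (hi * varphi_max) (lo * varphi_min)) * (norm ?t)\<^sup>2"
      using 1 2 by (simp add: eqs algebra_simps)
    also have "\<dots> \<le> (e * varphi_max + varrho (hi * varphi_max) (lo * varphi_min)) * (phi_max * (norm p)\<^sup>2)"
      using phi(2)[of p] vr e(2) nonneg by (intro mult_left_mono) auto
    finally show ?thesis by (simp add: ctp eqs mult_ac)
  qed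
qed

text \<open>The bound for the skew part is kept as its square \<open>\<rho>2\<close>, which is what the theorem gives in closed form; its
  nonnegativity is part of the claim.\<close>

definition enclosed :: "real \<Rightarrow> real \<Rightarrow> real \<Rightarrow> bool" where
  "enclosed l h \<rho>2 \<longleftrightarrow> 0 \<le> \<rho>2 \<and> (\<forall>x. l * (norm x)\<^sup>2 \<le> x \<bullet> T x \<and> x \<bullet> T x \<le> h * (norm x)\<^sup>2) \<and>
     (\<forall>x y. \<bar>x \<bullet> T y - y \<bullet> T x\<bar> \<le> 2 * sqrt \<rho>2 * norm x * norm y)"

text \<open>All coordinates are in \<open>Neg\<close>. In the symmetric part the second block then decouples, so its bounds
  \<open>gamma_min * nu_min\<close> and \<open>gamma_max * nu_max\<close> carry no factor \<open>g1\<close> or \<open>g2\<close>; this is why they are divided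
  by these factors inside the minimum and the maximum.\<close>

theorem enclosed_gamma_le_1:
  assumes Neg: "Neg = UNIV" and d: "\<And>i. (1 - G i) * a i \<le> d"
  defines "\<xi> \<equiv> phi_max * varphi_max * (1 - gamma_min) / mu_min"
  shows "enclosed
    (Min {mu_min, h_min varphi_max + phi_min * (1 - varphi_max), gamma_min * nu_min / g1 \<xi>} * g1 \<xi>)
    (Max {mu_max, h_max varphi_max + phi_max * (1 - varphi_min), gamma_max * nu_max / g2 \<xi>} * g2 \<xi>)
    (omega_max - phi_max + phi_max * varrho (gamma_max * varphi_max) (gamma_min * varphi_min) + nu_max * d)"
    (is "enclosed ?l ?h ?\<rho>")
proof -
  have G1: "G i \<le> 1" for i using r_neg[of i] zero_le_power2[of "r i"] Neg by simp
  have g1: "gamma_min \<le> 1" using order_trans[OF gamma(1) G1] .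
  have \<xi>: "0 \<le> \<xi>" "\<And>p. (norm (shear Neg (wct p)))\<^sup>2 \<le> \<xi> * (norm p)\<^sup>2"
    using shear_Neg[OF g1] by (simp_all add: \<xi>_def)
  have gp: "0 < g1 \<xi>" "1 \<le> g2 \<xi>" using g1_pos g2_ge_1 \<xi>(1) by auto
  have ST: "varphi_min * (norm (wct p))\<^sup>2 \<le> ST (wct p)" "ST (wct p) \<le> varphi_max * (norm (wct p))\<^sup>2" for p
    using ST_bounds[of 1 1 p] Neg by auto
  have SQ: "gamma_min * nu_min * (norm q)\<^sup>2 \<le> SQ q" "SQ q \<le> gamma_max * nu_max * (norm q)\<^sup>2" for q
    using SQ_bounds[of gamma_min gamma_max q] gamma const_order(6) Neg by auto
  define c c' where "c = h_min varphi_max + phi_min * (1 - varphi_max)"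
    and "c' = h_max varphi_max + phi_max * (1 - varphi_min)"
  have c: "c * (norm p)\<^sup>2 \<le> p \<bullet> (D *v p) + 2 * (norm (wct p))\<^sup>2 - ST (wct p)" "0 \<le> c" for p
    unfolding c_def using third_block_lower[OF nonneg(7,9)] ST by blast+
  have c': "p \<bullet> (D *v p) + 2 * (norm (wct p))\<^sup>2 - ST (wct p) \<le> c' * (norm p)\<^sup>2" "0 \<le> c'" for p
    unfolding c'_def using third_block_upper[OF nonneg(7,9,8)] ST by blast+
  have zero: "(norm (shear (-Neg) q))\<^sup>2 \<le> 0 * (norm q)\<^sup>2" for q
    by (simp add: Neg shear_empty)
  have "?l * (norm x)\<^sup>2 \<le> x \<bullet> T x" for x
  proof (rule real_part_lower[of "min mu_min c" "gamma_min * nu_min" \<xi> 0, OF _ _ _ _ SQ(1) _ \<xi>(2,1) zero])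
    show "min mu_min c * (norm p)\<^sup>2 \<le> p \<bullet> (D *v p) + 2 * (norm (wct p))\<^sup>2 - ST (wct p)" for p
      by (rule order_trans[OF mult_right_mono c(1)]) simp_all
    show "?l \<le> min mu_min c * g1 \<xi>"
      unfolding c_def using gp by (intro mult_right_mono) auto
    have "?l \<le> gamma_min * nu_min / g1 \<xi> * g1 \<xi>"
      using gp by (intro mult_right_mono) auto
    then show "?l \<le> gamma_min * nu_min * g1 0" using gp by simp
  qed (use mu c(2) gamma nu Neg in \<open>auto simp: min.coboundedI1\<close>)
  moreover have "x \<bullet> T x \<le> ?h * (norm x)\<^sup>2" for x
  proof (rule real_part_upper[of "max mu_max c'" "gamma_max * nu_max" \<xi> 0, OF _ _ _ _ SQ(2) _ \<xi>(2,1) zero])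
    show "p \<bullet> (D *v p) + 2 * (norm (wct p))\<^sup>2 - ST (wct p) \<le> max mu_max c' * (norm p)\<^sup>2" for p
      by (rule order_trans[OF c'(1) mult_right_mono]) simp_all
    show "max mu_max c' * g2 \<xi> \<le> ?h"
      unfolding c'_def using gp by (intro mult_right_mono) auto
    have "gamma_max * nu_max / g2 \<xi> * g2 \<xi> \<le> ?h"
      using gp by (intro mult_right_mono) auto
    then show "gamma_max * nu_max * g2 0 \<le> ?h" using gp by simp
  qed (use mu c'(2) gamma const_order nonneg Neg in \<open>auto simp: max.coboundedI1\<close>)
  moreover have d0: "0 \<le> d"
    using d[of undefined] G1[of undefined] a_pos[of undefined]
      mult_nonneg_nonneg[of "1 - G undefined" "a undefined"] by linarith
  have e: "(norm (ct p - Pop (wct p)))\<^sup>2 + (\<Sum>i\<in>-Neg. (r i * (b i \<bullet> wct p))\<^sup>2)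
      \<le> (omega_max - phi_max + phi_max * varrho (gamma_max * varphi_max) (gamma_min * varphi_min)) * (norm p)\<^sup>2"
    "0 \<le> omega_max - phi_max + phi_max * varrho (gamma_max * varphi_max) (gamma_min * varphi_min)" for p
    using skew_Pos[of 0, OF _ _ gamma(1,3,2)] Neg by auto
  have "\<bar>x \<bullet> T y - y \<bullet> T x\<bar> \<le> 2 * sqrt ?\<rho> * norm x * norm y" for x y
    using skew_part_bound[OF skew_Neg[OF _ d0] _ e, of x y] d0 d nonneg(1) r_neg Neg
    by (simp add: add.commute)
  moreover have "0 \<le> ?\<rho>" using e(2) d0 nonneg(1) by simp
  ultimately show ?thesis by (simp add: enclosed_def)
qed

text \<open>No coordinate is in \<open>Neg\<close>. In the symmetric part it is now the third block that decouples. Both Schur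
  complements use \<open>G i = a i\<close>: in the second block the weights of \<open>SQ\<close> become those of \<open>SI\<close>, in the third
  block they are \<open>a i\<close> times as large.\<close>

theorem enclosed_gamma_ge_1:
  assumes Neg: "Neg = {}" and Ga: "\<And>i. G i = a i"
  defines "\<xi> \<equiv> nu_max - nu_max / mu_max"
  shows "enclosed
    (Min {mu_min * g1 \<xi>, nu_min * g1 \<xi>, h_min (mu_max * varphi_max) + phi_min * (1 - mu_max * varphi_max)})
    (Max {mu_max * g2 \<xi>, nu_max * g2 \<xi>, h_max (mu_max * varphi_max) + phi_max * (1 - mu_min * varphi_min)})
    (omega_max - phi_max + phi_max * ((mu_max - 1) * mu_max * varphi_max
       + varrho (mu_max * varphi_max) (mu_min * varphi_min)))"
    (is "enclosed ?l ?h ?\<rho>")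
proof -
  have a1: "1 \<le> a i" for i using r_pos[of i] zero_le_power2[of "r i"] Neg Ga by simp
  have mu1: "1 \<le> mu_max" using order_trans[OF a1 mu(3)] .
  have \<xi>: "0 \<le> \<xi>" "\<And>q. (norm (shear (-Neg) q))\<^sup>2 \<le> \<xi> * (norm q)\<^sup>2"
    using shear_Pos[OF mu1] Ga by (simp_all add: \<xi>_def)
  have gp: "0 < g1 \<xi>" "1 \<le> g2 \<xi>" using g1_pos g2_ge_1 \<xi>(1) by auto
  have ST: "mu_min * varphi_min * (norm (wct p))\<^sup>2 \<le> ST (wct p)"
    "ST (wct p) \<le> mu_max * varphi_max * (norm (wct p))\<^sup>2" for p
    using ST_bounds[of mu_min mu_max p] mu mu1 Ga Neg by auto
  have SQ: "nu_min * (norm q)\<^sup>2 \<le> SQ q" "SQ q \<le> nu_max * (norm q)\<^sup>2" for q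
    using SQ_bounds[of 1 1 q] Neg by auto
  define c c' where "c = h_min (mu_max * varphi_max) + phi_min * (1 - mu_max * varphi_max)"
    and "c' = h_max (mu_max * varphi_max) + phi_max * (1 - mu_min * varphi_min)"
  have H: "0 \<le> mu_max * varphi_max" "mu_min * varphi_min \<le> mu_max * varphi_max"
    using nonneg mu(1) const_order by (auto intro: mult_mono)
  have c: "c * (norm p)\<^sup>2 \<le> p \<bullet> (D *v p) + 2 * (norm (wct p))\<^sup>2 - ST (wct p)" "0 \<le> c" for p
    unfolding c_def using third_block_lower[OF H(1) nonneg(10)] ST by blast+
  have c': "p \<bullet> (D *v p) + 2 * (norm (wct p))\<^sup>2 - ST (wct p) \<le> c' * (norm p)\<^sup>2" "0 \<le> c'" for p
    unfolding c'_def using third_block_upper[OF H(1) nonneg(10) H(2)] ST by blast+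
  have zero: "(norm (shear Neg (wct p)))\<^sup>2 \<le> 0 * (norm p)\<^sup>2" for p
    by (simp add: Neg shear_empty)
  have "?l * (norm x)\<^sup>2 \<le> x \<bullet> T x" for x
  proof (rule real_part_lower[of c "min mu_min nu_min" 0 \<xi>, OF _ c(1) c(2) _ _ _ zero _ \<xi>(2,1)])
    show "min mu_min nu_min * (norm q)\<^sup>2 \<le> SQ q" for q
      by (rule order_trans[OF mult_right_mono SQ(1)]) simp_all
    show "?l \<le> min mu_min nu_min * g1 \<xi>"
      by (cases "mu_min \<le> nu_min") (simp_all add: min_def)
    show "?l \<le> c * g1 0" by (simp add: c_def)
  qed (use mu nu Neg in \<open>auto simp: min.coboundedI1\<close>)
  moreover have "x \<bullet> T x \<le> ?h * (norm x)\<^sup>2" for x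
  proof (rule real_part_upper[of c' "max mu_max nu_max" 0 \<xi>, OF _ c'(1) c'(2) _ _ _ zero _ \<xi>(2,1)])
    show "SQ q \<le> max mu_max nu_max * (norm q)\<^sup>2" for q
      by (rule order_trans[OF SQ(2) mult_right_mono]) simp_all
    show "max mu_max nu_max * g2 \<xi> \<le> ?h"
      by (cases "mu_max \<le> nu_max") (simp_all add: max_def)
    show "c' * g2 0 \<le> ?h" by (simp add: c'_def)
  qed (use mu nu nonneg Neg in \<open>auto simp: max.coboundedI1\<close>)
  moreover have e0: "0 \<le> (mu_max - 1) * mu_max" using mu1 by simp
  have "(r i)\<^sup>2 * a i \<le> (mu_max - 1) * mu_max" for i
    using r_pos[of i] Neg Ga mu(3)[of i] a1[of i] by (simp add: mult_mono)
  note e = skew_Pos[OF this e0 mu(2)[folded Ga] less_imp_le[OF mu(1)] mu(3)[folded Ga]]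
  have e: "(norm (ct p - Pop (wct p)))\<^sup>2 + (\<Sum>i\<in>-Neg. (r i * (b i \<bullet> wct p))\<^sup>2) \<le> ?\<rho> * (norm p)\<^sup>2"
    "0 \<le> ?\<rho>" for p
    using e by auto
  have "\<bar>x \<bullet> T y - y \<bullet> T x\<bar> \<le> 2 * sqrt ?\<rho> * norm x * norm y" for x y
    using skew_part_bound[of 0, OF _ _ e, of x y] Neg by simp
  ultimately show ?thesis using e(2) by (simp add: enclosed_def)
qed

text \<open>The coordinates are split by \<open>a i \<le> 1\<close> and \<open>a i \<ge> 1\<close>, which improves one of the bounds for \<open>a i\<close> in each
  pair to 1. The weights of \<open>ST\<close> relative to \<open>SI\<close> are \<open>max 1 (a i)\<close>, those of \<open>SQ\<close> are \<open>min 1 (a i)\<close>.\<close>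

theorem enclosed_gamma_mixed:
  assumes Ga: "\<And>i. G i = a i" and g: "gamma_min \<le> 1" "mu_min \<le> 1" "1 \<le> mu_max"
    and d: "\<And>i. a i * (1 - a i) \<le> d" "0 \<le> d"
  defines "\<xi>h \<equiv> phi_max * varphi_max * (1 - gamma_min) / mu_min"
    and "\<xi> \<equiv> nu_max - nu_max / mu_max"
  shows "enclosed
    (Min {mu_min, h_min (mu_max * varphi_max) + phi_min * (1 - mu_max * varphi_max),
       g1 \<xi> / g1 \<xi>h, mu_min * nu_min * g1 \<xi> / g1 \<xi>h} * g1 \<xi>h)
    (Max {1, h_max (mu_max * varphi_max) + phi_max * (1 - varphi_min),
       mu_max * g2 \<xi> / g2 \<xi>h, nu_max * g2 \<xi> / g2 \<xi>h} * g2 \<xi>h)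
    (omega_max - phi_max + phi_max * ((mu_max - 1) * mu_max * varphi_max
       + varrho (mu_max * varphi_max) (mu_min * varphi_min)) + nu_max * d)"
    (is "enclosed ?l ?h ?\<rho>")
proof -
  have an: "a i \<le> 1" if "i \<in> Neg" for i using r_neg[OF that] zero_le_power2[of "r i"] Ga by simp
  have ap: "1 \<le> a i" if "i \<notin> Neg" for i using r_pos[OF that] zero_le_power2[of "r i"] Ga by simp
  have \<xi>h: "0 \<le> \<xi>h" "\<And>p. (norm (shear Neg (wct p)))\<^sup>2 \<le> \<xi>h * (norm p)\<^sup>2"
    using shear_Neg[OF g(1)] by (simp_all add: \<xi>h_def)
  have \<xi>: "0 \<le> \<xi>" "\<And>q. (norm (shear (-Neg) q))\<^sup>2 \<le> \<xi> * (norm q)\<^sup>2"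
    using shear_Pos[OF g(3)] Ga by (simp_all add: \<xi>_def)
  have gp: "0 < g1 \<xi>" "1 \<le> g2 \<xi>" "0 < g1 \<xi>h" "1 \<le> g2 \<xi>h" using g1_pos g2_ge_1 \<xi>(1) \<xi>h(1) by auto
  have ST: "varphi_min * (norm (wct p))\<^sup>2 \<le> ST (wct p)"
    "ST (wct p) \<le> mu_max * varphi_max * (norm (wct p))\<^sup>2" for p
    using ST_bounds[of 1 mu_max p] mu g Ga ap by auto
  have SQ: "mu_min * nu_min * (norm q)\<^sup>2 \<le> SQ q" "SQ q \<le> nu_max * (norm q)\<^sup>2" for q
    using SQ_bounds[of mu_min 1 q] mu g Ga an by auto
  define c c' where "c = h_min (mu_max * varphi_max) + phi_min * (1 - mu_max * varphi_max)"
    and "c' = h_max (mu_max * varphi_max) + phi_max * (1 - varphi_min)"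
  have H: "0 \<le> mu_max * varphi_max" "varphi_min \<le> mu_max * varphi_max"
    using nonneg mult_mono[OF g(3) nonneg(8)] by auto
  have c: "c * (norm p)\<^sup>2 \<le> p \<bullet> (D *v p) + 2 * (norm (wct p))\<^sup>2 - ST (wct p)" "0 \<le> c" for p
    unfolding c_def using third_block_lower[OF H(1) nonneg(10)] ST by blast+
  have c': "p \<bullet> (D *v p) + 2 * (norm (wct p))\<^sup>2 - ST (wct p) \<le> c' * (norm p)\<^sup>2" "0 \<le> c'" for p
    unfolding c'_def using third_block_upper[OF H(1) nonneg(10) H(2)] ST by blast+
  have "?l * (norm x)\<^sup>2 \<le> x \<bullet> T x" for x
  proof (rule real_part_lower[of "min mu_min c" "min 1 (mu_min * nu_min)" \<xi>h \<xi>, OF _ _ _ _ _ _ \<xi>h(2,1) \<xi>(2,1)])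
    show "min mu_min c * (norm p)\<^sup>2 \<le> p \<bullet> (D *v p) + 2 * (norm (wct p))\<^sup>2 - ST (wct p)" for p
      by (rule order_trans[OF mult_right_mono c(1)]) simp_all
    show "min 1 (mu_min * nu_min) * (norm q)\<^sup>2 \<le> SQ q" for q
      by (rule order_trans[OF mult_right_mono SQ(1)]) simp_all
    show "?l \<le> min mu_min c * g1 \<xi>h"
      unfolding c_def using gp by (intro mult_right_mono) auto
    have "?l \<le> g1 \<xi> / g1 \<xi>h * g1 \<xi>h" "?l \<le> mu_min * nu_min * g1 \<xi> / g1 \<xi>h * g1 \<xi>h"
      using gp by (intro mult_right_mono; auto)+
    then show "?l \<le> min 1 (mu_min * nu_min) * g1 \<xi>"
      using gp by (auto simp: min_def)
  qed (use mu c(2) nu ap in \<open>auto simp: min.coboundedI1\<close>)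
  moreover have "x \<bullet> T x \<le> ?h * (norm x)\<^sup>2" for x
  proof (rule real_part_upper[of "max 1 c'" "max mu_max nu_max" \<xi>h \<xi>, OF _ _ _ _ _ _ \<xi>h(2,1) \<xi>(2,1)])
    show "p \<bullet> (D *v p) + 2 * (norm (wct p))\<^sup>2 - ST (wct p) \<le> max 1 c' * (norm p)\<^sup>2" for p
      by (rule order_trans[OF c'(1) mult_right_mono]) simp_all
    show "SQ q \<le> max mu_max nu_max * (norm q)\<^sup>2" for q
      by (rule order_trans[OF SQ(2) mult_right_mono]) simp_all
    show "max 1 c' * g2 \<xi>h \<le> ?h"
      unfolding c'_def using gp by (intro mult_right_mono) auto
    have "mu_max * g2 \<xi> / g2 \<xi>h * g2 \<xi>h \<le> ?h" "nu_max * g2 \<xi> / g2 \<xi>h * g2 \<xi>h \<le> ?h"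
      using gp by (intro mult_right_mono; auto)+
    then show "max mu_max nu_max * g2 \<xi> \<le> ?h"
      using gp by (auto simp: max_def)
  qed (use mu nonneg an in \<open>auto simp: max.coboundedI1\<close>)
  moreover have e0: "0 \<le> (mu_max - 1) * mu_max" using g by simp
  have "(r i)\<^sup>2 * a i \<le> (mu_max - 1) * mu_max" if "i \<notin> Neg" for i
    using r_pos[OF that] Ga mu(3)[of i] ap[OF that] by (simp add: mult_mono)
  note e = skew_Pos[OF this e0 mu(2)[folded Ga] less_imp_le[OF mu(1)] mu(3)[folded Ga]]
  let ?e = "omega_max - phi_max + phi_max * ((mu_max - 1) * mu_max * varphi_max
       + varrho (mu_max * varphi_max) (mu_min * varphi_min))"
  have e: "(norm (ct p - Pop (wct p)))\<^sup>2 + (\<Sum>i\<in>-Neg. (r i * (b i \<bullet> wct p))\<^sup>2) \<le> ?e * (norm p)\<^sup>2"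
    "0 \<le> ?e" for p
    using e by auto
  have rd: "(r i)\<^sup>2 * a i \<le> d" if "i \<in> Neg" for i
    using r_neg[OF that] Ga d(1)[of i] by (simp add: mult.commute)
  have "\<bar>x \<bullet> T y - y \<bullet> T x\<bar> \<le> 2 * sqrt ?\<rho> * norm x * norm y" for x y
    using skew_part_bound[OF skew_Neg[OF rd d(2)] _ e, of x y] d(2) nonneg(1)
    by (simp add: add.commute)
  moreover have "0 \<le> ?\<rho>" using e(2) d(2) nonneg(1) by simp
  ultimately show ?thesis by (simp add: enclosed_def)
qed

end

section \<open>From the preconditioned matrix to the reduced system\<close>

definition join3 :: "'a^'n \<Rightarrow> 'a^'m \<Rightarrow> 'a^'l \<Rightarrow> 'a^('n + 'm + 'l)" where
  "join3 x y z = (\<chi> i. case i of Inl i \<Rightarrow> x $ i | Inr (Inl j) \<Rightarrow> y $ j | Inr (Inr k) \<Rightarrow> z $ k)"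

lemma sum_UNIV_Plus3: "(\<Sum>i\<in>(UNIV :: ('n::finite + 'm::finite + 'l::finite) set). f i) =
   (\<Sum>i\<in>UNIV. f (Inl i)) + (\<Sum>j\<in>UNIV. f (Inr (Inl j))) + (\<Sum>k\<in>UNIV. f (Inr (Inr k)))"
  for f :: "_ \<Rightarrow> 'a::comm_monoid_add"
proof -
  have *: "(\<Sum>i\<in>(UNIV :: ('p::finite + 'q::finite) set). g i) = (\<Sum>i\<in>UNIV. g (Inl i)) + (\<Sum>j\<in>UNIV. g (Inr j))"
    for g :: "_ \<Rightarrow> 'a"
    unfolding UNIV_Plus_UNIV[symmetric] by (subst sum.Plus) (simp_all add: o_def)
  show ?thesis by (simp add: * add.assoc)
qed

lemma block3_join3:
  "block3 A11 A12 A13 A21 A22 A23 A31 A32 A33 *v join3 x y z =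
   join3 (A11 *v x + A12 *v y + A13 *v z) (A21 *v x + A22 *v y + A23 *v z) (A31 *v x + A32 *v y + A33 *v z)"
  by (simp add: vec_eq_iff matrix_vector_mult_def sum_UNIV_Plus3 block3_def join3_def split: sum.split)

lemma join3_eq_iff [simp]: "join3 x y z = join3 x' y' z' \<longleftrightarrow> x = x' \<and> y = y' \<and> z = z'"
proof
  assume h: "join3 x y z = join3 x' y' z'"
  have "x $ i = x' $ i" "y $ j = y' $ j" "z $ k = z' $ k" for i j k
    using arg_cong[OF h, of "\<lambda>v. v $ Inl i"] arg_cong[OF h, of "\<lambda>v. v $ Inr (Inl j)"]
      arg_cong[OF h, of "\<lambda>v. v $ Inr (Inr k)"] by (simp_all add: join3_def)
  then show "x = x' \<and> y = y' \<and> z = z'" by (simp add: vec_eq_iff)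
qed auto

lemma join3_zero: "join3 0 0 0 = 0"
  by (simp add: join3_def vec_eq_iff split: sum.split)

lemma transpose_block3:
  "transpose (block3 A11 A12 A13 A21 A22 A23 A31 A32 A33) =
   block3 (transpose A11) (transpose A21) (transpose A31) (transpose A12) (transpose A22) (transpose A32)
     (transpose A13) (transpose A23) (transpose A33)"
  by (simp add: vec_eq_iff block3_def transpose_def split: sum.split)

definition part1 :: "'a^('n::finite + 'm::finite + 'l::finite) \<Rightarrow> 'a^'n" where "part1 x = (\<chi> i. x $ Inl i)"
definition part2 :: "'a^('n::finite + 'm::finite + 'l::finite) \<Rightarrow> 'a^'m" where "part2 x = (\<chi> i. x $ Inr (Inl i))"
definition part3 :: "'a^('n::finite + 'm::finite + 'l::finite) \<Rightarrow> 'a^'l" where "part3 x = (\<chi> i. x $ Inr (Inr i))"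

lemma join3_parts: "join3 (part1 x) (part2 x) (part3 x) = x"
  by (simp add: join3_def part1_def part2_def part3_def vec_eq_iff split: sum.split)

lemma parts_linear:
  "part1 (c *\<^sub>R x + d *\<^sub>R y) = c *\<^sub>R part1 x + d *\<^sub>R part1 y"
  "part2 (c *\<^sub>R x + d *\<^sub>R y) = c *\<^sub>R part2 x + d *\<^sub>R part2 y"
  "part3 (c *\<^sub>R x + d *\<^sub>R y) = c *\<^sub>R part3 x + d *\<^sub>R part3 y"
  for x y :: "real^('n::finite + 'm::finite + 'l::finite)"
  by (simp_all add: part1_def part2_def part3_def vec_eq_iff)

definition precond :: "real^'n^'n \<Rightarrow> real^'m^'m \<Rightarrow> real^'l^'l \<Rightarrow> real^'n^'m \<Rightarrow> real^'m^'l \<Rightarrow>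
    real^'n^'n \<Rightarrow> real^'n^'n \<Rightarrow> real^'m^'m \<Rightarrow> real^('n + 'm + 'l)^('n + 'm + 'l)" where
  "precond MA Shat MShat B C YA ZA WS =
          block3 (mat 1)    0              0
                 (B ** YA)  (mat 1)        0
                 0          (- (C ** WS))  (mat 1)
       ** block3 MA  0        0
                 0   (-Shat)  0
                 0   0        MShat
       ** block3 (mat 1)  (ZA ** transpose B)  0
                 0        (mat 1)              (- (WS ** transpose C))
                 0        0                    (mat 1)"

lemma matrix_minus_vector: "(- A) *v x = - (A *v x)" for A :: "real^'n^'m"
  by (simp add: matrix_vector_mult_def vec_eq_iff sum_negf)

lemma matrix_vector_minus: "A *v (- x) = - (A *v x)" for A :: "real^'n^'m"
  by (simp add: matrix_vector_mult_def vec_eq_iff sum_negf)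

lemma precond_join3:
  fixes x1 :: "real^'n" and x2 :: "real^'m" and x3 :: "real^'l"
  defines "y1 \<equiv> \<lambda>ZA (B :: real^'n^'m). x1 + ZA *v (transpose B *v x2)"
    and "y2 \<equiv> \<lambda>WS (C :: real^'m^'l). x2 - WS *v (transpose C *v x3)"
  shows "precond MA Shat MShat B C YA ZA WS *v join3 x1 x2 x3 =
    join3 (MA *v y1 ZA B) (B *v (YA *v (MA *v y1 ZA B)) - Shat *v y2 WS C)
      (C *v (WS *v (Shat *v y2 WS C)) + MShat *v x3)"
  unfolding precond_def matrix_vector_mul_assoc[symmetric] block3_join3 y1_def y2_def
  by (simp add: matrix_minus_vector matrix_vector_minus matrix_vector_mul_assoc[symmetric]
      matrix_vector_right_distrib matrix_vector_mult_diff_distrib)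

lemma transpose_neg: "transpose (- A) = - transpose A" for A :: "real^'n^'m"
  by (simp add: transpose_def vec_eq_iff)

lemma transpose_zero: "transpose (0 :: real^'n^'m) = 0"
  by (simp add: transpose_def vec_eq_iff)

lemma transpose_precond:
  assumes "transpose MA = MA" "transpose Shat = Shat" "transpose MShat = MShat"
    "transpose YA = YA" "transpose ZA = ZA" "transpose WS = WS"
  shows "transpose (precond MA Shat MShat B C YA ZA WS) = precond MA Shat MShat B C ZA YA WS"
  unfolding precond_def
  by (simp add: matrix_transpose_mul transpose_block3 transpose_neg transpose_zero assms matrix_mul_assoc)

lemma spd_ker: "spd P \<Longrightarrow> P *v x = 0 \<Longrightarrow> x = 0"
  by (force simp: spd_def)

lemma precond_ker:
  assumes "spd MA" "spd Shat" "spd MShat" and x: "precond MA Shat MShat B C YA ZA WS *v x = 0"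
  shows "x = 0"
proof -
  obtain x1 x2 x3 where xs: "x = join3 x1 x2 x3" using join3_parts[of x] by metis
  define y1 y2 where "y1 = x1 + ZA *v (transpose B *v x2)" and "y2 = x2 - WS *v (transpose C *v x3)"
  have e: "MA *v y1 = 0" "B *v (YA *v (MA *v y1)) - Shat *v y2 = 0"
    "C *v (WS *v (Shat *v y2)) + MShat *v x3 = 0"
    using x unfolding xs precond_join3 join3_zero[symmetric] y1_def y2_def by auto
  then have "Shat *v y2 = 0" by simp
  with e have "y1 = 0" "y2 = 0" "x3 = 0" using assms(1-3) spd_ker by auto
  then show ?thesis by (simp add: y1_def y2_def xs join3_zero)
qed

subsection \<open>Complex eigenvalues as pairs of real vectors\<close>

text \<open>The generalized eigenproblem \<open>K v = (\<alpha> + i \<beta>) M v\<close> for \<open>v = x + i y\<close>, split into real and imaginary parts.\<close>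

definition eigenpair :: "real^'k^'k \<Rightarrow> real^'k^'k \<Rightarrow> real \<Rightarrow> real \<Rightarrow> real^'k \<Rightarrow> real^'k \<Rightarrow> bool" where
  "eigenpair K M \<alpha> \<beta> x y \<longleftrightarrow> (x \<noteq> 0 \<or> y \<noteq> 0) \<and>
     K *v x = M *v (\<alpha> *\<^sub>R x - \<beta> *\<^sub>R y) \<and> K *v y = M *v (\<beta> *\<^sub>R x + \<alpha> *\<^sub>R y)"

lemma complex_eigenvalue_pair:
  fixes N :: "real^'k^'k"
  assumes "lam \<in> eigenvalues (map_matrix complex_of_real N)"
  obtains x y where "eigenpair N (mat 1) (Re lam) (Im lam) x y"
proof -
  obtain v where v: "v \<noteq> 0" "map_matrix complex_of_real N *v v = lam *s v"
    using assms by (auto simp: eigenvalues_def)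
  define x y where "x = (\<chi> i. Re (v $ i))" and "y = (\<chi> i. Im (v $ i))"
  have "(\<Sum>j\<in>UNIV. complex_of_real (N $ i $ j) * v $ j) = lam * v $ i" for i
    using arg_cong[OF v(2), of "\<lambda>v. v $ i"] by (simp add: matrix_vector_mult_def)
  then have "(\<Sum>j\<in>UNIV. N $ i $ j * Re (v $ j)) = Re (lam * v $ i)"
    "(\<Sum>j\<in>UNIV. N $ i $ j * Im (v $ j)) = Im (lam * v $ i)" for i
    by (simp_all flip: \<open>\<And>i. _ i = lam * v $ i\<close>)
  then have "N *v x = Re lam *\<^sub>R x - Im lam *\<^sub>R y" "N *v y = Im lam *\<^sub>R x + Re lam *\<^sub>R y"
    by (simp_all add: vec_eq_iff matrix_vector_mult_def x_def y_def)
  moreover have "x \<noteq> 0 \<or> y \<noteq> 0"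
    using v(1) by (auto simp: vec_eq_iff x_def y_def complex_eq_iff)
  ultimately show ?thesis by (intro that[of x y]) (simp add: eigenpair_def)
qed

lemma eigenvalues_det: "k \<in> eigenvalues A \<longleftrightarrow> det (A - mat k) = 0" for A :: "'a::field^'n^'n"
proof -
  have mk: "mat k *v v = k *s v" for v :: "'a^'n"
    by (simp add: matrix_vector_mult_def mat_def vec_eq_iff if_distrib[of "\<lambda>c. c * _"] cong: if_cong)
  have "det (A - mat k) = 0 \<longleftrightarrow> \<not> (\<exists>B. B ** (A - mat k) = mat 1)"
    using invertible_det_nz[of "A - mat k"] by (auto simp: invertible_left_inverse)
  also have "\<dots> \<longleftrightarrow> (\<exists>v. v \<noteq> 0 \<and> (A - mat k) *v v = 0)"
    unfolding matrix_left_invertible_ker by auto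
  also have "\<dots> \<longleftrightarrow> k \<in> eigenvalues A"
    by (simp add: eigenvalues_def matrix_vector_mult_diff_rdistrib mk)
  finally show ?thesis by simp
qed

text \<open>A matrix and its transpose have the same spectrum but unrelated eigenvectors, so the argument goes
  through the determinant.\<close>

lemma eigenvalues_transpose: "eigenvalues (transpose A) = eigenvalues A" for A :: "'a::field^'n^'n"
proof -
  have "transpose A - mat k = transpose (A - mat k)" for k
    by (simp add: transpose_def vec_eq_iff mat_def)
  then show ?thesis by (auto simp: eigenvalues_det)
qed

text \<open>The second pair comes from an eigenvector of \<open>(M\<inverse>K)\<^sup>T = K M\<^sup>-\<^sup>T\<close>, mapped by \<open>M\<^sup>-\<^sup>T\<close>. Together with
  \<open>transpose_precond\<close> it allows exchanging \<open>Y\<^sub>A\<close> and \<open>Z\<^sub>A\<close>.\<close>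

lemma preconditioned_eigenpairs:
  assumes lam: "lam \<in> eigenvalues (map_matrix complex_of_real (matrix_inv M ** K))"
    and K: "transpose K = K" and ker: "\<And>x. M *v x = 0 \<Longrightarrow> x = 0"
  obtains x y x' y' where "eigenpair K M (Re lam) (Im lam) x y"
    "eigenpair K (transpose M) (Re lam) (Im lam) x' y'"
proof -
  have M: "M ** matrix_inv M = mat 1" "matrix_inv M ** M = mat 1"
    using matrix_inv_right_ker[OF ker] by blast+
  obtain x y where "eigenpair (matrix_inv M ** K) (mat 1) (Re lam) (Im lam) x y"
    using complex_eigenvalue_pair[OF lam] .
  then have nz: "x \<noteq> 0 \<or> y \<noteq> 0" and
    x: "matrix_inv M *v (K *v x) = Re lam *\<^sub>R x - Im lam *\<^sub>R y" and
    y: "matrix_inv M *v (K *v y) = Im lam *\<^sub>R x + Re lam *\<^sub>R y"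
    by (auto simp: eigenpair_def matrix_vector_mul_assoc)
  have "M *v (matrix_inv M *v v) = v" for v
    by (simp add: matrix_vector_mul_assoc M)
  then have 1: "eigenpair K M (Re lam) (Im lam) x y"
    unfolding eigenpair_def x[symmetric] y[symmetric] using nz by simp
  have "map_matrix complex_of_real (transpose (matrix_inv M ** K)) =
      transpose (map_matrix complex_of_real (matrix_inv M ** K))"
    by (simp add: transpose_def vec_eq_iff)
  then have "lam \<in> eigenvalues (map_matrix complex_of_real (K ** transpose (matrix_inv M)))"
    using lam by (simp add: eigenvalues_transpose matrix_transpose_mul K)
  then obtain x y where "eigenpair (K ** transpose (matrix_inv M)) (mat 1) (Re lam) (Im lam) x y"
    by (rule complex_eigenvalue_pair)
  then have nz: "x \<noteq> 0 \<or> y \<noteq> 0" and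
    x: "K *v (transpose (matrix_inv M) *v x) = Re lam *\<^sub>R x - Im lam *\<^sub>R y" and
    y: "K *v (transpose (matrix_inv M) *v y) = Im lam *\<^sub>R x + Re lam *\<^sub>R y"
    by (auto simp: eigenpair_def matrix_vector_mul_assoc)
  have MT: "transpose M *v (transpose (matrix_inv M) *v v) = v" for v
    by (simp add: matrix_vector_mul_assoc M flip: matrix_transpose_mul)
  have "transpose (matrix_inv M) *v v \<noteq> 0" if "v \<noteq> 0" for v
    using MT[of v] that by auto
  then have 2: "eigenpair K (transpose M) (Re lam) (Im lam)
      (transpose (matrix_inv M) *v x) (transpose (matrix_inv M) *v y)"
    using nz x y MT
    by (auto simp: eigenpair_def matrix_vector_mult_diff_distrib matrix_vector_right_distrib
        matrix_vector_mult_scaleR)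
  show ?thesis by (rule that[OF 1 2])
qed

subsection \<open>Eigenvector coordinates\<close>

text \<open>The matrix \<open>M\<inverse>K\<close> in the new coordinates, before the rescaling of the first block that makes its coupling
  with the second block symmetric or skew. The factor \<open>y + z - y z a i\<close> is \<open>G i / a i\<close>.\<close>

definition unscaled :: "('n::finite \<Rightarrow> real) \<Rightarrow> ('n \<Rightarrow> real^'m) \<Rightarrow> real^'m^'l \<Rightarrow> real^'l^'l \<Rightarrow> real \<Rightarrow> real \<Rightarrow> real \<Rightarrow>
    (real^'n) \<times> (real^'m) \<times> (real^'l) \<Rightarrow> (real^'n) \<times> (real^'m) \<times> (real^'l)" where
  "unscaled a b C D w y z = (\<lambda>(u, q, p).
     let s = q + w *\<^sub>R (transpose C *v p);
         q' = (\<Sum>i\<in>UNIV. ((y + z - y * z * a i) * (b i \<bullet> s) - (1 - y * a i) * u $ i) *\<^sub>R b i)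
              - transpose C *v p
     in ((\<chi> i. a i * u $ i + (1 - z * a i) * (b i \<bullet> s)), q', C *v s + D *v p - w *\<^sub>R (C *v q')))"

lemma normalized_basis:
  fixes P V :: "real^'k^'k"
  assumes V: "transpose V ** P ** V = mat 1"
  shows "transpose V *v (P *v (V *v x)) = x" "V *v (transpose V *v (P *v x)) = x"
    "P *v (V *v (transpose V *v x)) = x" "matrix_inv P = V ** transpose V"
proof -
  have V2: "V ** (transpose V ** P) = mat 1"
    using V by (simp add: matrix_left_right_inverse)
  then have V3: "P ** (V ** transpose V) = mat 1"
    by (metis matrix_left_right_inverse1 matrix_mul_assoc)
  show "transpose V *v (P *v (V *v x)) = x"
    by (simp add: matrix_vector_mul_assoc matrix_mul_assoc V)
  show "V *v (transpose V *v (P *v x)) = x"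
    using V2 by (simp add: matrix_vector_mul_assoc matrix_mul_assoc)
  show "P *v (V *v (transpose V *v x)) = x"
    using V3 by (simp add: matrix_vector_mul_assoc matrix_mul_assoc)
  show "matrix_inv P = V ** transpose V"
    using V3 by (rule matrix_inv_unique)
qed

text \<open>The columns of \<open>V\<close>, \<open>W\<close> and \<open>Y\<close> are orthonormal bases for the inner products given by \<open>M\<^sub>A\<close> and by the two
  other diagonal blocks of the preconditioner; those of \<open>V\<close> also diagonalize \<open>A\<close>.\<close>

locale saddle_coordinates =
  fixes A MA V :: "real^'n^'n" and a :: "'n \<Rightarrow> real" and B :: "real^'n^'m" and C :: "real^'m^'l"
    and D MShat Y :: "real^'l^'l" and Shat W :: "real^'m^'m" and y z w :: real
  assumes V: "transpose V ** MA ** V = mat 1" "A ** V = MA ** V ** diag a"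
    and W: "transpose W ** Shat ** W = mat 1"
    and Y: "transpose Y ** MShat ** Y = mat 1"
begin

definition "Bc = transpose W ** B ** V"
definition "Cc = transpose Y ** C ** W"
definition "Dc = transpose Y ** D ** Y"
definition "bc i = column i Bc"

text \<open>The expansion, in these bases, of \<open>x\<close> multiplied by the upper triangular factor of \<open>M\<close>.\<close>

definition coords :: "real^('n + 'm + 'l) \<Rightarrow> (real^'n) \<times> (real^'m) \<times> (real^'l)" where
  "coords x =
     (transpose V *v (MA *v (part1 x + (z *\<^sub>R matrix_inv MA) *v (transpose B *v part2 x))),
      transpose W *v (Shat *v (part2 x - (w *\<^sub>R matrix_inv Shat) *v (transpose C *v part3 x))),
      transpose Y *v (MShat *v part3 x))"

lemma coords_linear: "coords (c *\<^sub>R x + d *\<^sub>R x') = c *\<^sub>R coords x + d *\<^sub>R coords x'"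
  by (simp add: coords_def parts_linear matrix_vector_right_distrib matrix_vector_mult_scaleR
      matrix_vector_mult_diff_distrib algebra_simps)

lemma coords_eq_0:
  assumes "coords x = 0"
  shows "x = 0"
proof -
  have V0: "v = 0" if "transpose V *v (MA *v v) = 0" for v
    using normalized_basis(2)[OF V(1), of v] that by simp
  have W0: "v = 0" if "transpose W *v (Shat *v v) = 0" for v
    using normalized_basis(2)[OF W, of v] that by simp
  have Y0: "v = 0" if "transpose Y *v (MShat *v v) = 0" for v
    using normalized_basis(2)[OF Y, of v] that by simp
  have p3: "part3 x = 0" using assms Y0[of "part3 x"] by (simp add: coords_def zero_prod_def)
  have p2: "part2 x = 0" using assms p3 W0[of "part2 x"] by (simp add: coords_def zero_prod_def)
  have p1: "part1 x = 0" using assms p2 V0[of "part1 x"] by (simp add: coords_def zero_prod_def)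
  show ?thesis using join3_parts[of x] by (simp add: p1 p2 p3 join3_zero)
qed

text \<open>If \<open>K x = M x'\<close>, then the lower triangular factor is removed by forward substitution and the upper one by
  passing from \<open>x\<close> to \<open>coords x\<close>. Arguing with a pair of vectors instead of \<open>M\<inverse>\<close> avoids inverting the factors.\<close>

lemma coords_step:
  assumes "block3 A (transpose B) 0 B 0 (transpose C) 0 C D *v x =
    precond MA Shat MShat B C (y *\<^sub>R matrix_inv MA) (z *\<^sub>R matrix_inv MA) (w *\<^sub>R matrix_inv Shat) *v x'"
  shows "unscaled a bc Cc Dc w y z (coords x) = coords x'"
proof -
  let ?Z = "z *\<^sub>R matrix_inv MA" and ?Y = "y *\<^sub>R matrix_inv MA" and ?W = "w *\<^sub>R matrix_inv Shat"
  define x1 x2 x3 where "x1 = part1 x" and "x2 = part2 x" and "x3 = part3 x"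
  define x1' x2' x3' where "x1' = part1 x'" and "x2' = part2 x'" and "x3' = part3 x'"
  define y1 y2 where "y1 = x1 + ?Z *v (transpose B *v x2)" and "y2 = x2 - ?W *v (transpose C *v x3)"
  define y1' y2' where "y1' = x1' + ?Z *v (transpose B *v x2')" and "y2' = x2' - ?W *v (transpose C *v x3')"
  define u q p where "u = transpose V *v (MA *v y1)" and "q = transpose W *v (Shat *v y2)"
    and "p = transpose Y *v (MShat *v x3)"
  define u' q' p' where "u' = transpose V *v (MA *v y1')" and "q' = transpose W *v (Shat *v y2')"
    and "p' = transpose Y *v (MShat *v x3')"
  note nV = normalized_basis[OF V(1)] and nW = normalized_basis[OF W] and nY = normalized_basis[OF Y]
  have "block3 A (transpose B) 0 B 0 (transpose C) 0 C D *v join3 x1 x2 x3 =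
    precond MA Shat MShat B C ?Y ?Z ?W *v join3 x1' x2' x3'"
    using assms by (simp add: x1_def x2_def x3_def x1'_def x2'_def x3'_def join3_parts)
  then have e1: "A *v x1 + transpose B *v x2 = MA *v y1'"
    and e2: "B *v x1 + transpose C *v x3 = B *v (?Y *v (MA *v y1')) - Shat *v y2'"
    and e3: "C *v x2 + D *v x3 = C *v (?W *v (Shat *v y2')) + MShat *v x3'"
    unfolding block3_join3 precond_join3 y1'_def y2'_def by simp_all
  have y: "y1 = V *v u" "y2 = W *v q" "x3 = Y *v p" "y1' = V *v u'" "y2' = W *v q'" "x3' = Y *v p'"
    unfolding u_def q_def p_def u'_def q'_def p'_def nV nW nY by simp_all
  have inv: "?Z *v v = z *\<^sub>R (V *v (transpose V *v v))" "?Y *v v = y *\<^sub>R (V *v (transpose V *v v))"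
    "?W *v v' = w *\<^sub>R (W *v (transpose W *v v'))" for v v'
    unfolding scaleR_matrix_vector_assoc[symmetric] nV(4) nW(4) by (simp_all add: matrix_vector_mul_assoc)
  have Cct: "transpose Cc *v v = transpose W *v (transpose C *v (Y *v v))" for v
    by (simp add: Cc_def matrix_transpose_mul matrix_vector_mul_assoc matrix_mul_assoc)
  have Bct: "transpose Bc *v v = transpose V *v (transpose B *v (W *v v))" for v
    by (simp add: Bc_def matrix_transpose_mul matrix_vector_mul_assoc matrix_mul_assoc)
  have Bcv: "Bc *v v = transpose W *v (B *v (V *v v))" and Ccv: "Cc *v v' = transpose Y *v (C *v (W *v v'))"
    and Dcv: "Dc *v v'' = transpose Y *v (D *v (Y *v v''))" for v v' v''
    by (simp_all add: Bc_def Cc_def Dc_def matrix_vector_mul_assoc matrix_mul_assoc)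
  define s where "s = q + w *\<^sub>R (transpose Cc *v p)"
  have x2: "x2 = W *v s"
    using y2_def unfolding s_def Cct y inv
    by (simp add: matrix_vector_right_distrib matrix_vector_mult_scaleR algebra_simps)
  have x1: "x1 = V *v (u - z *\<^sub>R (transpose Bc *v s))"
    using y1_def unfolding Bct x2 y inv
    by (simp add: matrix_vector_mult_diff_distrib matrix_vector_mult_scaleR algebra_simps)
  have AV: "A *v (V *v v) = MA *v (V *v (diag a *v v))" for v
    by (metis V(2) matrix_vector_mul_assoc)
  have u': "u' = diag a *v (u - z *\<^sub>R (transpose Bc *v s)) + transpose Bc *v s"
    using arg_cong[OF e1, of "\<lambda>v. transpose V *v v"]
    unfolding x1 x2 AV u'_def by (simp add: matrix_vector_right_distrib nV(1) Bct)
  have "transpose W *v (B *v (V *v (u - z *\<^sub>R (transpose Bc *v s)))) + transpose W *v (transpose C *v (Y *v p))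
      = y *\<^sub>R (transpose W *v (B *v (V *v u'))) - q'"
    using arg_cong[OF e2, of "\<lambda>v. transpose W *v v"]
    unfolding x1 y inv by (simp add: matrix_vector_right_distrib matrix_vector_mult_diff_distrib
        matrix_vector_mult_scaleR nV(1) nW(1))
  then have "q' = y *\<^sub>R (Bc *v u') - Bc *v (u - z *\<^sub>R (transpose Bc *v s)) - transpose Cc *v p"
    unfolding Bcv Cct by (simp add: algebra_simps)
  also have "\<dots> = Bc *v (y *\<^sub>R u' - (u - z *\<^sub>R (transpose Bc *v s))) - transpose Cc *v p"
    by (simp add: matrix_vector_mult_diff_distrib matrix_vector_mult_scaleR)
  finally have q': "q' = Bc *v (y *\<^sub>R u' - (u - z *\<^sub>R (transpose Bc *v s))) - transpose Cc *v p" .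
  have "transpose Y *v (C *v (W *v s)) + transpose Y *v (D *v (Y *v p)) =
     w *\<^sub>R (transpose Y *v (C *v (W *v q'))) + p'"
    using arg_cong[OF e3, of "\<lambda>v. transpose Y *v v"]
    unfolding x2 y inv by (simp add: matrix_vector_right_distrib
        matrix_vector_mult_scaleR nY(1) nW(1))
  then have p': "p' = Cc *v s + Dc *v p - w *\<^sub>R (Cc *v q')"
    unfolding Ccv Dcv by (simp add: algebra_simps)
  have bs: "(transpose Bc *v s) $ i = bc i \<bullet> s" for i
    by (simp add: matrix_vector_mult_def transpose_def bc_def column_def inner_vec_def)
  have ui: "u' $ i = a i * u $ i + (1 - z * a i) * (bc i \<bullet> s)" for i
    unfolding u' by (simp add: bs algebra_simps)
  have "Bc *v v = (\<Sum>i\<in>UNIV. v $ i *\<^sub>R bc i)" for v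
    by (simp add: matrix_mult_sum bc_def scalar_mult_eq_scaleR)
  then have "q' = (\<Sum>i\<in>UNIV. ((y + z - y * z * a i) * (bc i \<bullet> s) - (1 - y * a i) * u $ i) *\<^sub>R bc i)
              - transpose Cc *v p"
    unfolding q' by (simp add: bs ui) (intro sum.cong refl arg_cong2[of _ _ _ _ "(*\<^sub>R)"], simp add: algebra_simps)
  moreover have "u' = (\<chi> i. a i * u $ i + (1 - z * a i) * (bc i \<bullet> s))"
    by (simp add: vec_eq_iff ui)
  ultimately have "unscaled a bc Cc Dc w y z (u, q, p) = (u', q', p')"
    using p' by (simp add: unscaled_def Let_def flip: s_def)
  then show ?thesis
    by (simp add: coords_def u_def q_def p_def u'_def q'_def p'_def y1_def y2_def y1'_def y2'_def
        x1_def x2_def x3_def x1'_def x2'_def x3'_def)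
qed

lemma coords_eigenpair:
  assumes "eigenpair (block3 A (transpose B) 0 B 0 (transpose C) 0 C D)
      (precond MA Shat MShat B C (y *\<^sub>R matrix_inv MA) (z *\<^sub>R matrix_inv MA) (w *\<^sub>R matrix_inv Shat)) \<alpha> \<beta> x x'"
  shows "coords x \<noteq> 0 \<or> coords x' \<noteq> 0"
    "unscaled a bc Cc Dc w y z (coords x) = \<alpha> *\<^sub>R coords x - \<beta> *\<^sub>R coords x'"
    "unscaled a bc Cc Dc w y z (coords x') = \<beta> *\<^sub>R coords x + \<alpha> *\<^sub>R coords x'"
proof -
  show "coords x \<noteq> 0 \<or> coords x' \<noteq> 0"
    using assms coords_eq_0 by (auto simp: eigenpair_def)
  have "unscaled a bc Cc Dc w y z (coords x) = coords (\<alpha> *\<^sub>R x - \<beta> *\<^sub>R x')"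
    by (rule coords_step) (use assms in \<open>simp add: eigenpair_def\<close>)
  then show "unscaled a bc Cc Dc w y z (coords x) = \<alpha> *\<^sub>R coords x - \<beta> *\<^sub>R coords x'"
    using coords_linear[of \<alpha> x "- \<beta>" x'] by simp
  have "unscaled a bc Cc Dc w y z (coords x') = coords (\<beta> *\<^sub>R x + \<alpha> *\<^sub>R x')"
    by (rule coords_step) (use assms in \<open>simp add: eigenpair_def\<close>)
  then show "unscaled a bc Cc Dc w y z (coords x') = \<beta> *\<^sub>R coords x + \<alpha> *\<^sub>R coords x'"
    using coords_linear[of \<beta> x \<alpha> x'] by simp
qed

end

context reduced_system
begin

definition rescale :: "('n \<Rightarrow> real) \<Rightarrow> (real^'n) \<times> (real^'m) \<times> (real^'l) \<Rightarrow> (real^'n) \<times> (real^'m) \<times> (real^'l)" where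
  "rescale f = (\<lambda>(u, q, p). ((\<chi> i. f i * u $ i), q, p))"

lemma rescale_linear: "rescale f (c *\<^sub>R x + d *\<^sub>R y) = c *\<^sub>R rescale f x + d *\<^sub>R rescale f y"
  by (cases x; cases y) (simp add: rescale_def vec_eq_iff algebra_simps)

text \<open>Rescaling coordinate \<open>i\<close> by \<open>f i\<close> has to turn the coupling factors \<open>1 - z a i\<close> and \<open>1 - y a i\<close> into \<open>r i\<close> and
  \<open>sg i * r i\<close>. The relation is an intertwining, not a similarity, since \<open>f i\<close> may vanish.\<close>

lemma T_rescale:
  assumes f: "\<And>i. f i * (1 - z * a i) = r i" "\<And>i. 1 - y * a i = sg i * r i * f i"
    and G: "\<And>i. G i = y * a i + z * a i - y * z * (a i)\<^sup>2"
  shows "T (rescale f x) = rescale f (unscaled a b C D w y z x)"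
proof -
  obtain u q p where x: "x = (u, q, p)" by (cases x)
  define s where "s = q + w *\<^sub>R (transpose C *v p)"
  have s: "s = q + wct p" by (simp add: s_def wct_def ct_def)
  have g: "G i / a i = y + z - y * z * a i" for i
    using a_pos[of i] by (simp add: G field_simps power2_eq_square)
  define q' where "q' = (\<Sum>i\<in>UNIV. ((y + z - y * z * a i) * (b i \<bullet> s) - (1 - y * a i) * u $ i) *\<^sub>R b i)
      - transpose C *v p"
  have q': "T2 ((\<chi> i. f i * u $ i), q, p) = q'"
    unfolding T2_def prod.case s[symmetric] Pop_def g q'_def ct_def f(2)
    by (simp add: sum_subtractf sum.distrib algebra_simps)
  have "rescale f (unscaled a b C D w y z x) =
     ((\<chi> i. f i * (a i * u $ i + (1 - z * a i) * (b i \<bullet> s))), q', C *v s + D *v p - w *\<^sub>R (C *v q'))"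
    by (simp add: x unscaled_def rescale_def Let_def flip: s_def q'_def)
  moreover have "T (rescale f x) = ((\<chi> i. a i * (f i * u $ i) + r i * (b i \<bullet> s)), q', C *v s + D *v p - w *\<^sub>R (C *v q'))"
    unfolding x rescale_def prod.case T_def q' s[symmetric] by simp
  moreover have "f i * (a i * u $ i + (1 - z * a i) * (b i \<bullet> s)) = a i * (f i * u $ i) + r i * (b i \<bullet> s)" for i
    unfolding f(1)[of i, symmetric] by (simp add: algebra_simps)
  ultimately show ?thesis by simp
qed

text \<open>An eigenvector annihilated by the rescaling is supported on first-block coordinates with \<open>f i = 0\<close>, where
  \<open>unscaled\<close> acts as multiplication by \<open>a i\<close>. Since \<open>r i = 0\<close> there, the corresponding unit vector is an
  eigenvector of \<open>T\<close> for the same eigenvalue.\<close>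

lemma T_eigenpair:
  assumes f: "\<And>i. f i * (1 - z * a i) = r i" "\<And>i. 1 - y * a i = sg i * r i * f i"
    and G: "\<And>i. G i = y * a i + z * a i - y * z * (a i)\<^sup>2"
    and nz: "X \<noteq> 0 \<or> X' \<noteq> 0"
    and X: "unscaled a b C D w y z X = \<alpha> *\<^sub>R X - \<beta> *\<^sub>R X'"
    and X': "unscaled a b C D w y z X' = \<beta> *\<^sub>R X + \<alpha> *\<^sub>R X'"
  obtains x x' where "x \<noteq> 0 \<or> x' \<noteq> 0" "T x = \<alpha> *\<^sub>R x - \<beta> *\<^sub>R x'" "T x' = \<beta> *\<^sub>R x + \<alpha> *\<^sub>R x'"
proof (cases "rescale f X \<noteq> 0 \<or> rescale f X' \<noteq> 0")
  case True
  have "T (rescale f X) = \<alpha> *\<^sub>R rescale f X - \<beta> *\<^sub>R rescale f X'"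
    using T_rescale[OF f G, of X] rescale_linear[of f \<alpha> X "- \<beta>" X'] by (simp add: X)
  moreover have "T (rescale f X') = \<beta> *\<^sub>R rescale f X + \<alpha> *\<^sub>R rescale f X'"
    using T_rescale[OF f G, of X'] rescale_linear[of f \<beta> X \<alpha> X'] by (simp add: X')
  ultimately show ?thesis using that True by blast
next
  case False
  obtain u q p where Xe: "X = (u, q, p)" by (cases X)
  obtain v q' p' where Xe': "X' = (v, q', p')" by (cases X')
  have 0: "q = 0" "p = 0" "q' = 0" "p' = 0" and fu: "f i * u $ i = 0" "f i * v $ i = 0" for i
    using False by (auto simp: Xe Xe' rescale_def zero_prod_def vec_eq_iff)
  obtain i where i: "u $ i \<noteq> 0 \<or> v $ i \<noteq> 0"
    using nz by (auto simp: Xe Xe' 0 zero_prod_def vec_eq_iff)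
  then have fi: "f i = 0" using fu[of i] by auto
  then have ri: "r i = 0" using f(1)[of i] by simp
  have au: "a i * u $ i = \<alpha> * u $ i - \<beta> * v $ i" and av: "a i * v $ i = \<beta> * u $ i + \<alpha> * v $ i"
    using arg_cong[OF X, of "\<lambda>x. fst x $ i"] arg_cong[OF X', of "\<lambda>x. fst x $ i"]
    by (simp_all add: Xe Xe' 0 unscaled_def Let_def)
  have sq: "0 < (u $ i)\<^sup>2 + (v $ i)\<^sup>2"
    using i by (auto simp: add_pos_nonneg add_nonneg_pos)
  have "\<beta> * ((u $ i)\<^sup>2 + (v $ i)\<^sup>2) = u $ i * (a i * v $ i) - v $ i * (a i * u $ i)"
    unfolding au av by (simp add: power2_eq_square algebra_simps)
  then have \<beta>: "\<beta> = 0" using sq i by (auto simp: mult.commute mult.left_commute)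
  then have \<alpha>: "\<alpha> = a i" using au av i by auto
  define e where "e = (axis i 1 :: real^'n, 0 :: real^'m, 0 :: real^'l)"
  have "(\<Sum>j\<in>UNIV. (sg j * r j * axis i 1 $ j) *\<^sub>R b j) = 0"
    by (rule sum.neutral) (use ri in \<open>auto simp: axis_def\<close>)
  then have "T2 e = 0"
    by (simp add: T2_def e_def wct_def ct_def Pop_def)
  moreover have "(\<chi> j. a j * axis i 1 $ j) = a i *\<^sub>R axis i 1"
    by (simp add: vec_eq_iff axis_def)
  ultimately have "T e = a i *\<^sub>R e"
    by (simp add: T_def e_def wct_def ct_def)
  moreover have "T 0 = 0"
    by (simp add: T_def T2_def zero_prod_def wct_def ct_def Pop_def vec_eq_iff)
  moreover have "e \<noteq> 0" by (simp add: e_def zero_prod_def axis_eq_0_iff)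
  ultimately show ?thesis using that[of e 0] by (simp add: \<alpha> \<beta>)
qed

end

lemma (in bounded_system) eigenvalue_enclosure:
  assumes enc: "enclosed l h \<rho>2"
    and f: "\<And>i. f i * (1 - z * a i) = r i" "\<And>i. 1 - y * a i = sg i * r i * f i"
    and G: "\<And>i. G i = y * a i + z * a i - y * z * (a i)\<^sup>2"
    and nz: "X \<noteq> 0 \<or> X' \<noteq> 0"
    and X: "unscaled a b C D w y z X = \<alpha> *\<^sub>R X - \<beta> *\<^sub>R X'"
    and X': "unscaled a b C D w y z X' = \<beta> *\<^sub>R X + \<alpha> *\<^sub>R X'"
  shows "l \<le> \<alpha> \<and> \<alpha> \<le> h \<and> (\<exists>\<rho>\<ge>0. \<rho>\<^sup>2 = \<rho>2 \<and> \<bar>\<beta>\<bar> \<le> \<rho>)"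
proof -
  obtain x x' where x: "x \<noteq> 0 \<or> x' \<noteq> 0" "T x = \<alpha> *\<^sub>R x - \<beta> *\<^sub>R x'" "T x' = \<beta> *\<^sub>R x + \<alpha> *\<^sub>R x'"
    using T_eigenpair[OF f G nz X X'] .
  note be = bendixson[OF x(2,3,1)]
  have "l \<le> \<alpha>" "\<alpha> \<le> h" using enc be(1,2) by (auto simp: enclosed_def)
  moreover have "\<bar>\<beta>\<bar> \<le> sqrt \<rho>2" using enc be(3)[of "sqrt \<rho>2"] by (auto simp: enclosed_def)
  moreover have "(sqrt \<rho>2)\<^sup>2 = \<rho>2" "0 \<le> sqrt \<rho>2" using enc by (auto simp: enclosed_def)
  ultimately show ?thesis by blast
qed

section \<open>The eigenvalue data in eigenvector coordinates\<close>

lemma transpose_add: "transpose (A + B) = transpose A + transpose B" for A B :: "real^'n^'m"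
  by (simp add: transpose_def vec_eq_iff)

text \<open>The Rayleigh bounds in coordinates that are orthonormal for \<open>P\<close>; the form \<open>F\<close> is the one that appears in
  the reduced system.\<close>

lemma rayleigh_basis:
  fixes P H V :: "real^'k^'k"
  assumes P: "spd P" and H: "transpose H = H" and V: "transpose V ** P ** V = mat 1"
    and F: "\<And>q. (V *v q) \<bullet> (H *v (V *v q)) = F q"
  shows "lambda_min (matrix_inv P ** H) * (norm q)\<^sup>2 \<le> F q"
    and "F q \<le> lambda_max (matrix_inv P ** H) * (norm q)\<^sup>2"
    and "(\<And>q. 0 \<le> F q) \<Longrightarrow> 0 \<le> lambda_min (matrix_inv P ** H)"
proof -
  have "(V *v q) \<bullet> (P *v (V *v q)) = (norm q)\<^sup>2"
    by (metis inner_commute inner_matrix_vector normalized_basis(1)[OF V] power2_norm_eq_inner)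
  with rayleigh(1,2)[OF P H, of "V *v q"] F[of q]
  show "lambda_min (matrix_inv P ** H) * (norm q)\<^sup>2 \<le> F q"
    and "F q \<le> lambda_max (matrix_inv P ** H) * (norm q)\<^sup>2" by simp_all
  assume nn: "\<And>q. 0 \<le> F q"
  obtain v where v: "v \<bullet> (H *v v) = lambda_min (matrix_inv P ** H)"
    using rayleigh(3)[OF P H] by blast
  define q' where "q' = transpose V *v (P *v v)"
  have "V *v q' = v" by (simp add: q'_def normalized_basis(2)[OF V])
  then show "0 \<le> lambda_min (matrix_inv P ** H)"
    using F[of q'] nn[of q'] v by simp
qed

lemma lambda_scale:
  fixes N :: "real^'k^'k"
  assumes "w = 0 \<or> w = 1"
  shows "lambda_min (w *\<^sub>R N) = w * lambda_min N" "lambda_max (w *\<^sub>R N) = w * lambda_max N"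
proof -
  have "eigenvalues (0 :: real^'k^'k) = {0}"
  proof -
    have "axis undefined 1 \<noteq> (0 :: real^'k)" by (simp add: axis_eq_0_iff)
    then show ?thesis unfolding eigenvalues_def scalar_mult_eq_scaleR by fastforce
  qed
  then have "lambda_min (0 :: real^'k^'k) = 0" "lambda_max (0 :: real^'k^'k) = 0"
    unfolding lambda_min_def lambda_max_def by simp_all
  with assms show "lambda_min (w *\<^sub>R N) = w * lambda_min N" "lambda_max (w *\<^sub>R N) = w * lambda_max N"
    by auto
qed

context saddle_coordinates
begin

text \<open>The matrices whose eigenvalues the theorem takes on the first block are polynomials in \<open>M\<^sub>A\<inverse>A\<close> and hence diagonal in the basis \<open>V\<close>, which gives
  their extreme eigenvalues exactly.\<close>

lemma lambda_eigenbasis: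
  assumes "\<And>x. N *v (V *v x) = V *v (diag d *v x)"
  shows "lambda_min N = Min (range d)" "lambda_max N = Max (range d)"
proof -
  have "N ** V = V ** diag d"
    unfolding matrix_eq using assms by (simp flip: matrix_vector_mul_assoc)
  moreover have "(transpose V ** MA) ** V = mat 1" using V by simp
  ultimately show "lambda_min N = Min (range d)" "lambda_max N = Max (range d)"
    by (rule lambda_diagonalizable)+
qed

lemma MA_inv_A: "matrix_inv MA *v (A *v (V *v x)) = V *v (diag a *v x)"
proof -
  have "A *v (V *v x) = MA *v (V *v (diag a *v x))"
    by (metis V(2) matrix_vector_mul_assoc)
  then show ?thesis
    by (simp add: normalized_basis(4)[OF V(1)] normalized_basis(1)[OF V(1)] flip: matrix_vector_mul_assoc)
qed

lemma a_pos: 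
  assumes "spd A"
  shows "0 < a i"
proof -
  let ?v = "V *v axis i 1"
  have AV: "A *v ?v = MA *v (V *v (diag a *v axis i 1))"
    by (metis V(2) matrix_vector_mul_assoc)
  have "?v \<noteq> 0"
  proof
    assume v0: "?v = 0"
    have "axis i (1::real) = 0"
      using normalized_basis(1)[OF V(1), of "axis i 1"] unfolding v0 by simp
    then show False by (simp add: axis_eq_0_iff)
  qed
  then have "0 < ?v \<bullet> (A *v ?v)" using assms by (simp add: spd_def)
  also have "?v \<bullet> (A *v ?v) = axis i 1 \<bullet> (transpose V *v (MA *v (V *v (diag a *v axis i 1))))"
    unfolding AV by (metis inner_commute inner_matrix_vector)
  also have "\<dots> = a i"
    by (simp add: normalized_basis(1)[OF V(1)] inner_axis')
  finally show ?thesis .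
qed

lemma A_inv:
  assumes "spd A"
  shows "matrix_inv A *v x = V *v (diag (\<lambda>i. 1 / a i) *v (transpose V *v x))"
proof -
  have AV: "A *v (V *v v) = MA *v (V *v (diag a *v v))" for v
    by (metis V(2) matrix_vector_mul_assoc)
  have dd: "diag a *v (diag (\<lambda>i. 1 / a i) *v v) = v" for v
    using a_pos[OF assms] by (simp add: vec_eq_iff less_imp_neq[symmetric])
  have "A *v (V *v (diag (\<lambda>i. 1 / a i) *v (transpose V *v x))) = x" for x
    by (simp add: AV dd normalized_basis(3)[OF V(1)])
  then have "A ** (V ** diag (\<lambda>i. 1 / a i) ** transpose V) = mat 1"
    unfolding matrix_eq by (simp flip: matrix_vector_mul_assoc)
  then have "matrix_inv A = V ** diag (\<lambda>i. 1 / a i) ** transpose V"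
    by (rule matrix_inv_unique)
  then show ?thesis by (simp flip: matrix_vector_mul_assoc)
qed

lemma S_form:
  assumes "spd A"
  shows "(W *v q) \<bullet> ((B ** matrix_inv A ** transpose B) *v (W *v q)) = (\<Sum>i\<in>UNIV. (bc i \<bullet> q)\<^sup>2 / a i)"
proof -
  have Bct: "transpose Bc *v v = transpose V *v (transpose B *v (W *v v))" for v
    by (simp add: Bc_def matrix_transpose_mul matrix_vector_mul_assoc matrix_mul_assoc)
  have bs: "(transpose Bc *v s) $ i = bc i \<bullet> s" for i s
    by (simp add: matrix_vector_mult_def transpose_def bc_def column_def inner_vec_def)
  have "(W *v q) \<bullet> ((B ** matrix_inv A ** transpose B) *v (W *v q)) =
      (transpose Bc *v q) \<bullet> (diag (\<lambda>i. 1 / a i) *v (transpose Bc *v q))"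
    by (simp add: matrix_vector_mul_assoc[symmetric] A_inv[OF assms] Bct)
      (metis inner_matrix_vector)
  then show ?thesis by (simp add: inner_vec_def bs power2_eq_square)
qed

lemma C_form: "(Y *v p) \<bullet> ((C ** matrix_inv Shat ** transpose C) *v (Y *v p)) = (norm (transpose Cc *v p))\<^sup>2"
proof -
  have Cct: "transpose Cc *v v = transpose W *v (transpose C *v (Y *v v))" for v
    by (simp add: Cc_def matrix_transpose_mul matrix_vector_mul_assoc matrix_mul_assoc)
  show ?thesis
    unfolding power2_norm_eq_inner Cct normalized_basis(4)[OF W] matrix_vector_mul_assoc[symmetric]
    by (metis inner_matrix_vector)
qed

lemma D_form: "(Y *v p) \<bullet> (D *v (Y *v p)) = p \<bullet> (Dc *v p)"
  by (simp add: Dc_def matrix_vector_mul_assoc[symmetric]) (metis inner_commute inner_matrix_vector)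

lemma Dc_sym: "transpose D = D \<Longrightarrow> transpose Dc = Dc"
  by (simp add: Dc_def matrix_transpose_mul matrix_mul_assoc)

end

text \<open>The three choices of \<open>(y, z)\<close> up to exchange. For \<open>(0, 0)\<close> nothing is rescaled. For \<open>(1, 1)\<close> both factors
  equal \<open>1 - a i\<close>, whose absolute value is \<open>r i\<close>, and \<open>f i\<close> corrects the sign. For \<open>(1, 0)\<close> the whole factor
  \<open>1 - a i = \<plusminus>(r i)\<^sup>2\<close> is in one place, and half of it is moved.\<close>

lemma rescaling_exists:
  fixes a r G :: "'n \<Rightarrow> real"
  assumes yz: "y = 0 \<and> z = 0 \<or> y = 1 \<and> z = 1 \<or> y = 1 \<and> z = 0"
    and G: "\<And>i. G i = y * a i + z * a i - y * z * (a i)\<^sup>2"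
    and r: "\<And>i. r i = sqrt \<bar>1 - G i\<bar>"
    and Neg: "\<And>i. i \<in> Neg \<Longrightarrow> G i \<le> 1" "\<And>i. i \<notin> Neg \<Longrightarrow> 1 \<le> G i"
  obtains f where "\<And>i. f i * (1 - z * a i) = r i"
    "\<And>i. 1 - y * a i = (if i \<in> Neg then 1 else -1) * r i * f i"
proof -
  consider "y = 0" "z = 0" | "y = 1" "z = 1" | "y = 1" "z = 0" using yz by blast
  then show ?thesis
  proof cases
    case 1
    then have "i \<in> Neg" for i using Neg(2)[of i] G[of i] by auto
    then show ?thesis using that[of "\<lambda>_. 1"] 1 by (simp add: r G)
  next
    case 2
    have Ga: "1 - G i = (1 - a i)\<^sup>2" for i
      by (simp add: G 2 power2_eq_square algebra_simps)
    have ra: "r i = \<bar>1 - a i\<bar>" for i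
      unfolding r Ga by simp
    have "a i = 1" if "i \<notin> Neg" for i
    proof -
      have "(1 - a i)\<^sup>2 = 0"
        using Neg(2)[OF that] Ga[of i] zero_le_power2[of "1 - a i"] by linarith
      then show ?thesis by simp
    qed
    then show ?thesis using that[of "\<lambda>i. if a i \<le> 1 then 1 else -1"] 2 by (auto simp: ra)
  next
    case 3
    have "1 - a i = (if i \<in> Neg then 1 else -1) * r i * r i" for i
      using Neg[of i] by (auto simp: r G 3 simp flip: power2_eq_square)
    then show ?thesis using that[of r] 3 by simp
  qed
qed

theorem theorem4p1:
  fixes A MA YA ZA :: "real^'n^'n"
    and B :: "real^'n^'m"
    and C :: "real^'m^'l"
    and D MShat :: "real^'l^'l"
    and S Shat WS :: "real^'m^'m"
    and K M :: "real^('n + 'm + 'l)^('n + 'm + 'l)"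
    and h_min h_max :: "real \<Rightarrow> real"
    and lam :: complex
  assumes A: "spd A"
    and B: "rank B = CARD('m)" "CARD('m) \<le> CARD('n)"
    and D: "spsd D"
    and C: "\<not> spd D \<Longrightarrow> rank C = CARD('l)"
    and K: "K = block3
              A  (transpose B)  0
              B  0              (transpose C)
              0  C              D"
    and S: "S = B ** matrix_inv A ** transpose B"
    and MA: "spd MA" and Shat: "spd Shat" and MShat: "spd MShat"
    and WS: "WS \<in> {0, matrix_inv Shat}"
    and YA: "YA \<in> {0, matrix_inv MA}"
    and ZA: "ZA \<in> {0, matrix_inv MA}"
    and M: "M =
          block3 (mat 1)    0              0
                 (B ** YA)  (mat 1)        0
                 0          (- (C ** WS))  (mat 1)
       ** block3 MA  0        0
                 0   (-Shat)  0
                 0   0        MShat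
       ** block3 (mat 1)  (ZA ** transpose B)  0
                 0        (mat 1)              (- (WS ** transpose C))
                 0        0                    (mat 1)"
    and mu: "mu_min = lambda_min (matrix_inv MA ** A)"
            "mu_max = lambda_max (matrix_inv MA ** A)"
    and nu: "nu_min = lambda_min (matrix_inv Shat ** S)"
            "nu_max = lambda_max (matrix_inv Shat ** S)"
    and omega: "omega_min = lambda_min (matrix_inv MShat ** C ** matrix_inv Shat ** transpose C)"
               "omega_max = lambda_max (matrix_inv MShat ** C ** matrix_inv Shat ** transpose C)"
    and tau: "tau_min = lambda_min (matrix_inv MShat ** D)"
             "tau_max = lambda_max (matrix_inv MShat ** D)"
    and varphi: "varphi_min = lambda_min (WS ** S)"
                "varphi_max = lambda_max (WS ** S)"
    and phi: "phi_min = lambda_min (matrix_inv MShat ** C ** WS ** transpose C)"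
             "phi_max = lambda_max (matrix_inv MShat ** C ** WS ** transpose C)"
    and kappa: "kappa_min = lambda_min (matrix_inv MShat ** (D + C ** WS ** transpose C))"
               "kappa_max = lambda_max (matrix_inv MShat ** (D + C ** WS ** transpose C))"
    and gamma: "gamma_min = lambda_min (YA ** A + ZA ** A - YA ** A ** ZA ** A)"
               "gamma_max = lambda_max (YA ** A + ZA ** A - YA ** A ** ZA ** A)"
    and h_min: "\<And>t. 0 \<le> t \<Longrightarrow> t \<le> 1 \<Longrightarrow> h_min t = kappa_min"
               "\<And>t. 1 < t \<Longrightarrow> t \<le> 2 \<Longrightarrow> h_min t = tau_min + phi_min"
    and h_max: "\<And>t. 0 \<le> t \<Longrightarrow> t \<le> 1 \<Longrightarrow> h_max t = kappa_max"
               "\<And>t. 1 < t \<Longrightarrow> t \<le> 2 \<Longrightarrow> h_max t = tau_max + phi_max"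
    and xihat: "xihat = phi_max * varphi_max * (1 - gamma_min) / mu_min"
    and xi1: "xi1 = nu_max - nu_max / mu_max"
    and mu_bounds: "0 < mu_max" "mu_max \<le> 2"
    and nu_bounds: "0 < nu_max" "nu_max \<le> 2"
    and mu_nu_bounds: "0 < mu_max * nu_max" "mu_max * nu_max < 2"
    and lam: "lam \<in> eigenvalues (map_matrix complex_of_real (matrix_inv M ** K))"
  shows
    "(gamma_max \<le> 1 \<longrightarrow>
        Min {mu_min,
             h_min varphi_max + phi_min * (1 - varphi_max),
             gamma_min * nu_min / g1 xihat} * g1 xihat \<le> Re lam \<and>
        Re lam \<le> Max {mu_max,
             h_max varphi_max + phi_max * (1 - varphi_min),
             gamma_max * nu_max / g2 xihat} * g2 xihat \<and>
        (\<exists>rho\<ge>0.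
           rho\<^sup>2 = omega_max - phi_max
             + phi_max * varrho (gamma_max * varphi_max) (gamma_min * varphi_min)
             + nu_max * lambda_max ((mat 1 - YA ** A) ** (mat 1 - ZA ** A) ** matrix_inv MA ** A) \<and>
           \<bar>Im lam\<bar> \<le> rho)) \<and>
     (1 \<le> gamma_min \<longrightarrow>
        Min {mu_min * g1 xi1,
             nu_min * g1 xi1,
             h_min (mu_max * varphi_max) + phi_min * (1 - mu_max * varphi_max)} \<le> Re lam \<and>
        Re lam \<le> Max {mu_max * g2 xi1,
             nu_max * g2 xi1,
             h_max (mu_max * varphi_max) + phi_max * (1 - mu_min * varphi_min)} \<and>
        (\<exists>rho\<ge>0.
           rho\<^sup>2 = omega_max - phi_max
             + phi_max * ((mu_max - 1) * mu_max * varphi_max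
                          + varrho (mu_max * varphi_max) (mu_min * varphi_min)) \<and>
           \<bar>Im lam\<bar> \<le> rho)) \<and>
     (gamma_min < 1 \<and> 1 < gamma_max \<longrightarrow>
        Min {mu_min,
             h_min (mu_max * varphi_max) + phi_min * (1 - mu_max * varphi_max),
             g1 xi1 / g1 xihat,
             mu_min * nu_min * g1 xi1 / g1 xihat} * g1 xihat \<le> Re lam \<and>
        Re lam \<le> Max {1,
             h_max (mu_max * varphi_max) + phi_max * (1 - varphi_min),
             mu_max * g2 xi1 / g2 xihat,
             nu_max * g2 xi1 / g2 xihat} * g2 xihat \<and>
        (\<exists>rho\<ge>0.
           rho\<^sup>2 = omega_max - phi_max
             + phi_max * ((mu_max - 1) * mu_max * varphi_max
                          + varrho (mu_max * varphi_max) (mu_min * varphi_min))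
             + nu_max * lambda_max (matrix_inv MA ** A ** (mat 1 - matrix_inv MA ** A)) \<and>
           \<bar>Im lam\<bar> \<le> rho))"
proof -
  obtain ya where ya: "ya = 0 \<or> ya = 1" "YA = ya *\<^sub>R matrix_inv MA"
    using YA that[of 0] that[of 1] by auto
  obtain za where za: "za = 0 \<or> za = 1" "ZA = za *\<^sub>R matrix_inv MA"
    using ZA that[of 0] that[of 1] by auto
  obtain w where w: "w = 0 \<or> w = 1" "WS = w *\<^sub>R matrix_inv Shat"
    using WS that[of 0] that[of 1] by auto
  have Ksym: "transpose K = K"
    using A D by (simp add: K transpose_block3 transpose_zero spd_def spsd_def)
  have M': "M = precond MA Shat MShat B C (ya *\<^sub>R matrix_inv MA) (za *\<^sub>R matrix_inv MA) (w *\<^sub>R matrix_inv Shat)"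
    unfolding M precond_def ya(2) za(2) w(2) ..
  have MT: "transpose M = precond MA Shat MShat B C (za *\<^sub>R matrix_inv MA) (ya *\<^sub>R matrix_inv MA) (w *\<^sub>R matrix_inv Shat)"
    unfolding M' by (rule transpose_precond)
      (simp_all add: spd_sym MA Shat MShat spd_matrix_inv transpose_scalar)
  obtain x1 x1' x2 x2' where "eigenpair K M (Re lam) (Im lam) x1 x1'"
    "eigenpair K (transpose M) (Re lam) (Im lam) x2 x2'"
    using preconditioned_eigenpairs[OF lam Ksym] precond_ker[OF MA Shat MShat] unfolding M' by blast
  \<comment> \<open>If \<open>(ya, za) = (0, 1)\<close>, the pair for the transposed preconditioner is taken; \<open>G\<close> below depends only on the sum and the product of \<open>y\<close> and \<open>z\<close>.\<close>
  then obtain y z x x' where yz: "y = 0 \<and> z = 0 \<or> y = 1 \<and> z = 1 \<or> y = 1 \<and> z = 0"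
    "y + z = ya + za" "y * z = ya * za" and
    pair: "eigenpair K (precond MA Shat MShat B C (y *\<^sub>R matrix_inv MA) (z *\<^sub>R matrix_inv MA)
      (w *\<^sub>R matrix_inv Shat)) (Re lam) (Im lam) x x'"
    using ya(1) za(1) unfolding MT unfolding M' by fastforce
  obtain V :: "real^'n^'n" and a where V: "transpose V ** MA ** V = mat 1" "A ** V = MA ** V ** diag a"
    using simultaneous_diagonalization[OF MA spd_sym[OF A]] .
  obtain W :: "real^'m^'m" and d where W: "transpose W ** Shat ** W = mat 1"
    using simultaneous_diagonalization[OF Shat spd_sym[OF Shat]] .
  obtain Y :: "real^'l^'l" and d where Y: "transpose Y ** MShat ** Y = mat 1"
    using simultaneous_diagonalization[OF MShat spd_sym[OF MShat]] .
  interpret sc: saddle_coordinates A MA V a B C D MShat Y Shat W y z w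
    by unfold_locales (use V W Y in auto)
  define G where "G i = y * a i + z * a i - y * z * (a i)\<^sup>2" for i
  have G': "G i = ya * a i + za * a i - ya * za * (a i)\<^sup>2" for i
    unfolding G_def yz(3) distrib_right[symmetric] yz(2) ..
  define r where "r i = sqrt \<bar>1 - G i\<bar>" for i
  note a_pos = sc.a_pos[OF A]
  have YAv: "YA *v (A *v (V *v v)) = V *v (ya *\<^sub>R (diag a *v v))"
    and ZAv: "ZA *v (A *v (V *v v)) = V *v (za *\<^sub>R (diag a *v v))" for v
    unfolding ya(2) za(2) scaleR_matrix_vector_assoc[symmetric] sc.MA_inv_A
    by (simp_all add: matrix_vector_mult_scaleR)
  have mu': "mu_min = Min (range a)" "mu_max = Max (range a)"
    unfolding mu by (rule sc.lambda_eigenbasis; simp add: sc.MA_inv_A flip: matrix_vector_mul_assoc)+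
  have gamma': "gamma_min = Min (range G)" "gamma_max = Max (range G)"
  proof -
    have "(YA ** A + ZA ** A - YA ** A ** ZA ** A) *v (V *v v) = V *v (diag G *v v)" for v
    proof -
      have "(YA ** A + ZA ** A - YA ** A ** ZA ** A) *v (V *v v) =
        V *v (ya *\<^sub>R (diag a *v v) + za *\<^sub>R (diag a *v v) - ya *\<^sub>R (diag a *v (za *\<^sub>R (diag a *v v))))"
        by (simp add: matrix_vector_mult_diff_rdistrib matrix_vector_mult_add_rdistrib
            matrix_vector_mul_assoc[symmetric] YAv ZAv matrix_vector_right_distrib matrix_vector_mult_diff_distrib)
      also have "ya *\<^sub>R (diag a *v v) + za *\<^sub>R (diag a *v v) - ya *\<^sub>R (diag a *v (za *\<^sub>R (diag a *v v))) = diag G *v v"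
        by (simp add: vec_eq_iff G' power2_eq_square algebra_simps)
      finally show ?thesis .
    qed
    then show "gamma_min = Min (range G)" "gamma_max = Max (range G)"
      unfolding gamma by (rule sc.lambda_eigenbasis)+
  qed
  define \<delta>1 where "\<delta>1 = lambda_max ((mat 1 - YA ** A) ** (mat 1 - ZA ** A) ** matrix_inv MA ** A)"
  have \<delta>1: "(1 - G i) * a i \<le> \<delta>1" for i
  proof -
    have "((mat 1 - YA ** A) ** (mat 1 - ZA ** A) ** matrix_inv MA ** A) *v (V *v v) =
        V *v (diag (\<lambda>i. (1 - G i) * a i) *v v)" for v
    proof -
      define v1 where "v1 = diag a *v v"
      define v2 where "v2 = v1 - za *\<^sub>R (diag a *v v1)"
      have "((mat 1 - YA ** A) ** (mat 1 - ZA ** A) ** matrix_inv MA ** A) *v (V *v v) =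
        V *v (v2 - ya *\<^sub>R (diag a *v v2))"
        by (simp add: matrix_vector_mult_diff_rdistrib matrix_vector_mul_assoc[symmetric] YAv ZAv
            matrix_vector_mult_diff_distrib matrix_vector_mult_scaleR scaleR_diff_right sc.MA_inv_A
            v1_def v2_def)
      also have "v2 - ya *\<^sub>R (diag a *v v2) = diag (\<lambda>i. (1 - G i) * a i) *v v"
        by (simp add: vec_eq_iff v1_def v2_def G' power2_eq_square algebra_simps)
      finally show ?thesis .
    qed
    then have "\<delta>1 = Max (range (\<lambda>i. (1 - G i) * a i))"
      unfolding \<delta>1_def by (rule sc.lambda_eigenbasis)
    then show ?thesis by simp
  qed
  define \<delta>3 where "\<delta>3 = lambda_max (matrix_inv MA ** A ** (mat 1 - matrix_inv MA ** A))"
  have \<delta>3: "a i * (1 - a i) \<le> \<delta>3" for i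
  proof -
    have "(matrix_inv MA ** A ** (mat 1 - matrix_inv MA ** A)) *v (V *v v) =
        V *v (diag (\<lambda>i. a i * (1 - a i)) *v v)" for v
    proof -
      have "(matrix_inv MA ** A ** (mat 1 - matrix_inv MA ** A)) *v (V *v v) =
        V *v (diag a *v v - diag a *v (diag a *v v))"
        by (simp add: matrix_vector_mult_diff_rdistrib matrix_vector_mul_assoc[symmetric]
            matrix_vector_mult_diff_distrib sc.MA_inv_A)
      also have "diag a *v v - diag a *v (diag a *v v) = diag (\<lambda>i. a i * (1 - a i)) *v v"
        by (simp add: vec_eq_iff algebra_simps)
      finally show ?thesis .
    qed
    then have "\<delta>3 = Max (range (\<lambda>i. a i * (1 - a i)))"
      unfolding \<delta>3_def by (rule sc.lambda_eigenbasis)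
    then show ?thesis by simp
  qed
  have mu_a: "mu_min \<le> a i" "a i \<le> mu_max" for i by (simp_all add: mu')
  have gamma_G: "gamma_min \<le> G i" "G i \<le> gamma_max" for i by (simp_all add: gamma')
  have a2: "a i \<le> 2" for i using mu_a(2)[of i] mu_bounds(2) by linarith
  have G0: "0 \<le> G i" for i
    using yz(1) a2[of i] a_pos[of i] mult_nonneg_nonneg[of "2 - a i" "a i"]
    by (auto simp: G_def power2_eq_square algebra_simps)
  have mu_pos: "0 < mu_min" using a_pos by (simp add: mu')
  have gamma0: "0 \<le> gamma_min" using G0 by (simp add: gamma')
  have Ssym: "transpose S = S"
    by (simp add: S matrix_transpose_mul spd_matrix_inv(3)[OF A] matrix_mul_assoc)
  define CC where "CC = C ** matrix_inv Shat ** transpose C"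
  have CCsym: "transpose CC = CC"
    by (simp add: CC_def matrix_transpose_mul spd_matrix_inv(3)[OF Shat] matrix_mul_assoc)
  have Dsym: "transpose D = D" using D by (simp add: spsd_def)
  have Dpos: "0 \<le> p \<bullet> (sc.Dc *v p)" for p
    using D unfolding sc.D_form[symmetric] spsd_def by blast
  note nuR = rayleigh_basis[OF Shat Ssym W sc.S_form[OF A, folded S]]
  note omR = rayleigh_basis[OF MShat CCsym Y sc.C_form[folded CC_def]]
  note tauR = rayleigh_basis[OF MShat Dsym Y sc.D_form]
  have om: "omega_min = lambda_min (matrix_inv MShat ** CC)" "omega_max = lambda_max (matrix_inv MShat ** CC)"
    unfolding omega CC_def matrix_mul_assoc by simp_all
  have om0: "0 \<le> omega_min" unfolding om by (rule omR(3)) simp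
  have varphi': "varphi_min = w * nu_min" "varphi_max = w * nu_max"
    unfolding varphi nu w(2) scalar_matrix_assoc[symmetric] by (simp_all add: lambda_scale[OF w(1)])
  have phi_mat: "matrix_inv MShat ** C ** WS ** transpose C = w *\<^sub>R (matrix_inv MShat ** CC)"
    unfolding w(2) CC_def
    by (simp add: matrix_scalar_ac matrix_mul_assoc flip: scalar_matrix_assoc)
  have phi': "phi_min = w * omega_min" "phi_max = w * omega_max"
    unfolding phi om phi_mat by (simp_all add: lambda_scale[OF w(1)])
  have kappa_mat: "D + C ** WS ** transpose C = D + w *\<^sub>R CC"
    unfolding w(2) CC_def by (simp add: matrix_scalar_ac flip: scalar_matrix_assoc)
  have Hsym: "transpose (D + w *\<^sub>R CC) = D + w *\<^sub>R CC"
    by (simp add: transpose_add transpose_scalar Dsym CCsym)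
  have kF: "(Y *v p) \<bullet> ((D + w *\<^sub>R CC) *v (Y *v p)) = p \<bullet> (sc.Dc *v p) + w * (norm (transpose sc.Cc *v p))\<^sup>2" for p
    using sc.D_form[of p] sc.C_form[of p]
    by (simp add: matrix_vector_mult_add_rdistrib inner_add_right CC_def flip: scaleR_matrix_vector_assoc)
  note kaR = rayleigh_basis[OF MShat Hsym Y kF, folded kappa_mat, folded kappa]
  have nu0: "0 \<le> nu_min"
    unfolding nu by (rule nuR(3)) (use a_pos in \<open>auto intro!: sum_nonneg divide_nonneg_nonneg simp: less_imp_le\<close>)
  have tau0: "0 \<le> tau_min" unfolding tau by (rule tauR(3)[OF Dpos])
  have kappa0: "0 \<le> kappa_min" by (rule kaR(3)) (use Dpos w(1) in \<open>auto intro: add_nonneg_nonneg\<close>)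
  have bs: "bounded_system Neg a r G sc.bc sc.Cc sc.Dc w mu_min mu_max nu_min nu_max omega_max
      tau_min tau_max varphi_min varphi_max phi_min phi_max kappa_min kappa_max gamma_min gamma_max h_min h_max"
    if Neg: "\<forall>i\<in>Neg. G i \<le> 1" "\<forall>i\<in>-Neg. 1 \<le> G i" for Neg
  proof -
    interpret rs: reduced_system Neg a r G sc.bc sc.Cc sc.Dc w
      by unfold_locales (use Neg a_pos w(1) sc.Dc_sym[OF Dsym] in \<open>auto simp: r_def\<close>)
    have wct: "(norm (rs.wct p))\<^sup>2 = w * (norm (rs.ct p))\<^sup>2" for p
      using w(1) by (auto simp: rs.wct_def)
    have ct: "omega_min * (norm p)\<^sup>2 \<le> (norm (rs.ct p))\<^sup>2" "(norm (rs.ct p))\<^sup>2 \<le> omega_max * (norm p)\<^sup>2" for p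
      using omR(1,2)[of p] by (simp_all add: rs.ct_def om)
    have w0: "0 \<le> w" using w(1) by auto
    show ?thesis
    proof unfold_locales
      show "phi_min * (norm p)\<^sup>2 \<le> (norm (rs.wct p))\<^sup>2" "(norm (rs.wct p))\<^sup>2 \<le> phi_max * (norm p)\<^sup>2" for p
        using mult_left_mono[OF ct(1)[of p] w0] mult_left_mono[OF ct(2)[of p] w0]
        unfolding wct phi' by (simp_all add: mult.assoc)
      show "kappa_min * (norm p)\<^sup>2 \<le> p \<bullet> (sc.Dc *v p) + (norm (rs.wct p))\<^sup>2"
        "p \<bullet> (sc.Dc *v p) + (norm (rs.wct p))\<^sup>2 \<le> kappa_max * (norm p)\<^sup>2" for p
        unfolding wct rs.ct_def using kaR(1,2)[of p] by simp_all
      show "nu_min * (norm q)\<^sup>2 \<le> (\<Sum>i\<in>UNIV. (sc.bc i \<bullet> q)\<^sup>2 / a i)"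
        "(\<Sum>i\<in>UNIV. (sc.bc i \<bullet> q)\<^sup>2 / a i) \<le> nu_max * (norm q)\<^sup>2" for q
        unfolding nu using nuR(1,2)[of q] by simp_all
      show "tau_min * (norm p)\<^sup>2 \<le> p \<bullet> (sc.Dc *v p)" "p \<bullet> (sc.Dc *v p) \<le> tau_max * (norm p)\<^sup>2" for p
        unfolding tau using tauR(1,2)[of p] by simp_all
      show "0 \<le> phi_min" using om0 w0 by (simp add: phi')
    qed (use mu_pos mu_a mu_bounds nu0 nu_bounds mu_nu_bounds ct tau0 kappa0 varphi' phi' gamma_G gamma0
        h_min h_max in auto)
  qed
  \<comment> \<open>The same real form \<open>T\<close> is used in all cases, only the split \<open>Neg\<close> changes.\<close>
  have transfer: "l \<le> Re lam \<and> Re lam \<le> h \<and> (\<exists>\<rho>\<ge>0. \<rho>\<^sup>2 = \<rho>2 \<and> \<bar>Im lam\<bar> \<le> \<rho>)"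
    if Neg: "\<forall>i\<in>Neg. G i \<le> 1" "\<forall>i\<in>-Neg. 1 \<le> G i"
      and enc: "bounded_system.enclosed Neg a r G sc.bc sc.Cc sc.Dc w l h \<rho>2" for Neg l h \<rho>2
  proof -
    interpret bs: bounded_system Neg a r G sc.bc sc.Cc sc.Dc w mu_min mu_max nu_min nu_max omega_max
      tau_min tau_max varphi_min varphi_max phi_min phi_max kappa_min kappa_max gamma_min gamma_max h_min h_max
      by (rule bs[OF Neg])
    obtain f where f: "\<And>i. f i * (1 - z * a i) = r i"
      "\<And>i. 1 - y * a i = (if i \<in> Neg then 1 else -1) * r i * f i"
      using rescaling_exists[of y z G a r Neg, OF yz(1) G_def r_def] Neg by blast
    show ?thesis
      using bs.eigenvalue_enclosure[OF enc f(1) f(2)[folded bs.sg_def] G_def]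
        sc.coords_eigenpair[OF pair[unfolded K]] by blast
  qed
  have case1: "Min {mu_min,
             h_min varphi_max + phi_min * (1 - varphi_max),
             gamma_min * nu_min / g1 xihat} * g1 xihat \<le> Re lam \<and>
        Re lam \<le> Max {mu_max,
             h_max varphi_max + phi_max * (1 - varphi_min),
             gamma_max * nu_max / g2 xihat} * g2 xihat \<and>
        (\<exists>rho\<ge>0.
           rho\<^sup>2 = omega_max - phi_max
             + phi_max * varrho (gamma_max * varphi_max) (gamma_min * varphi_min)
             + nu_max * lambda_max ((mat 1 - YA ** A) ** (mat 1 - ZA ** A) ** matrix_inv MA ** A) \<and>
           \<bar>Im lam\<bar> \<le>rho)" if g: "gamma_max \<le> 1"
  proof -
    have Neg: "\<forall>i\<in>UNIV. G i \<le> 1" "\<forall>i\<in>-UNIV. 1 \<le> G i"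
      using order_trans[OF gamma_G(2) g] by auto
    interpret bs: bounded_system UNIV a r G sc.bc sc.Cc sc.Dc w mu_min mu_max nu_min nu_max omega_max
      tau_min tau_max varphi_min varphi_max phi_min phi_max kappa_min kappa_max gamma_min gamma_max h_min h_max
      by (rule bs[OF Neg])
    show ?thesis
      using transfer[OF Neg bs.enclosed_gamma_le_1[OF refl \<delta>1]] unfolding xihat \<delta>1_def .
  qed
  have case2: "Min {mu_min * g1 xi1,
             nu_min * g1 xi1,
             h_min (mu_max * varphi_max) + phi_min * (1 - mu_max * varphi_max)} \<le> Re lam \<and>
        Re lam \<le> Max {mu_max * g2 xi1,
             nu_max * g2 xi1,
             h_max (mu_max * varphi_max) + phi_max * (1 - mu_min * varphi_min)} \<and>
        (\<exists>rho\<ge>0.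
           rho\<^sup>2 = omega_max - phi_max
             + phi_max * ((mu_max - 1) * mu_max * varphi_max
                          + varrho (mu_max * varphi_max) (mu_min * varphi_min)) \<and>
           \<bar>Im lam\<bar> \<le>rho)" if g: "1 \<le> gamma_min"
  proof -
    have G1: "1 \<le> G i" for i using gamma_G(1)[of i] g by simp
    have Neg: "\<forall>i\<in>{}. G i \<le> 1" "\<forall>i\<in>-{}. 1 \<le> G i"
      using G1 by auto
    interpret bs: bounded_system "{}" a r G sc.bc sc.Cc sc.Dc w mu_min mu_max nu_min nu_max omega_max
      tau_min tau_max varphi_min varphi_max phi_min phi_max kappa_min kappa_max gamma_min gamma_max h_min h_max
      by (rule bs[OF Neg])
    \<comment> \<open>If \<open>y = z\<close>, then \<open>G i \<ge> 1\<close> forces \<open>a i = 1\<close>.\<close>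
    have Ga: "G i = a i" for i
    proof -
      have "y = z \<Longrightarrow> (1 - a i)\<^sup>2 \<le> 0"
        using yz(1) G1[of i] by (auto simp: G_def power2_eq_square algebra_simps)
      then show ?thesis using yz(1) G1[of i] by (auto simp: G_def)
    qed
    show ?thesis
      using transfer[OF Neg bs.enclosed_gamma_ge_1[OF refl Ga]] unfolding xi1 .
  qed
  have case3: "Min {mu_min,
             h_min (mu_max * varphi_max) + phi_min * (1 - mu_max * varphi_max),
             g1 xi1 / g1 xihat,
             mu_min * nu_min * g1 xi1 / g1 xihat} * g1 xihat \<le> Re lam \<and>
        Re lam \<le> Max {1,
             h_max (mu_max * varphi_max) + phi_max * (1 - varphi_min),
             mu_max * g2 xi1 / g2 xihat,
             nu_max * g2 xi1 / g2 xihat} * g2 xihat \<and>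
        (\<exists>rho\<ge>0.
           rho\<^sup>2 = omega_max - phi_max
             + phi_max * ((mu_max - 1) * mu_max * varphi_max
                          + varrho (mu_max * varphi_max) (mu_min * varphi_min))
             + nu_max * lambda_max (matrix_inv MA ** A ** (mat 1 - matrix_inv MA ** A)) \<and>
           \<bar>Im lam\<bar> \<le> rho)" if g: "gamma_min < 1" "1 < gamma_max"
  proof -
    \<comment> \<open>An entry \<open>G j > 1\<close> excludes \<open>y = z\<close>.\<close>
    obtain j where j: "1 < G j"
      using g(2) by (auto simp: gamma' Max_gr_iff)
    have "\<not> (y = 1 \<and> z = 1)" using j zero_le_power2[of "1 - a j"]
      by (auto simp: G_def power2_eq_square algebra_simps)
    then have Ga: "G i = a i" for i using yz(1) j by (auto simp: G_def)
    define Neg where "Neg = {i. a i \<le> 1}"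
    have Neg: "\<forall>i\<in>Neg. G i \<le> 1" "\<forall>i\<in>-Neg. 1 \<le> G i"
      by (auto simp: Neg_def Ga)
    interpret bs: bounded_system Neg a r G sc.bc sc.Cc sc.Dc w mu_min mu_max nu_min nu_max omega_max
      tau_min tau_max varphi_min varphi_max phi_min phi_max kappa_min kappa_max gamma_min gamma_max h_min h_max
      by (rule bs[OF Neg])
    obtain k where k: "G k < 1"
      using g(1) by (auto simp: gamma' Min_less_iff)
    have "0 \<le> \<delta>3"
      by (rule order_trans[OF mult_nonneg_nonneg \<delta>3[of k]]) (use k a_pos[of k] in \<open>simp_all add: Ga\<close>)
    moreover have "mu_min \<le> 1" "1 \<le> mu_max"
      using mu_a(1)[of k] mu_a(2)[of j] j k by (simp_all add: Ga)
    ultimately have "bs.enclosed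
        (Min {mu_min, h_min (mu_max * varphi_max) + phi_min * (1 - mu_max * varphi_max),
          g1 xi1 / g1 xihat, mu_min * nu_min * g1 xi1 / g1 xihat} * g1 xihat)
        (Max {1, h_max (mu_max * varphi_max) + phi_max * (1 - varphi_min),
          mu_max * g2 xi1 / g2 xihat, nu_max * g2 xi1 / g2 xihat} * g2 xihat)
        (omega_max - phi_max + phi_max * ((mu_max - 1) * mu_max * varphi_max
          + varrho (mu_max * varphi_max) (mu_min * varphi_min)) + nu_max * \<delta>3)"
      unfolding xi1 xihat using g \<delta>3 by (intro bs.enclosed_gamma_mixed Ga) auto
    then show ?thesis
      using transfer[OF Neg] unfolding \<delta>3_def by blast
  qed
  show ?thesis using case1 case2 case3 by blast
qed

end
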